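(* Suppose that $G$ is Mackey $k$-continuous for some $k\in\mathbb N\sqcup\{\mathrm{lip},\infty,\mathrm c\}$, and additionally abelian if $k=\mathrm c$. Let $I\subseteq\mathbb R$ be open and let $\Phi\colon I\times[0,1]\to\mathfrak g$ satisfy $\Phi(z,\cdot)\in\mathrm D_k$ for each $z\in I$. Let $x\in I$ be such that a) for each $t\in[0,1]$ the map $z\mapsto\Phi(z,t)$ is differentiable at $z=x$ with derivative $(\partial_z\Phi)(x,t)$, and $(\partial_z\Phi)(x,\cdot)\in C^k([0,1],\mathfrak g)$; b) for each $p\in\mathfrak P$ and $s\preceq k$ there exist $L_{p,s}\ge0$ and an open $I_{p,s}\subseteq I$ with $x\in I_{p,s}$ such that $$\frac1{|h|}\cdot p^s_{\mathfrak g,\infty}\big(\Phi(x+h,\cdot)-\Phi(x,\cdot)\big)\le L_{p,s}\qquad\text{for all }h\in\mathbb R\setminus\{0\}\text{ with }x+h\in I_{p,s}.$$ Then $$\lim_{h\to0}\frac1h\cdot\Xi\big(\mathrm{Evol}(\Phi(x,\cdot))(t)^{-1}\cdot\mathrm{Evol}(\Phi(x+h,\cdot))(t)\big)=\int_0^t\big(d_e\Xi\circ\mathrm{Ad}_{\mathrm{Evol}(\Phi(x,\cdot))(s)^{-1}}\big)(\partial_z\Phi(x,s))\,ds\in\overline E$$ holds uniformly in $t\in[0,1]$. In particular, $$\frac{d}{dh}\Big|_{h=0}\mathrm{evol}(\Phi(x+h,\cdot))=d_eL_{\mathrm{evol}(\Phi(x,\cdot))}\Big(\int_0^1\mathrm{Ad}_{\mathrm{Evol}(\Phi(x,\cdot))(s)^{-1}}(\partial_z\Phi(x,s))\,ds\Big)$$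 holds if and only if the Riemann integral on the right side exists in $\mathfrak g$.
   Context: $\mathbb N=\{0,1,2,\dots\}$. $G$ is a Lie group in Milnor's infinite-dimensional sense: a smooth Hausdorff manifold modelled on a real Hausdorff locally convex vector space $E$ (no completeness assumed) with smooth group operations, where $C^k$ is understood in Bastiani's sense (iterated directional derivatives of order $p\le k$ exist and define continuous maps $(x,v_1,\dots,v_p)\mapsto d^p_xf(v_1,\dots,v_p)$). $e$ is the unit, $\mathfrak g=T_eG$, $L_g(h)=gh$, $R_g(h)=hg$, $\mathrm{Ad}_g=d_e(h\mapsto ghg^{-1})$. $\mathfrak P$ is the set of continuous seminorms on $E$; $\overline p$ is the continuous extension of $p\in\mathfrak P$ to the completion $\overline E$. $\Xi\colon G\supseteq\mathcal U\to\mathcal V\subseteq E$ is a fixed chart with $e\in\mathcal U$, $\Xi(e)=0$, $\mathcal V$ convex, and $p_{\mathfrak g}:=p\circ d_e\Xi$ for $p\in\mathfrak P$. Curves: a curve on a compact interval is of class $C^k$ ($k\in\mathbb N\sqcup\{\infty\}$) if it is the restriction of a $C^k$-curve on an open interval. $C^{\mathrm{lip}}([0,1],\mathfrak g)$ is the set of curves $\gamma$ with $\mathrm{Lip}(p_{\mathfrak g},\gamma):=\sup_{t\ne t'}p_{\mathfrak g}(\gamma(t)-\gamma(t'))/|t-t'|<\infty$ for all $p\in\mathfrak P$; $C^{\mathrm c}([0,1],\mathfrak g)$ is the set of constant curves. $s\preceq k$ means: $s=\mathrm{lip}$ if $k=\mathrm{lip}$; $s\in\mathbb N$, $s\le k$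 if $k\in\mathbb N$; $s\in\mathbb N$ if $k=\infty$; $s=0$ if $k=\mathrm c$. $p^{s}_{\mathfrak g,\infty}(\gamma):=\sup\{p_{\mathfrak g}(\gamma^{(m)}(t)):0\le m\le s,\ t\in[0,1]\}$ for $s\in\mathbb N$ and $p^{\mathrm{lip}}_{\mathfrak g,\infty}(\gamma):=\max(\sup_tp_{\mathfrak g}(\gamma(t)),\mathrm{Lip}(p_{\mathfrak g},\gamma))$. Evolution: for $\mu\in C^1([0,1],G)$ let $\delta^r(\mu)(t)=d_{\mu(t)}R_{\mu(t)^{-1}}(\dot\mu(t))$, and $\mathrm D=\{\delta^r(\mu):\mu\in C^1([0,1],G)\}$. On $\mathrm D$, $\mathrm{Evol}(\delta^r(\mu)):=\mu\cdot\mu(0)^{-1}$ and $\mathrm{evol}(\phi):=\mathrm{Evol}(\phi)(1)$ are well defined. $\mathrm D_k:=\mathrm D\cap C^k([0,1],\mathfrak g)$. Mackey $k$-continuity: $\{\phi_n\}\rightharpoonup_{\mathfrak m.k}\phi$ for $\phi_n,\phi\in C^k([0,1],\mathfrak g)$ means that there are constants $c^s_p\ge0$, $l^s_p\in\mathbb N$ ($p\in\mathfrak P$, $s\preceq k$) and a sequence $\lambda_n\ge0$, $\lambda_n\to0$, with $p^s_{\mathfrak g,\infty}(\phi-\phi_n)\le c^s_p\cdot\lambda_n$ for all $n\ge l^s_p$, $p\in\mathfrak P$, $s\preceq k$. $G$ is Mackey $k$-continuous if for all $\phi_n,\phi\in\mathrm D_k$ with $\{\phi_n\}\rightharpoonup_{\mathfrak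 m.k}\phi$: for each neighbourhood $U$ of $e$ there is $n_U$ with $\mathrm{Evol}(\phi)(t)^{-1}\mathrm{Evol}(\phi_n)(t)\in U$ for all $t\in[0,1]$, $n\ge n_U$. Uniform limits: $\lim_{h\to0}\alpha(h,t)=\beta(t)\in\overline E$ uniformly in $t$ means $\lim_{h\to0}\sup_t\overline p(\alpha(h,t)-\beta(t))=0$ for each $p\in\mathfrak P$; for expressions involving $\Xi$ this includes that the argument of $\Xi$ lies in $\mathcal U$ for all $t$ once $|h|$ is small enough. Riemann integrals of continuous curves take values in the completion of the respective space. A derivative $\frac{d}{dh}|_{h=0}f(h)$ of a $G$-valued map exists if, in a chart around $f(0)$, the difference quotient converges in $E$; the derivative is then the corresponding vector in $T_{f(0)}G$. *)

theory Defs
  imports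
    "HOL-Analysis.Analysis"
    "HOL-Algebra.Group"
    "HOL-Library.Extended_Nat"
begin

section \<open>Locally convex spaces\<close>

text \<open>Real Hausdorff locally convex vector spaces; no completeness is assumed.\<close>

class locally_convex_space = real_vector + t2_space + topological_ab_group_add +
  assumes tendsto_scaleR_Pair:
      "((\<lambda>p. fst p *\<^sub>R snd p) \<longlongrightarrow> a *\<^sub>R b) (nhds (a::real) \<times>\<^sub>F nhds b)"
    and locally_convex:
      "open U \<Longrightarrow> 0 \<in> U \<Longrightarrow> \<exists>V. open V \<and> 0 \<in> V \<and> V \<subseteq> U \<and>
         (\<forall>x\<in>V. \<forall>y\<in>V. \<forall>u\<ge>0. \<forall>v\<ge>0. u + v = 1 \<longrightarrow> u *\<^sub>R x + v *\<^sub>R y \<in> V)"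

lemma locally_convex_convex:
  fixes U :: "'a::locally_convex_space set"
  assumes "open U" "0 \<in> U"
  shows "\<exists>V. open V \<and> convex V \<and> 0 \<in> V \<and> V \<subseteq> U"
  using locally_convex[OF assms] unfolding convex_def by blast

definition cont_seminorms :: "('a::{real_vector,topological_space} \<Rightarrow> real) set" where
  "cont_seminorms = {p. (\<forall>x y. p (x + y) \<le> p x + p y) \<and> (\<forall>c x. p (c *\<^sub>R x) = \<bar>c\<bar> * p x) \<and>
     continuous_on UNIV p}"

text \<open>A completion of \<open>'a\<close> is a linear topological embedding \<open>j\<close> with dense range into a complete
  space \<open>'b\<close>. The classes on \<open>'b\<close> make its uniformity the one induced by its vector space topology.
  Completions are unique up to a unique topological isomorphism.\<close>

definition is_completion ::
  "('a::locally_convex_space \<Rightarrow>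
    'b::{locally_convex_space,uniform_topological_group_add,complete_uniform_space}) \<Rightarrow> bool" where
  "is_completion j \<longleftrightarrow> linear j \<and> inj j \<and> homeomorphism UNIV (range j) j (inv_into UNIV j) \<and>
     closure (range j) = UNIV"

text \<open>The continuous extension of \<open>p\<close> along \<open>j\<close>.\<close>

definition ext_seminorm ::
  "('a \<Rightarrow> 'b::topological_space) \<Rightarrow> ('a \<Rightarrow> real) \<Rightarrow> 'b \<Rightarrow> real" where
  "ext_seminorm j p = (THE q. continuous_on UNIV q \<and> (\<forall>x. q (j x) = p x))"

text \<open>Riemann (not Henstock--Kurzweil) integral: the gauge is constant, so \<open>v\<close> is the limit of
  the Riemann sums as the mesh tends to zero.\<close>

definition has_riemann_integral ::
  "(real \<Rightarrow> 'a::{real_vector,topological_space}) \<Rightarrow> 'a \<Rightarrow> real \<Rightarrow> real \<Rightarrow> bool" where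
  "has_riemann_integral f v a b \<longleftrightarrow>
     (\<forall>U. open U \<and> v \<in> U \<longrightarrow>
       (\<exists>\<delta>>0. \<forall>P. P tagged_division_of {a..b} \<and> (\<lambda>x. ball x \<delta>) fine P \<longrightarrow>
          (\<Sum>(x, K)\<in>P. Henstock_Kurzweil_Integration.content K *\<^sub>R f x) \<in> U))"


section \<open>Bastiani differentiability\<close>

definition ddir :: "('a::real_vector \<Rightarrow> 'b::{real_vector,t2_space}) \<Rightarrow> 'a \<Rightarrow> 'a \<Rightarrow> 'b" where
  "ddir f x v = Lim (at (0::real)) (\<lambda>h. (1 / h) *\<^sub>R (f (x + h *\<^sub>R v) - f x))"

text \<open>\<open>bdiff p f x v\<close> is the iterated directional derivative of \<open>f\<close> at \<open>x\<close> along
  \<open>v 0, \<dots>, v (p - 1)\<close>. The directions form a sequence of which only the first \<open>p\<close> entries matter;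
  with the product topology on sequences, joint continuity in \<open>(x, v)\<close> is therefore joint continuity
  in \<open>x\<close> and these \<open>p\<close> vectors.\<close>

primrec bdiff ::
  "nat \<Rightarrow> ('a::real_vector \<Rightarrow> 'b::{real_vector,t2_space}) \<Rightarrow> 'a \<Rightarrow> (nat \<Rightarrow> 'a) \<Rightarrow> 'b" where
  "bdiff 0 f x v = f x"
| "bdiff (Suc p) f x v = ddir (\<lambda>y. bdiff p f y v) x (v p)"

definition bastiani ::
  "enat \<Rightarrow> 'a::{real_vector,topological_space} set \<Rightarrow> ('a \<Rightarrow> 'b::{real_vector,t2_space}) \<Rightarrow> bool" where
  "bastiani k U f \<longleftrightarrow> open U \<and>
     (\<forall>p. enat (Suc p) \<le> k \<longrightarrow> (\<forall>x\<in>U. \<forall>v. \<exists>l.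
        ((\<lambda>h::real. (1 / h) *\<^sub>R (bdiff p f (x + h *\<^sub>R v p) v - bdiff p f x v)) \<longlongrightarrow> l) (at 0))) \<and>
     (\<forall>p. enat p \<le> k \<longrightarrow> continuous_on (U \<times> UNIV) (\<lambda>(x, v). bdiff p f x v))"

text \<open>Iterated derivatives of a curve on the unit interval, one-sided at the end points.\<close>

primrec cderiv :: "nat \<Rightarrow> (real \<Rightarrow> 'a::{real_vector,t2_space}) \<Rightarrow> real \<Rightarrow> 'a" where
  "cderiv 0 \<gamma> t = \<gamma> t"
| "cderiv (Suc m) \<gamma> t =
     Lim (at t within {0..1}) (\<lambda>s. (1 / (s - t)) *\<^sub>R (cderiv m \<gamma> s - cderiv m \<gamma> t))"

text \<open>On the unit interval, \<open>\<gamma>\<close> agrees with a curve that has property \<open>P\<close> on a larger open interval.\<close>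

definition extends_with :: "(real set \<Rightarrow> (real \<Rightarrow> 'a) \<Rightarrow> bool) \<Rightarrow> (real \<Rightarrow> 'a) \<Rightarrow> bool" where
  "extends_with P \<gamma> \<longleftrightarrow>
     (\<exists>a b \<nu>. a < 0 \<and> 1 < b \<and> P {a<..<b} \<nu> \<and> (\<forall>t\<in>{0..1}. \<gamma> t = \<nu> t))"


section \<open>Manifolds modelled on locally convex spaces\<close>

text \<open>A chart is a pair of a domain and a map that matters only on that domain.\<close>

type_synonym ('g, 'e) chart = "'g set \<times> ('g \<Rightarrow> 'e)"

definition chart_inv :: "('g, 'e) chart \<Rightarrow> 'e \<Rightarrow> 'g" where
  "chart_inv c = inv_into (fst c) (snd c)"

definition is_chart :: "('g::topological_space, 'e::topological_space) chart \<Rightarrow> bool" where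
  "is_chart c \<longleftrightarrow> open (fst c) \<and> open (snd c ` fst c) \<and>
     homeomorphism (fst c) (snd c ` fst c) (snd c) (chart_inv c)"

definition smooth_transition ::
  "('g, 'e::{real_vector,t2_space}) chart \<Rightarrow> ('g, 'e) chart \<Rightarrow> bool" where
  "smooth_transition c c' \<longleftrightarrow>
     bastiani \<infinity> (snd c ` (fst c \<inter> fst c')) (snd c' \<circ> chart_inv c)"

definition maximal_atlas ::
  "('g::topological_space, 'e::{real_vector,t2_space}) chart set \<Rightarrow> bool" where
  "maximal_atlas A \<longleftrightarrow> (\<forall>c\<in>A. is_chart c) \<and> (\<Union>c\<in>A. fst c) = UNIV \<and>
     (\<forall>c\<in>A. \<forall>c'\<in>A. smooth_transition c c') \<and>
     (\<forall>c. is_chart c \<and> (\<forall>c'\<in>A. smooth_transition c c' \<and> smooth_transition c' c) \<longrightarrow> c \<in> A)"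

text \<open>\<open>C\<^sup>k\<close>-maps between manifolds. Any atlas of a smooth structure, maximal or not, gives the same
  notion, so products and vector spaces enter through the two simple atlases below.\<close>

definition prod_atlas ::
  "('g, 'e) chart set \<Rightarrow> ('h, 'f) chart set \<Rightarrow> ('g \<times> 'h, 'e \<times> 'f) chart set" where
  "prod_atlas A B = {(fst a \<times> fst b, map_prod (snd a) (snd b)) | a b. a \<in> A \<and> b \<in> B}"

definition vs_atlas :: "('a, 'a) chart set" where
  "vs_atlas = {(UNIV, id)}"

definition Ck_map ::
  "('g::topological_space, 'e::{real_vector,t2_space}) chart set \<Rightarrow>
   ('h::topological_space, 'f::{real_vector,t2_space}) chart set \<Rightarrow>
   enat \<Rightarrow> 'g set \<Rightarrow> ('g \<Rightarrow> 'h) \<Rightarrow> bool" where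
  "Ck_map A B k U f \<longleftrightarrow> open U \<and> continuous_on U f \<and>
     (\<forall>a\<in>A. \<forall>b\<in>B. bastiani k (snd a ` (fst a \<inter> U \<inter> f -` fst b)) (snd b \<circ> f \<circ> chart_inv a))"


section \<open>Tangent vectors\<close>

text \<open>A tangent vector at \<open>g\<close> is the family of its coordinates with respect to all charts around
  \<open>g\<close>, related by the differentials of the transition maps (and \<open>0\<close> at all other indices). The type
  below carries the pointwise operations and the product topology. Hence the tangent space at \<open>g\<close> is
  a closed linear subspace, with the topology for which each coordinate map is a linear
  homeomorphism onto the modelling space. The differential of a chart \<open>c\<close> at \<open>g\<close> is the evaluation
  at \<open>c\<close>.\<close>

datatype ('g, 'e) tvec = Tvec (coord: "('g, 'e) chart \<Rightarrow> 'e")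

instantiation tvec :: (type, real_vector) real_vector
begin

definition "0 = Tvec (\<lambda>c. 0)"
definition "\<xi> + \<eta> = Tvec (\<lambda>c. coord \<xi> c + coord \<eta> c)"
definition "\<xi> - \<eta> = Tvec (\<lambda>c. coord \<xi> c - coord \<eta> c)"
definition "- \<xi> = Tvec (\<lambda>c. - coord \<xi> c)"
definition "r *\<^sub>R \<xi> = Tvec (\<lambda>c. r *\<^sub>R coord \<xi> c)"

instance
  by standard
    (auto simp: zero_tvec_def plus_tvec_def minus_tvec_def uminus_tvec_def scaleR_tvec_def
      algebra_simps tvec.expand)

end

instantiation tvec :: (type, topological_space) topological_space
begin

definition open_tvec :: "('a, 'b) tvec set \<Rightarrow> bool" where
  "open_tvec U \<longleftrightarrow> open (Tvec -` U)"

instance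
  by standard (auto simp: open_tvec_def vimage_Union)

end

lemma continuous_on_coord: "continuous_on UNIV (\<lambda>\<xi>::('g, 'e::topological_space) tvec. coord \<xi> c)"
proof -
  have "open ((\<lambda>\<xi>::('g, 'e) tvec. coord \<xi> c) -` U)" if "open U" for U
  proof -
    have "open ((\<lambda>f::('g, 'e) chart \<Rightarrow> 'e. f c) -` U)"
      using that continuous_on_product_coordinates[of c] by (auto intro: open_vimage)
    then show ?thesis
      by (simp add: open_tvec_def vimage_def)
  qed
  then show ?thesis
    by (simp add: continuous_on_open_vimage)
qed

instance tvec :: (type, t2_space) t2_space
proof
  fix \<xi> \<eta> :: "('a, 'b) tvec"
  assume "\<xi> \<noteq> \<eta>"
  then have "coord \<xi> \<noteq> coord \<eta>"
    by (auto intro: tvec.expand)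
  then obtain c where "coord \<xi> c \<noteq> coord \<eta> c"
    by blast
  then obtain U V where UV: "open U" "open V" "coord \<xi> c \<in> U" "coord \<eta> c \<in> V" "U \<inter> V = {}"
    using hausdorff by meson
  have "open ((\<lambda>\<zeta>::('a, 'b) tvec. coord \<zeta> c) -` U)" "open ((\<lambda>\<zeta>::('a, 'b) tvec. coord \<zeta> c) -` V)"
    using UV by (auto intro: open_vimage continuous_on_coord)
  moreover have "\<xi> \<in> (\<lambda>\<zeta>. coord \<zeta> c) -` U" "\<eta> \<in> (\<lambda>\<zeta>. coord \<zeta> c) -` V"
      "(\<lambda>\<zeta>. coord \<zeta> c) -` U \<inter> (\<lambda>\<zeta>. coord \<zeta> c) -` V = {}"
    using UV by auto
  ultimately show "\<exists>U V. open U \<and> open V \<and> \<xi> \<in> U \<and> \<eta> \<in> V \<and> U \<inter> V = {}"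
    by blast
qed

definition charts_at :: "('g, 'e) chart set \<Rightarrow> 'g \<Rightarrow> ('g, 'e) chart set" where
  "charts_at A g = {c \<in> A. g \<in> fst c}"

definition tangent_space ::
  "('g, 'e::{real_vector,t2_space}) chart set \<Rightarrow> 'g \<Rightarrow> ('g, 'e) tvec set" where
  "tangent_space A g = {\<xi>.
     (\<forall>c\<in>charts_at A g. \<forall>c'\<in>charts_at A g.
        coord \<xi> c' = ddir (snd c' \<circ> chart_inv c) (snd c g) (coord \<xi> c)) \<and>
     (\<forall>c. c \<notin> charts_at A g \<longrightarrow> coord \<xi> c = 0)}"

definition d_chart :: "('g, 'e) chart \<Rightarrow> ('g, 'e) tvec \<Rightarrow> 'e" where
  "d_chart c \<xi> = coord \<xi> c"

text \<open>The tangent map of \<open>f\<close> at \<open>g\<close>; the choice of the source chart is immaterial when \<open>f\<close> is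
  \<open>C\<^sup>1\<close>.\<close>

definition tmap ::
  "('g, 'e::{real_vector,t2_space}) chart set \<Rightarrow> ('g \<Rightarrow> 'g) \<Rightarrow> 'g \<Rightarrow>
   ('g, 'e) tvec \<Rightarrow> ('g, 'e) tvec" where
  "tmap A f g \<xi> = Tvec (\<lambda>c'. if c' \<in> charts_at A (f g)
     then (let c = (SOME c. c \<in> charts_at A g)
           in ddir (snd c' \<circ> f \<circ> chart_inv c) (snd c g) (coord \<xi> c))
     else 0)"

definition velocity ::
  "('g, 'e::{real_vector,t2_space}) chart set \<Rightarrow> (real \<Rightarrow> 'g) \<Rightarrow> real \<Rightarrow> ('g, 'e) tvec" where
  "velocity A \<mu> t = Tvec (\<lambda>c. if c \<in> charts_at A (\<mu> t)
     then Lim (at t within {0..1}) (\<lambda>s. (1 / (s - t)) *\<^sub>R (snd c (\<mu> s) - snd c (\<mu> t)))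
     else 0)"

text \<open>\<open>w\<close> is the derivative at \<open>h = 0\<close> of the \<open>'g\<close>-valued map \<open>f\<close>.\<close>

definition has_curve_derivative ::
  "('g, 'e::{real_vector,t2_space}) chart set \<Rightarrow> (real \<Rightarrow> 'g) \<Rightarrow> ('g, 'e) tvec \<Rightarrow> bool" where
  "has_curve_derivative A f w \<longleftrightarrow> w \<in> tangent_space A (f 0) \<and>
     (\<exists>c\<in>charts_at A (f 0). (\<forall>\<^sub>F h in at 0. f h \<in> fst c) \<and>
        ((\<lambda>h. (1 / h) *\<^sub>R (snd c (f h) - snd c (f 0))) \<longlongrightarrow> d_chart c w) (at 0))"


section \<open>Lie groups\<close>

record ('g, 'e) lie_group_data = "'g monoid" +
  atlas :: "('g, 'e) chart set"

definition lie_group ::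
  "('g::t2_space, 'e::locally_convex_space, 'm) lie_group_data_scheme \<Rightarrow> bool" where
  "lie_group G \<longleftrightarrow> group G \<and> carrier G = UNIV \<and> maximal_atlas (atlas G) \<and>
     Ck_map (prod_atlas (atlas G) (atlas G)) (atlas G) \<infinity> UNIV (\<lambda>(g, h). g \<otimes>\<^bsub>G\<^esub> h) \<and>
     Ck_map (atlas G) (atlas G) \<infinity> UNIV (\<lambda>g. inv\<^bsub>G\<^esub> g)"

definition lie_algebra ::
  "('g, 'e::{real_vector,t2_space}, 'm) lie_group_data_scheme \<Rightarrow> ('g, 'e) tvec set" where
  "lie_algebra G = tangent_space (atlas G) \<one>\<^bsub>G\<^esub>"

definition Ad ::
  "('g, 'e::{real_vector,t2_space}, 'm) lie_group_data_scheme \<Rightarrow> 'g \<Rightarrow>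
   ('g, 'e) tvec \<Rightarrow> ('g, 'e) tvec" where
  "Ad G g = tmap (atlas G) (\<lambda>h. g \<otimes>\<^bsub>G\<^esub> h \<otimes>\<^bsub>G\<^esub> inv\<^bsub>G\<^esub> g) \<one>\<^bsub>G\<^esub>"

definition C1_curve ::
  "('g::topological_space, 'e::{real_vector,t2_space}, 'm) lie_group_data_scheme \<Rightarrow>
   (real \<Rightarrow> 'g) \<Rightarrow> bool" where
  "C1_curve G \<mu> \<longleftrightarrow> extends_with (Ck_map vs_atlas (atlas G) 1) \<mu>"

definition log_deriv ::
  "('g, 'e::{real_vector,t2_space}, 'm) lie_group_data_scheme \<Rightarrow> (real \<Rightarrow> 'g) \<Rightarrow> real \<Rightarrow>
   ('g, 'e) tvec" where
  "log_deriv G \<mu> t =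
     tmap (atlas G) (\<lambda>h. h \<otimes>\<^bsub>G\<^esub> inv\<^bsub>G\<^esub> (\<mu> t)) (\<mu> t) (velocity (atlas G) \<mu> t)"

text \<open>Curves are total functions on the reals of which only the values on the unit interval
  matter; equality of curves is equality there.\<close>

definition is_primitive ::
  "('g::topological_space, 'e::{real_vector,t2_space}, 'm) lie_group_data_scheme \<Rightarrow>
   (real \<Rightarrow> ('g, 'e) tvec) \<Rightarrow> (real \<Rightarrow> 'g) \<Rightarrow> bool" where
  "is_primitive G \<phi> \<mu> \<longleftrightarrow> C1_curve G \<mu> \<and> (\<forall>t\<in>{0..1}. \<phi> t = log_deriv G \<mu> t)"

definition evol_domain ::
  "('g::topological_space, 'e::{real_vector,t2_space}, 'm) lie_group_data_scheme \<Rightarrow>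
   (real \<Rightarrow> ('g, 'e) tvec) set" where
  "evol_domain G = {\<phi>. \<exists>\<mu>. is_primitive G \<phi> \<mu>}"

text \<open>On the unit interval this does not depend on the choice of \<open>\<mu>\<close>.\<close>

definition Evol ::
  "('g::topological_space, 'e::{real_vector,t2_space}, 'm) lie_group_data_scheme \<Rightarrow>
   (real \<Rightarrow> ('g, 'e) tvec) \<Rightarrow> real \<Rightarrow> 'g" where
  "Evol G \<phi> t = (let \<mu> = (SOME \<mu>. is_primitive G \<phi> \<mu>) in \<mu> t \<otimes>\<^bsub>G\<^esub> inv\<^bsub>G\<^esub> (\<mu> 0))"

definition evol ::
  "('g::topological_space, 'e::{real_vector,t2_space}, 'm) lie_group_data_scheme \<Rightarrow>
   (real \<Rightarrow> ('g, 'e) tvec) \<Rightarrow> 'g" where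
  "evol G \<phi> = Evol G \<phi> 1"


section \<open>Curve spaces and Mackey continuity\<close>

text \<open>\<open>Diff k\<close> with \<open>k :: enat\<close> covers the finite orders and \<open>\<infinity>\<close>.\<close>

datatype curve_class = Diff enat | Lip | Const

datatype norm_index = Ord nat | LipOrd

fun index_le :: "norm_index \<Rightarrow> curve_class \<Rightarrow> bool"  (infix "\<preceq>" 50) where
  "Ord s \<preceq> Diff k \<longleftrightarrow> enat s \<le> k"
| "Ord s \<preceq> Lip \<longleftrightarrow> False"
| "Ord s \<preceq> Const \<longleftrightarrow> s = 0"
| "LipOrd \<preceq> Diff k \<longleftrightarrow> False"
| "LipOrd \<preceq> Lip \<longleftrightarrow> True"
| "LipOrd \<preceq> Const \<longleftrightarrow> False"

text \<open>Suprema are taken in \<^typ>\<open>ereal\<close>, so unbounded families give \<open>\<infinity>\<close>.\<close>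

definition Lip_const :: "('a::ab_group_add \<Rightarrow> real) \<Rightarrow> (real \<Rightarrow> 'a) \<Rightarrow> ereal" where
  "Lip_const q \<gamma> =
     (SUP (t, t')\<in>{(t, t'). t \<in> {0..1} \<and> t' \<in> {0..1} \<and> t \<noteq> t'}.
        ereal (q (\<gamma> t - \<gamma> t') / \<bar>t - t'\<bar>))"

fun sup_seminorm ::
  "('a::{real_vector,t2_space} \<Rightarrow> real) \<Rightarrow> norm_index \<Rightarrow> (real \<Rightarrow> 'a) \<Rightarrow> ereal" where
  "sup_seminorm q (Ord s) \<gamma> = (SUP m\<in>{..s}. SUP t\<in>{0..1}. ereal (q (cderiv m \<gamma> t)))"
| "sup_seminorm q LipOrd \<gamma> = max (SUP t\<in>{0..1}. ereal (q (\<gamma> t))) (Lip_const q \<gamma>)"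

text \<open>\<open>\<Xi>\<close> is the fixed chart around the unit; \<open>p \<circ> d_chart \<Xi>\<close> is the seminorm on the Lie algebra
  induced by \<open>p\<close>.\<close>

fun alg_curves ::
  "('g, 'e::{real_vector,t2_space}, 'm) lie_group_data_scheme \<Rightarrow> ('g, 'e) chart \<Rightarrow>
   curve_class \<Rightarrow> (real \<Rightarrow> ('g, 'e) tvec) set" where
  "alg_curves G \<Xi> (Diff k) =
     {\<gamma>. extends_with (\<lambda>J \<nu>. bastiani k J \<nu> \<and> \<nu> ` J \<subseteq> lie_algebra G) \<gamma>}"
| "alg_curves G \<Xi> Lip =
     {\<gamma>. \<gamma> ` {0..1} \<subseteq> lie_algebra G \<and>
         (\<forall>p\<in>cont_seminorms. Lip_const (p \<circ> d_chart \<Xi>) \<gamma> < \<infinity>)}"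
| "alg_curves G \<Xi> Const = {\<gamma>. \<exists>X\<in>lie_algebra G. \<forall>t\<in>{0..1}. \<gamma> t = X}"

definition evol_domain_k ::
  "('g::topological_space, 'e::{real_vector,t2_space}, 'm) lie_group_data_scheme \<Rightarrow>
   ('g, 'e) chart \<Rightarrow> curve_class \<Rightarrow> (real \<Rightarrow> ('g, 'e) tvec) set" where
  "evol_domain_k G \<Xi> k = evol_domain G \<inter> alg_curves G \<Xi> k"

definition mackey_converges ::
  "('g, 'e::{real_vector,t2_space}) chart \<Rightarrow> curve_class \<Rightarrow>
   (nat \<Rightarrow> real \<Rightarrow> ('g, 'e) tvec) \<Rightarrow> (real \<Rightarrow> ('g, 'e) tvec) \<Rightarrow> bool" where
  "mackey_converges \<Xi> k \<phi>s \<phi> \<longleftrightarrow>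
     (\<exists>(c :: ('e \<Rightarrow> real) \<Rightarrow> norm_index \<Rightarrow> real) (l :: ('e \<Rightarrow> real) \<Rightarrow> norm_index \<Rightarrow> nat)
        (r :: nat \<Rightarrow> real).
        (\<forall>p\<in>cont_seminorms. \<forall>s. s \<preceq> k \<longrightarrow> c p s \<ge> 0) \<and> (\<forall>n. r n \<ge> 0) \<and> r \<longlonglongrightarrow> 0 \<and>
        (\<forall>p\<in>cont_seminorms. \<forall>s. s \<preceq> k \<longrightarrow> (\<forall>n\<ge>l p s.
           sup_seminorm (p \<circ> d_chart \<Xi>) s (\<lambda>t. \<phi> t - \<phi>s n t) \<le> ereal (c p s * r n))))"

definition mackey_continuous ::
  "('g::topological_space, 'e::{real_vector,t2_space}, 'm) lie_group_data_scheme \<Rightarrow>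
   ('g, 'e) chart \<Rightarrow> curve_class \<Rightarrow> bool" where
  "mackey_continuous G \<Xi> k \<longleftrightarrow>
     (\<forall>\<phi>s. \<forall>\<phi>\<in>evol_domain_k G \<Xi> k. (\<forall>n. \<phi>s n \<in> evol_domain_k G \<Xi> k) \<longrightarrow>
        mackey_converges \<Xi> k \<phi>s \<phi> \<longrightarrow>
        (\<forall>U. open U \<and> \<one>\<^bsub>G\<^esub> \<in> U \<longrightarrow>
           (\<exists>N. \<forall>n\<ge>N. \<forall>t\<in>{0..1}. inv\<^bsub>G\<^esub> (Evol G \<phi> t) \<otimes>\<^bsub>G\<^esub> Evol G (\<phi>s n) t \<in> U)))"

definition uniform_limit_completion ::
  "('e::{real_vector,topological_space} \<Rightarrow> 'f::{real_vector,topological_space}) \<Rightarrow>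
   (real \<Rightarrow> real \<Rightarrow> 'e) \<Rightarrow> (real \<Rightarrow> 'f) \<Rightarrow> bool" where
  "uniform_limit_completion j \<alpha> \<beta> \<longleftrightarrow>
     (\<forall>p\<in>cont_seminorms.
        ((\<lambda>h. SUP t\<in>{0..1}. ereal (ext_seminorm j p (j (\<alpha> h t) - \<beta> t))) \<longlongrightarrow> 0) (at 0))"

end

theory Submission
  imports Defs
begin

text \<open>For a small increment \<open>h\<close>, put \<open>\<alpha>\<^sub>h(t) = Evol(\<Phi>(x))(t)\<^sup>-\<^sup>1 Evol(\<Phi>(x+h))(t)\<close>. Mackey continuity, applied along
  arbitrary null sequences, says that \<open>\<alpha>\<^sub>h\<close> tends to the unit uniformly in \<open>t\<close>. In the chart, the
  velocity of \<open>\<alpha>\<^sub>h / h\<close> at \<open>t\<close> is a continuous expression in \<open>t\<close> and \<open>\<alpha>\<^sub>h(t)\<close> which is linear in the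
  difference quotient \<open>(\<Phi>(x+h,t) - \<Phi>(x,t)) / h\<close>, and which at \<open>\<alpha>\<^sub>h(t) = e\<close> is the adjoint action. By
  compactness of the unit interval and linearity, each seminorm of the difference between this
  velocity and the expected integrand is at most a fixed seminorm of the difference between the
  difference quotient and \<open>\<partial>\<^sub>z\<Phi>\<close>, up to a small constant. That bound is a bounded real function of \<open>t\<close>
  tending to \<open>0\<close> pointwise, so its integral tends to \<open>0\<close> by dominated convergence.

  The mean value inequality then shows that, for small \<open>h\<close>, the coordinates of \<open>\<alpha>\<^sub>h / h\<close> are close to
  every fine Riemann sum of the integrand, uniformly in \<open>t\<close>. Hence they form a Cauchy family; its
  limit in the completion is the Riemann integral, and the limit exists in the modelling space
  exactly when the integral does.\<close>

section \<open>Seminorms\<close>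

text \<open>Since \<open>'e\<close> need not be complete, neither the integral nor the limit can be
  named inside it. The estimates therefore compare with finite Riemann sums, which are vectors of
  \<open>'e\<close>, and they integrate real functions only. The outcome,
  \<open>near_riemann_sums\<close>, mentions no limit: it passes through \<open>j\<close> unchanged
  and is used both in the completion, where it produces the limit, and in \<open>'e\<close>, where
  it decides whether a limit exists there. The difference quotients of \<open>\<Phi>\<close>
  converge only pointwise in \<open>t\<close>. Hypothesis b) makes up for this in two ways: with all
  its indices \<open>s\<close> it gives Mackey convergence at rate \<open>\<bar>h\<bar>\<close>, and
  at one index it gives the dominating constant. Differentiation in \<open>G\<close> rests on strict
  difference quotients of the multiplication, where base point, direction and increment all move
  along an arbitrary filter. One statement then serves one-sided limits at the ends of the unit
  interval, rays in charts, and the product filters behind joint continuity.\<close>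

lemma tendsto_scaleR_lcs [tendsto_intros]:
  fixes g :: "'i \<Rightarrow> 'a::locally_convex_space"
  assumes "(f \<longlongrightarrow> a) F" "(g \<longlongrightarrow> b) F"
  shows "((\<lambda>i. f i *\<^sub>R g i) \<longlongrightarrow> a *\<^sub>R b) F"
  using filterlim_compose[OF tendsto_scaleR_Pair, of "\<lambda>i. (f i, g i)" a b F] assms
  by (simp add: nhds_prod[symmetric] tendsto_Pair)

lemma continuous_on_scaleR_lcs [continuous_intros]:
  fixes g :: "'i::topological_space \<Rightarrow> 'a::locally_convex_space"
  assumes "continuous_on S f" "continuous_on S g"
  shows "continuous_on S (\<lambda>i. f i *\<^sub>R g i)"
  using assms unfolding continuous_on_def by (auto intro: tendsto_scaleR_lcs)

lemma seminormD:
  fixes p :: "'a::{real_vector,topological_space} \<Rightarrow> real"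
  assumes "p \<in> cont_seminorms"
  shows seminorm_add: "p (x + y) \<le> p x + p y"
    and seminorm_scaleR: "p (c *\<^sub>R x) = \<bar>c\<bar> * p x"
    and seminorm_cont: "continuous_on UNIV p"
  using assms unfolding cont_seminorms_def by auto

context
  fixes p :: "'a::{real_vector,topological_space} \<Rightarrow> real"
  assumes p: "p \<in> cont_seminorms"
begin

lemma seminorm_zero [simp]: "p 0 = 0"
  using seminorm_scaleR[OF p, of 0 0] by simp

lemma seminorm_minus: "p (- x) = p x"
  using seminorm_scaleR[OF p, of "-1" x] by simp

lemma seminorm_diff_commute: "p (x - y) = p (y - x)"
  using seminorm_minus[of "x - y"] by simp

lemma seminorm_nonneg [simp]: "p x \<ge> 0"
  using seminorm_add[OF p, of x "- x"] seminorm_minus[of x] by simp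

lemma seminorm_diff: "p (x - y) \<le> p x + p y"
  using seminorm_add[OF p, of x "- y"] seminorm_minus[of y] by simp

lemma seminorm_triangle: "p (x - z) \<le> p (x - y) + p (y - z)"
  using seminorm_add[OF p, of "x - y" "y - z"] by simp

lemma seminorm_diff_ge: "p x - p y \<le> p (x - y)"
  using seminorm_add[OF p, of "x - y" y] by simp

lemma seminorm_sum: "p (\<Sum>i\<in>I. f i) \<le> (\<Sum>i\<in>I. p (f i))"
proof (induction I rule: infinite_finite_induct)
  case (insert i I)
  then show ?case
    using seminorm_add[OF p, of "f i" "\<Sum>i\<in>I. f i"] by simp
qed auto

lemma tendsto_seminorm:
  assumes "(f \<longlongrightarrow> l) F"
  shows "((\<lambda>i. p (f i)) \<longlongrightarrow> p l) F"
  by (rule continuous_on_tendsto_compose[OF seminorm_cont[OF p] assms]) auto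

lemma continuous_on_seminorm:
  assumes "continuous_on S f"
  shows "continuous_on S (\<lambda>i. p (f i))"
  using seminorm_cont[OF p] assms by (rule continuous_on_compose2) auto

end

text \<open>Translation and the reverse triangle inequality carry smallness near 0 to continuity at
  every point.\<close>

lemma seminormI:
  fixes p :: "'a::locally_convex_space \<Rightarrow> real"
  assumes add: "\<And>x y. p (x + y) \<le> p x + p y"
    and scale: "\<And>c x. p (c *\<^sub>R x) = \<bar>c\<bar> * p x"
    and cont: "\<And>e. e > 0 \<Longrightarrow> \<forall>\<^sub>F x in nhds 0. p x < e"
  shows "p \<in> cont_seminorms"
proof -
  have "(p \<longlongrightarrow> p x) (nhds x)" for x
  proof (rule tendstoI)
    fix e :: real assume "e > 0"
    have "((\<lambda>y. y - x) \<longlongrightarrow> x - x) (nhds x)"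
      by (intro tendsto_intros) (simp add: filterlim_ident)
    then have "filterlim (\<lambda>y. y - x) (nhds 0) (nhds x)" by simp
    from eventually_compose_filterlim[OF cont[OF \<open>e > 0\<close>] this]
    have "\<forall>\<^sub>F y in nhds x. p (y - x) < e" .
    then show "\<forall>\<^sub>F y in nhds x. dist (p y) (p x) < e"
    proof eventually_elim
      case (elim y)
      have "p y \<le> p (y - x) + p x" using add[of "y - x" x] by simp
      moreover have "p x \<le> p (x - y) + p y" using add[of "x - y" y] by simp
      moreover have "p (x - y) = p (y - x)" using scale[of "-1" "y - x"] by simp
      ultimately show ?case using elim by (simp add: dist_real_def)
    qed
  qed
  then have "continuous_on UNIV p"
    unfolding continuous_on_def by (metis tendsto_within_subset subset_UNIV tendsto_at_iff_tendsto_nhds)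
  then show ?thesis
    using add scale unfolding cont_seminorms_def by auto
qed

text \<open>The Minkowski functional of a symmetric convex neighbourhood.\<close>

lemma exists_seminorm_zero:
  fixes U :: "'a::locally_convex_space set"
  assumes "open U" "0 \<in> U"
  obtains p where "p \<in> cont_seminorms" "\<And>x. p x < 1 \<Longrightarrow> x \<in> U"
proof -
  obtain V where V: "open V" "convex V" "0 \<in> V" "V \<subseteq> U"
    using locally_convex_convex[OF assms] by blast
  \<comment> \<open>The symmetric part of \<open>V\<close> is used so that its gauge does not see
    the sign of a scalar.\<close>
  define W where "W = V \<inter> uminus -` V"
  have "open W"
    unfolding W_def by (intro open_Int V open_vimage continuous_intros)
  have "convex W"
    unfolding W_def
  proof (rule convex_Int[OF V(2)])
    have "uminus -` V = uminus ` V" by force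
    then show "convex (uminus -` V)"
      using convex_negations[OF V(2)] by simp
  qed
  have W0: "0 \<in> W" and WU: "W \<subseteq> U" and Wm: "x \<in> W \<Longrightarrow> - x \<in> W" for x
    using V unfolding W_def by auto
  define S where "S x = {r. r > 0 \<and> (1 / r) *\<^sub>R x \<in> W}" for x
  define p where "p x = Inf (S x)" for x
  have bdd: "bdd_below (S x)" for x
    unfolding S_def by (rule bdd_belowI[of _ 0]) auto
  have ne: "S x \<noteq> {}" for x
  proof -
    have "((\<lambda>r::real. 1 / r) \<longlongrightarrow> 0) at_top"
      using tendsto_inverse_0_at_top[OF filterlim_ident] by (simp add: inverse_eq_divide)
    from tendsto_scaleR_lcs[OF this tendsto_const, of x]
    have "((\<lambda>r::real. (1 / r) *\<^sub>R x) \<longlongrightarrow> 0 *\<^sub>R x) at_top" .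
    then have "\<forall>\<^sub>F r in at_top. (1 / r) *\<^sub>R x \<in> W"
      using \<open>open W\<close> W0 by (auto simp: tendsto_def)
    then have "\<forall>\<^sub>F r in at_top. (1 / r) *\<^sub>R x \<in> W \<and> r > 0"
      using eventually_gt_at_top[of 0] by eventually_elim auto
    then obtain r where "(1 / r) *\<^sub>R x \<in> W" "r > 0"
      using eventually_happens by fastforce
    then show ?thesis unfolding S_def by auto
  qed
  \<comment> \<open>Shrinking a vector towards 0 stays in the convex set \<open>W\<close>, so
    \<open>S x\<close> is closed upwards and contains every number above its infimum.\<close>
  have up: "r' \<in> S x" if "r \<in> S x" "r \<le> r'" for r r' x
  proof -
    have r: "r > 0" "(1 / r) *\<^sub>R x \<in> W" "r' > 0" using that unfolding S_def by auto
    have "(r / r') *\<^sub>R ((1 / r) *\<^sub>R x) + (1 - r / r') *\<^sub>R 0 \<in> W"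
      using r that by (intro convexD[OF \<open>convex W\<close>] W0) auto
    then show ?thesis using r unfolding S_def by simp
  qed
  have S_add: "r + s \<in> S (x + y)" if "r \<in> S x" "s \<in> S y" for r s x y
  proof -
    have r: "r > 0" "(1 / r) *\<^sub>R x \<in> W" "s > 0" "(1 / s) *\<^sub>R y \<in> W" using that unfolding S_def by auto
    have "(r / (r + s)) *\<^sub>R ((1 / r) *\<^sub>R x) + (s / (r + s)) *\<^sub>R ((1 / s) *\<^sub>R y) \<in> W"
      using r by (intro convexD[OF \<open>convex W\<close>]) (auto simp: add_divide_distrib[symmetric])
    moreover have "(r / (r + s)) *\<^sub>R ((1 / r) *\<^sub>R x) + (s / (r + s)) *\<^sub>R ((1 / s) *\<^sub>R y) = (1 / (r + s)) *\<^sub>R (x + y)"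
      using r by (simp add: scaleR_add_right)
    ultimately show ?thesis using r unfolding S_def by simp
  qed
  have S_scale: "\<bar>c\<bar> * r \<in> S (c *\<^sub>R x)" if "r \<in> S x" "c \<noteq> 0" for c r x
  proof -
    have r: "r > 0" "(1 / r) *\<^sub>R x \<in> W" using that unfolding S_def by auto
    have "(1 / (\<bar>c\<bar> * r)) *\<^sub>R (c *\<^sub>R x) = (if c > 0 then (1 / r) *\<^sub>R x else - ((1 / r) *\<^sub>R x))"
      using that r by (auto simp: abs_if)
    then show ?thesis using r Wm that unfolding S_def by auto
  qed
  have lt: "r \<in> S x" if "p x < r" for x r
    using that up[of _ x r] cInf_lessD[OF ne, of x r] unfolding p_def by (meson less_imp_le)
  have le: "p x \<le> r" if "r \<in> S x" for x r
    unfolding p_def by (rule cInf_lower[OF that bdd])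
  have nonneg: "p x \<ge> 0" for x
    unfolding p_def by (rule cInf_greatest[OF ne]) (auto simp: S_def)
  have add: "p (x + y) \<le> p x + p y" for x y
  proof (rule field_le_epsilon)
    fix e :: real assume "e > 0"
    then have "p x + e/2 \<in> S x" "p y + e/2 \<in> S y" by (auto intro: lt)
    from le[OF S_add[OF this]] show "p (x + y) \<le> p x + p y + e" by simp
  qed
  have sc1: "p (c *\<^sub>R x) \<le> \<bar>c\<bar> * p x" if "c \<noteq> 0" for c x
  proof (rule field_le_epsilon)
    fix e :: real assume "e > 0"
    then have "p x + e / \<bar>c\<bar> \<in> S x" using that by (auto intro: lt)
    from le[OF S_scale[OF this that]] that
    show "p (c *\<^sub>R x) \<le> \<bar>c\<bar> * p x + e" by (simp add: distrib_left)
  qed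
  have p0: "p 0 = 0"
  proof (rule antisym[OF field_le_epsilon nonneg])
    fix e :: real assume "e > 0"
    then show "p 0 \<le> 0 + e" using le[of e 0] W0 by (simp add: S_def)
  qed
  have sc: "p (c *\<^sub>R x) = \<bar>c\<bar> * p x" for c x
  proof (cases "c = 0")
    case False
    have "\<bar>c\<bar> * p x = \<bar>c\<bar> * p ((1 / c) *\<^sub>R (c *\<^sub>R x))" using False by simp
    also have "\<dots> \<le> \<bar>c\<bar> * (\<bar>1 / c\<bar> * p (c *\<^sub>R x))"
      using False by (intro mult_left_mono sc1) auto
    also have "\<dots> = p (c *\<^sub>R x)" using False by simp
    finally show ?thesis using sc1[OF False, of x] by simp
  qed (simp add: p0)
  have "p \<in> cont_seminorms"
  proof (rule seminormI[OF add sc])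
    fix e :: real assume "e > 0"
    have "((\<lambda>x. (1 / (e/2)) *\<^sub>R x) \<longlongrightarrow> (1 / (e/2)) *\<^sub>R (0::'a)) (nhds 0)"
      by (intro tendsto_intros filterlim_ident)
    then have "\<forall>\<^sub>F x in nhds 0. (1 / (e/2)) *\<^sub>R x \<in> W"
      using \<open>open W\<close> W0 by (simp add: tendsto_def)
    then show "\<forall>\<^sub>F x in nhds 0. p x < e"
    proof eventually_elim
      case (elim x)
      then have "e/2 \<in> S x" using \<open>e > 0\<close> by (simp add: S_def)
      then show ?case using le[of "e/2" x] \<open>e > 0\<close> by simp
    qed
  qed
  moreover have "x \<in> U" if "p x < 1" for x
    using lt[OF that] WU by (auto simp: S_def)
  ultimately show thesis using that by blast
qed

lemma exists_seminorm:
  fixes U :: "'a::locally_convex_space set"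
  assumes "open U" "a \<in> U"
  obtains p where "p \<in> cont_seminorms" "\<And>x. p (x - a) < 1 \<Longrightarrow> x \<in> U"
proof -
  have "open ((\<lambda>x. x + a) -` U)" "0 \<in> (\<lambda>x. x + a) -` U"
    using assms by (auto intro!: open_vimage continuous_intros)
  then obtain p where p: "p \<in> cont_seminorms" "\<And>x. p x < 1 \<Longrightarrow> x \<in> (\<lambda>x. x + a) -` U"
    by (rule exists_seminorm_zero) blast
  have "x \<in> U" if "p (x - a) < 1" for x
    using p(2)[OF that] by simp
  then show thesis using p(1) that by blast
qed

text \<open>Reduces convergence to estimates for one seminorm at a time; for the converse, a
  seminorm is taken whose unit ball around \<open>l\<close> fits into the given
  neighbourhood.\<close>

lemma tendsto_seminorm_iff:
  fixes f :: "'i \<Rightarrow> 'a::locally_convex_space"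
  shows "(f \<longlongrightarrow> l) F \<longleftrightarrow> (\<forall>p\<in>cont_seminorms. \<forall>e>0. \<forall>\<^sub>F i in F. p (f i - l) < e)"
proof
  assume f: "(f \<longlongrightarrow> l) F"
  show "\<forall>p\<in>cont_seminorms. \<forall>e>0. \<forall>\<^sub>F i in F. p (f i - l) < e"
  proof (intro ballI allI impI)
    fix p :: "'a \<Rightarrow> real" and e :: real
    assume p: "p \<in> cont_seminorms" and "e > 0"
    have "((\<lambda>i. p (f i - l)) \<longlongrightarrow> p (l - l)) F"
      by (intro tendsto_seminorm[OF p] tendsto_intros f)
    then have "((\<lambda>i. p (f i - l)) \<longlongrightarrow> 0) F"
      using p by simp
    then show "\<forall>\<^sub>F i in F. p (f i - l) < e"
      using \<open>e > 0\<close> by (rule order_tendstoD)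
  qed
next
  assume *: "\<forall>p\<in>cont_seminorms. \<forall>e>0. \<forall>\<^sub>F i in F. p (f i - l) < e"
  show "(f \<longlongrightarrow> l) F"
  proof (rule topological_tendstoI)
    fix U assume "open U" "l \<in> U"
    then obtain p where p: "p \<in> cont_seminorms" "\<And>x. p (x - l) < 1 \<Longrightarrow> x \<in> U"
      by (rule exists_seminorm) blast
    have "\<forall>\<^sub>F i in F. p (f i - l) < 1"
      using * p(1) by (auto intro: zero_less_one)
    then show "\<forall>\<^sub>F i in F. f i \<in> U"
      by (rule eventually_mono) (rule p(2))
  qed
qed

lemma eventually_seminorm_less:
  fixes f :: "'i \<Rightarrow> 'a::locally_convex_space"
  assumes "(f \<longlongrightarrow> l) F" "p \<in> cont_seminorms" "e > 0"
  shows "\<forall>\<^sub>F i in F. p (f i - l) < e"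
  using assms unfolding tendsto_seminorm_iff by blast

text \<open>Tube lemma for an arbitrary filter: finitely many neighbourhoods cover \<open>K\<close>,
  and the finitely many conditions on \<open>y\<close> hold simultaneously. Intersecting with
  \<open>principal K\<close> keeps the moving point in \<open>K\<close>, which gives one-sided
  neighbourhoods at the ends of the unit interval.\<close>

lemma compact_eventually_ball:
  assumes "compact K"
    and ev: "\<And>k. k \<in> K \<Longrightarrow> \<forall>\<^sub>F (k', y) in inf (nhds k) (principal K) \<times>\<^sub>F F. P k' y"
  shows "\<forall>\<^sub>F y in F. \<forall>k\<in>K. P k y"
proof -
  have "\<exists>U Q. open U \<and> k \<in> U \<and> eventually Q F \<and> (\<forall>k'\<in>K. k' \<in> U \<longrightarrow> (\<forall>y. Q y \<longrightarrow> P k' y))" if k: "k \<in> K" for k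
  proof -
    obtain R Q where RQ: "eventually R (inf (nhds k) (principal K))" "eventually Q F"
        "\<And>k' y. R k' \<Longrightarrow> Q y \<Longrightarrow> P k' y"
      using ev[OF k] unfolding eventually_prod_filter by (auto simp: split_beta)
    from RQ(1) obtain U where "open U" "k \<in> U" "\<And>k'. k' \<in> U \<Longrightarrow> k' \<in> K \<Longrightarrow> R k'"
      unfolding eventually_inf_principal eventually_nhds by auto
    then show ?thesis using RQ by blast
  qed
  then obtain U Q where UQ: "\<And>k. k \<in> K \<Longrightarrow> open (U k)" "\<And>k. k \<in> K \<Longrightarrow> k \<in> U k"
      "\<And>k. k \<in> K \<Longrightarrow> eventually (Q k) F"
      "\<And>k k' y. k \<in> K \<Longrightarrow> k' \<in> U k \<Longrightarrow> k' \<in> K \<Longrightarrow> Q k y \<Longrightarrow> P k' y"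
    by metis
  obtain C where C: "C \<subseteq> K" "finite C" "K \<subseteq> (\<Union>k\<in>C. U k)"
    by (rule compactE_image[OF \<open>compact K\<close>, of K U]) (use UQ in auto)
  have "\<forall>\<^sub>F y in F. \<forall>k\<in>C. Q k y"
    using C UQ by (intro eventually_ball_finite) auto
  then show ?thesis
  proof eventually_elim
    case (elim y)
    show ?case
    proof
      fix k assume "k \<in> K"
      then obtain c where "c \<in> C" "k \<in> U c" using C by auto
      then show "P k y" using UQ(4)[of c k y] C elim \<open>k \<in> K\<close> by auto
    qed
  qed
qed

text \<open>A basic open set of the product topology constrains only finitely many coordinates.
  Serves the direction sequences of \<open>bdiff\<close> and the coordinate families of
  \<open>tvec\<close>.\<close>

lemma tendsto_funI:
  fixes f :: "'i \<Rightarrow> 'c \<Rightarrow> 'b::topological_space"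
  assumes "\<And>c. ((\<lambda>i. f i c) \<longlongrightarrow> l c) F"
  shows "(f \<longlongrightarrow> l) F"
proof (rule topological_tendstoI)
  fix S :: "('c \<Rightarrow> 'b) set"
  assume "open S" "l \<in> S"
  then obtain X where X: "l \<in> (\<Pi>\<^sub>E c\<in>UNIV. X c)" "\<And>c. open (X c)"
      "finite {c. X c \<noteq> UNIV}" "(\<Pi>\<^sub>E c\<in>UNIV. X c) \<subseteq> S"
    using product_topology_open_contains_basis[of "\<lambda>_. euclidean" UNIV S l]
    by (auto simp: open_fun_def)
  have "\<forall>\<^sub>F i in F. \<forall>c\<in>{c. X c \<noteq> UNIV}. f i c \<in> X c"
  proof (rule eventually_ball_finite[OF X(3)], rule ballI)
    fix c
    have "l c \<in> X c" using X(1) by auto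
    with assms[of c] X(2)[of c] show "\<forall>\<^sub>F i in F. f i c \<in> X c"
      by (rule topological_tendstoD)
  qed
  then show "\<forall>\<^sub>F i in F. f i \<in> S"
  proof (rule eventually_mono)
    fix i assume "\<forall>c\<in>{c. X c \<noteq> UNIV}. f i c \<in> X c"
    then have "f i \<in> (\<Pi>\<^sub>E c\<in>UNIV. X c)" by (auto simp: PiE_iff)
    then show "f i \<in> S" using X(4) by auto
  qed
qed

section \<open>Products of locally convex spaces\<close>

instance prod :: (topological_monoid_add, topological_monoid_add) topological_monoid_add
proof
  fix a b :: "'a \<times> 'b"
  have "((\<lambda>x. (fst (fst x) + fst (snd x), snd (fst x) + snd (snd x))) \<longlongrightarrow>
      (fst a + fst b, snd a + snd b)) (nhds (a, b))"
    by (auto intro!: tendsto_eq_intros filterlim_ident)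
  then show "LIM x nhds a \<times>\<^sub>F nhds b. fst x + snd x :> nhds (a + b)"
    by (simp add: plus_prod_def nhds_prod)
qed

instance prod :: (topological_comm_monoid_add, topological_comm_monoid_add) topological_comm_monoid_add ..

instance prod :: (topological_group_add, topological_group_add) topological_group_add
proof
  fix a :: "'a \<times> 'b"
  have "((\<lambda>x. (- fst x, - snd x)) \<longlongrightarrow> (- fst a, - snd a)) (nhds a)"
    by (auto intro!: tendsto_eq_intros filterlim_ident)
  then show "(uminus \<longlongrightarrow> - a) (nhds a)"
    by (simp add: uminus_prod_def[abs_def] fun_eq_iff)
qed

instance prod :: (topological_ab_group_add, topological_ab_group_add) topological_ab_group_add ..

text \<open>Multiplication is differentiated in product charts, hence as a map on
  \<open>'e \<times> 'e\<close>; this instance makes strict differentiability available for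
  it.\<close>

instance prod :: (locally_convex_space, locally_convex_space) locally_convex_space
proof
  fix a :: real and b :: "'a \<times> 'b"
  have "((\<lambda>x. (fst x *\<^sub>R fst (snd x), fst x *\<^sub>R snd (snd x))) \<longlongrightarrow> (a *\<^sub>R fst b, a *\<^sub>R snd b)) (nhds (a, b))"
    by (auto intro!: tendsto_eq_intros filterlim_ident)
  then show "((\<lambda>p. fst p *\<^sub>R snd p) \<longlongrightarrow> a *\<^sub>R b) (nhds a \<times>\<^sub>F nhds b)"
    by (simp add: scaleR_prod_def nhds_prod)
next
  fix U :: "('a \<times> 'b) set"
  assume "open U" "0 \<in> U"
  then obtain A B where AB: "open A" "open B" "0 \<in> A" "0 \<in> B" "A \<times> B \<subseteq> U"
    by (metis SigmaE mem_Sigma_iff open_prod_elim zero_prod_def)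
  obtain A' where A': "open A'" "convex A'" "0 \<in> A'" "A' \<subseteq> A"
    using locally_convex_convex AB by blast
  obtain B' where B': "open B'" "convex B'" "0 \<in> B'" "B' \<subseteq> B"
    using locally_convex_convex AB by blast
  have "convex (A' \<times> B')" "open (A' \<times> B')" "0 \<in> A' \<times> B'" "A' \<times> B' \<subseteq> U"
    using A' B' AB by (auto simp: zero_prod_def open_Times intro: convex_Times)
  then show "\<exists>V. open V \<and> 0 \<in> V \<and> V \<subseteq> U \<and>
         (\<forall>x\<in>V. \<forall>y\<in>V. \<forall>u\<ge>0. \<forall>v\<ge>0. u + v = 1 \<longrightarrow> u *\<^sub>R x + v *\<^sub>R y \<in> V)"
    by (intro exI[of _ "A' \<times> B'"] conjI ballI allI impI convexD)
qed

section \<open>The mean value inequality and strict differentiability\<close>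

text \<open>With a slack \<open>e * (v - u)\<close> the inequality is additive over adjacent
  intervals, and differentiability at a point gives it on all short intervals around that point.
  Bisection then yields it on \<open>{a..b}\<close>, and the slack tends to 0.\<close>

lemma seminorm_mean_value:
  fixes c :: "real \<Rightarrow> 'a::locally_convex_space" and G :: "real \<Rightarrow> real"
  assumes p: "p \<in> cont_seminorms" and "a \<le> b"
    and c: "\<And>s. s \<in> {a..b} \<Longrightarrow> ((\<lambda>r. (1 / (r - s)) *\<^sub>R (c r - c s)) \<longlongrightarrow> c' s) (at s within {a..b})"
    and G: "\<And>s. s \<in> {a..b} \<Longrightarrow> (G has_real_derivative G' s) (at s within {a..b})"
    and le: "\<And>s. s \<in> {a..b} \<Longrightarrow> p (c' s) \<le> G' s"
  shows "p (c b - c a) \<le> G b - G a"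
proof -
  define Q where "Q e u v \<longleftrightarrow>
    (a \<le> u \<and> v \<le> b \<and> u \<le> v \<longrightarrow> p (c v - c u) \<le> G v - G u + e * (v - u))" for e u v
  have main: "Q e a b" if "e > 0" for e
    using \<open>a \<le> b\<close>
  proof (induction rule: Bolzano)
    case (trans u v w)
    show ?case
      unfolding Q_def
    proof
      assume uw: "a \<le> u \<and> w \<le> b \<and> u \<le> w"
      then have "p (c v - c u) \<le> G v - G u + e * (v - u)" "p (c w - c v) \<le> G w - G v + e * (w - v)"
        using trans by (auto simp: Q_def)
      moreover have "p (c w - c u) \<le> p (c w - c v) + p (c v - c u)"
        by (rule seminorm_triangle[OF p])
      ultimately show "p (c w - c u) \<le> G w - G u + e * (w - u)"
        by (simp add: algebra_simps)
    qed
  next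
    case (local x)
    then have x: "x \<in> {a..b}" by auto
    have "\<forall>\<^sub>F r in at x within {a..b}. p ((1 / (r - x)) *\<^sub>R (c r - c x) - c' x) < e / 2"
      using \<open>e > 0\<close> by (intro eventually_seminorm_less[OF c[OF x] p]) simp
    moreover have "\<forall>\<^sub>F r in at x within {a..b}. dist ((G r - G x) / (r - x)) (G' x) < e / 2"
      using \<open>e > 0\<close> by (intro tendstoD[OF G[OF x, unfolded has_field_derivative_iff]]) simp
    \<comment> \<open>The factor \<open>sgn (r - x)\<close> treats both sides of \<open>x\<close> at
      once: for \<open>r < x\<close> it turns the increment into \<open>G x - G r\<close>.\<close>
    ultimately have "\<forall>\<^sub>F r in at x within {a..b}.
        p (c r - c x) \<le> (G r - G x) * sgn (r - x) + e * \<bar>r - x\<bar>"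
      using eventually_neq_at_within[of x x "{a..b}"]
    proof eventually_elim
      case (elim r)
      have "p ((1 / (r - x)) *\<^sub>R (c r - c x)) \<le> p (c' x) + e / 2"
        using seminorm_diff_ge[OF p, of "(1 / (r - x)) *\<^sub>R (c r - c x)" "c' x"] elim by simp
      also have "\<dots> \<le> G' x + e / 2" using le[OF x] by simp
      also have "\<dots> \<le> (G r - G x) / (r - x) + e"
        using elim(2) unfolding dist_real_def by linarith
      finally have "p (c r - c x) / \<bar>r - x\<bar> \<le> (G r - G x) / (r - x) + e"
        by (simp add: seminorm_scaleR[OF p])
      then have "p (c r - c x) \<le> ((G r - G x) / (r - x) + e) * \<bar>r - x\<bar>"
        using elim(3) by (simp add: pos_divide_le_eq)
      also have "\<dots> = (G r - G x) * sgn (r - x) + e * \<bar>r - x\<bar>"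
        using elim(3) by (auto simp: field_simps sgn_if abs_if)
      finally show ?case .
    qed
    then obtain d where d: "d > 0" "\<And>r. r \<in> {a..b} \<Longrightarrow> r \<noteq> x \<Longrightarrow> dist r x < d \<Longrightarrow>
        p (c r - c x) \<le> (G r - G x) * sgn (r - x) + e * \<bar>r - x\<bar>"
      unfolding eventually_at by blast
    show ?case
      unfolding Q_def
    proof (intro exI[of _ d] conjI allI impI d(1))
      fix u v assume uv: "u \<le> x \<and> x \<le> v \<and> v - u < d" "a \<le> u \<and> v \<le> b \<and> u \<le> v"
      have "p (c v - c x) \<le> G v - G x + e * (v - x)"
        using d(2)[of v] uv p by (cases "v = x") (auto simp: dist_real_def)
      moreover have "p (c x - c u) \<le> G x - G u + e * (x - u)"
        using d(2)[of u] uv p seminorm_diff_commute[OF p, of "c x" "c u"]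
        by (cases "u = x") (auto simp: dist_real_def)
      moreover have "p (c v - c u) \<le> p (c v - c x) + p (c x - c u)"
        by (rule seminorm_triangle[OF p])
      ultimately show "p (c v - c u) \<le> G v - G u + e * (v - u)"
        by (simp add: algebra_simps)
    qed
  qed
  show ?thesis
  proof (rule field_le_epsilon)
    fix e :: real assume "e > 0"
    \<comment> \<open>Adding 1 to the length avoids a division by 0 when
      \<open>a = b\<close>.\<close>
    have "p (c b - c a) \<le> G b - G a + e / (b - a + 1) * (b - a)"
      using main[of "e / (b - a + 1)"] \<open>e > 0\<close> \<open>a \<le> b\<close> by (simp add: Q_def)
    also have "e / (b - a + 1) * (b - a) \<le> e"
      using \<open>e > 0\<close> \<open>a \<le> b\<close> by (simp add: field_simps)
    finally show "p (c b - c a) \<le> G b - G a + e" by simp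
  qed
qed

lemma bastiani_tendsto_ddir:
  fixes f :: "'a::{real_vector,topological_space} \<Rightarrow> 'b::{real_vector,t2_space}"
  assumes f: "bastiani k U f" and k: "1 \<le> k" and x: "x \<in> U"
  shows "((\<lambda>h. (1 / h) *\<^sub>R (f (x + h *\<^sub>R v) - f x)) \<longlongrightarrow> ddir f x v) (at 0)"
proof -
  have 0: "enat (Suc 0) \<le> k" using k by (simp add: one_enat_def)
  have "\<forall>p. enat (Suc p) \<le> k \<longrightarrow> (\<forall>x\<in>U. \<forall>v. \<exists>l.
        ((\<lambda>h::real. (1 / h) *\<^sub>R (bdiff p f (x + h *\<^sub>R v p) v - bdiff p f x v)) \<longlongrightarrow> l) (at 0))"
    using f unfolding bastiani_def by simp
  from this[rule_format, OF 0 x, of "\<lambda>_. v"]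
  obtain l where "((\<lambda>h. (1 / h) *\<^sub>R (f (x + h *\<^sub>R v) - f x)) \<longlongrightarrow> l) (at 0)"
    by (simp only: bdiff.simps) (erule exE)
  then show ?thesis
    unfolding ddir_def by (simp add: tendsto_Lim)
qed

context
  fixes f :: "'a::locally_convex_space \<Rightarrow> 'b::locally_convex_space" and k :: enat
    and U :: "'a set"
  assumes f: "bastiani k U f" and k: "1 \<le> k"
begin

text \<open>\<open>bdiff (Suc 0)\<close> reads only the first entry of its direction sequence, so
  embedding vectors as constant sequences transfers the joint continuity.\<close>

lemma bastiani_ddir_tendsto:
  assumes "x \<in> U" "(y \<longlongrightarrow> x) F" "(v \<longlongrightarrow> w) F"
  shows "((\<lambda>i. ddir f (y i) (v i)) \<longlongrightarrow> ddir f x w) F"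
proof -
  have U: "open U" using f unfolding bastiani_def by (rule conjunct1)
  have "enat (Suc 0) \<le> k" using k by (simp add: one_enat_def)
  then have cont: "continuous_on (U \<times> UNIV) (\<lambda>(x, v). bdiff (Suc 0) f x v)"
    using f unfolding bastiani_def by (simp only: simp_thms)
  have "((\<lambda>i. (\<lambda>_::nat. v i)) \<longlongrightarrow> (\<lambda>_. w)) F"
    by (rule tendsto_funI) (use assms in simp)
  then have "((\<lambda>i. (y i, (\<lambda>_::nat. v i))) \<longlongrightarrow> (x, (\<lambda>_. w))) F"
    by (intro tendsto_Pair assms)
  moreover have "\<forall>\<^sub>F i in F. y i \<in> U"
    using assms U by (simp add: tendsto_def)
  then have "\<forall>\<^sub>F i in F. (y i, (\<lambda>_::nat. v i)) \<in> U \<times> UNIV"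
    by simp
  ultimately have "((\<lambda>i. (\<lambda>(x, v). bdiff (Suc 0) f x v) (y i, (\<lambda>_::nat. v i))) \<longlongrightarrow>
      (\<lambda>(x, v). bdiff (Suc 0) f x v) (x, \<lambda>_. w)) F"
    using assms by (intro continuous_on_tendsto_compose[OF cont]) auto
  then show ?thesis by simp
qed

text \<open>Along the segment from \<open>y i\<close> to \<open>y i + h i *\<^sub>R v i\<close>,
  subtracting the expected linear motion leaves a curve with derivative
  \<open>h i *\<^sub>R (ddir f _ (v i) - L)\<close>. Joint continuity of \<open>ddir\<close> and
  compactness of \<open>{0..1}\<close> make the bracket small uniformly on the segment, and the mean
  value inequality finishes.\<close>

lemma bastiani_strict_ddir:
  assumes x: "x \<in> U" and y: "(y \<longlongrightarrow> x) F" and v: "(v \<longlongrightarrow> w) F" and h: "filterlim h (at 0) F"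
  shows "((\<lambda>i. (1 / h i) *\<^sub>R (f (y i + h i *\<^sub>R v i) - f (y i))) \<longlongrightarrow> ddir f x w) F"
  unfolding tendsto_seminorm_iff
proof (intro ballI allI impI)
  fix p :: "'b \<Rightarrow> real" and e :: real
  assume p: "p \<in> cont_seminorms" and e: "e > 0"
  have U: "open U" using f unfolding bastiani_def by (rule conjunct1)
  have h0: "(h \<longlongrightarrow> 0) F" and hn: "\<forall>\<^sub>F i in F. h i \<noteq> 0"
    using h unfolding filterlim_at by auto
  define L where "L = ddir f x w"
  have "\<forall>\<^sub>F i in F. \<forall>s\<in>{0..1::real}. y i + (s * h i) *\<^sub>R v i \<in> U \<and>
      p (ddir f (y i + (s * h i) *\<^sub>R v i) (v i) - L) < e / 2"
  proof (rule compact_eventually_ball)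
    fix s :: real assume "s \<in> {0..1}"
    let ?F = "inf (nhds s) (principal {0..1}) \<times>\<^sub>F F"
    have t: "filterlim snd F ?F" by (rule filterlim_snd)
    have "filterlim fst (inf (nhds s) (principal {0..1})) ?F" by (rule filterlim_fst)
    then have "(fst \<longlongrightarrow> s) ?F" by (rule filterlim_mono) auto
    moreover have "((\<lambda>q. h (snd q)) \<longlongrightarrow> 0) ?F" and v': "((\<lambda>q. v (snd q)) \<longlongrightarrow> w) ?F"
      and "((\<lambda>q. y (snd q)) \<longlongrightarrow> x) ?F"
      using filterlim_compose[OF h0 t] filterlim_compose[OF v t] filterlim_compose[OF y t] by auto
    ultimately have "((\<lambda>q. y (snd q) + (fst q * h (snd q)) *\<^sub>R v (snd q)) \<longlongrightarrow> x + (s * 0) *\<^sub>R w) ?F"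
      by (intro tendsto_add tendsto_scaleR_lcs tendsto_mult)
    then have lim': "((\<lambda>q. y (snd q) + (fst q * h (snd q)) *\<^sub>R v (snd q)) \<longlongrightarrow> x) ?F"
      by simp
    have "\<forall>\<^sub>F q in ?F. y (snd q) + (fst q * h (snd q)) *\<^sub>R v (snd q) \<in> U"
      using lim' U x by (simp add: tendsto_def)
    moreover have "\<forall>\<^sub>F q in ?F. p (ddir f (y (snd q) + (fst q * h (snd q)) *\<^sub>R v (snd q)) (v (snd q)) - L) < e / 2"
      using e unfolding L_def
      by (intro eventually_seminorm_less[OF bastiani_ddir_tendsto[OF x lim' v'] p]) simp
    ultimately show "\<forall>\<^sub>F (s, i) in ?F. y i + (s * h i) *\<^sub>R v i \<in> U \<and>
      p (ddir f (y i + (s * h i) *\<^sub>R v i) (v i) - L) < e / 2"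
      by eventually_elim auto
  qed auto
  then show "\<forall>\<^sub>F i in F. p ((1 / h i) *\<^sub>R (f (y i + h i *\<^sub>R v i) - f (y i)) - ddir f x w) < e"
    using hn
  proof eventually_elim
    case (elim i)
    define c where "c s = f (y i + (s * h i) *\<^sub>R v i) - (s * h i) *\<^sub>R L" for s
    have "p (c 1 - c 0) \<le> (\<lambda>s. (\<bar>h i\<bar> * (e/2)) * s) 1 - (\<lambda>s. (\<bar>h i\<bar> * (e/2)) * s) 0"
    proof (rule seminorm_mean_value[OF p,
          where c' = "\<lambda>s. h i *\<^sub>R (ddir f (y i + (s * h i) *\<^sub>R v i) (v i) - L)" and G' = "\<lambda>s. \<bar>h i\<bar> * (e/2)"])
      fix s :: real assume s: "s \<in> {0..1}"
      let ?z = "y i + (s * h i) *\<^sub>R v i"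
      have "filterlim (\<lambda>r. (r - s) * h i) (at 0) (at s within {0..1})"
        unfolding filterlim_at using elim(2)
        by (auto intro!: tendsto_eq_intros simp: eventually_at_filter)
      from filterlim_compose[OF bastiani_tendsto_ddir[OF f k, where x = ?z and v = "v i"] this]
      have "((\<lambda>r. (1 / ((r - s) * h i)) *\<^sub>R (f (?z + ((r - s) * h i) *\<^sub>R v i) - f ?z))
          \<longlongrightarrow> ddir f ?z (v i)) (at s within {0..1})"
        using elim(1) s by auto
      then have "((\<lambda>r. h i *\<^sub>R ((1 / ((r - s) * h i)) *\<^sub>R (f (?z + ((r - s) * h i) *\<^sub>R v i) - f ?z) - L))
          \<longlongrightarrow> h i *\<^sub>R (ddir f ?z (v i) - L)) (at s within {0..1})"
        by (intro tendsto_intros)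
      moreover have "\<forall>\<^sub>F r in at s within {0..1}. h i *\<^sub>R ((1 / ((r - s) * h i)) *\<^sub>R (f (?z + ((r - s) * h i) *\<^sub>R v i) - f ?z) - L) = (1 / (r - s)) *\<^sub>R (c r - c s)"
        using eventually_neq_at_within[of s s "{0..1}"]
      proof eventually_elim
        case (elim r)
        have "?z + ((r - s) * h i) *\<^sub>R v i = y i + (r * h i) *\<^sub>R v i"
          by (simp add: algebra_simps)
        moreover have "h i *\<^sub>R L = (1 / (r - s)) *\<^sub>R ((r * h i) *\<^sub>R L - (s * h i) *\<^sub>R L)"
          using elim by (simp add: scaleR_diff_left[symmetric] left_diff_distrib[symmetric])
        moreover have "h i *\<^sub>R ((1 / ((r - s) * h i)) *\<^sub>R X - L) = (1 / (r - s)) *\<^sub>R X - h i *\<^sub>R L" for X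
          using elim \<open>h i \<noteq> 0\<close> by (simp add: scaleR_diff_right)
        ultimately show ?case
          unfolding c_def by (simp only: scaleR_diff_right[symmetric]) (simp add: algebra_simps)
      qed
      ultimately show "((\<lambda>r. (1 / (r - s)) *\<^sub>R (c r - c s)) \<longlongrightarrow> h i *\<^sub>R (ddir f ?z (v i) - L)) (at s within {0..1})"
        by (rule Lim_transform_eventually)
      show "((\<lambda>s. (\<bar>h i\<bar> * (e/2)) * s) has_real_derivative \<bar>h i\<bar> * (e/2)) (at s within {0..1})"
        by (auto intro!: derivative_eq_intros)
      show "p (h i *\<^sub>R (ddir f ?z (v i) - L)) \<le> \<bar>h i\<bar> * (e/2)"
        unfolding seminorm_scaleR[OF p] using elim(1) s by (intro mult_left_mono) (auto intro: less_imp_le)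
    qed simp
    then have le: "p (c 1 - c 0) \<le> \<bar>h i\<bar> * (e/2)" by simp
    have "(1 / h i) *\<^sub>R (f (y i + h i *\<^sub>R v i) - f (y i)) - L = (1 / h i) *\<^sub>R (c 1 - c 0)"
      using elim(2) unfolding c_def by (simp add: scaleR_diff_right)
    then have "p ((1 / h i) *\<^sub>R (f (y i + h i *\<^sub>R v i) - f (y i)) - L) = p (c 1 - c 0) / \<bar>h i\<bar>"
      by (simp only:) (simp add: seminorm_scaleR[OF p])
    also have "\<dots> \<le> e / 2"
      using le elim(2) by (simp add: pos_divide_le_eq mult.commute)
    finally show ?case using e unfolding L_def by simp
  qed
qed

end

section \<open>Pairs of moving points on a Lie group\<close>

lemma chartD:
  assumes "is_chart c"
  shows chart_open: "open (fst c)"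
    and chart_open_image: "open (snd c ` fst c)"
    and chart_inv_left: "g \<in> fst c \<Longrightarrow> chart_inv c (snd c g) = g"
    and chart_inv_right: "y \<in> snd c ` fst c \<Longrightarrow> snd c (chart_inv c y) = y"
    and chart_continuous: "continuous_on (fst c) (snd c)"
    and chart_inv_continuous: "continuous_on (snd c ` fst c) (chart_inv c)"
  using assms unfolding is_chart_def homeomorphism_def by auto

lemma chart_tendsto:
  assumes "is_chart c" "g \<in> fst c" "(z \<longlongrightarrow> g) F"
  shows "((\<lambda>i. snd c (z i)) \<longlongrightarrow> snd c g) F"
  using assms chart_open[OF assms(1)]
  by (intro continuous_on_tendsto_compose[OF chart_continuous[OF assms(1)]]) (auto simp: tendsto_def)

lemma chart_inv_tendsto:
  assumes "is_chart c" "g \<in> fst c" "(y \<longlongrightarrow> snd c g) F"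
  shows "((\<lambda>i. chart_inv c (y i)) \<longlongrightarrow> g) F"
proof -
  have "\<forall>\<^sub>F i in F. y i \<in> snd c ` fst c"
    by (rule topological_tendstoD[OF assms(3) chart_open_image[OF assms(1)]]) (use assms(2) in simp)
  then have "((\<lambda>i. chart_inv c (y i)) \<longlongrightarrow> chart_inv c (snd c g)) F"
    by (intro continuous_on_tendsto_compose[OF chart_inv_continuous[OF assms(1)] assms(3)]) (use assms(2) in simp)
  then show ?thesis
    using chart_inv_left[OF assms(1,2)] by simp
qed

text \<open>\<open>y\<close> and \<open>z\<close> both approach \<open>g\<close>, and \<open>w\<close> is the limit of their difference quotient with
  respect to the increments \<open>h\<close> in the chart \<open>c\<close>. Keeping both points in motion allows quotients
  of curves to be differentiated with multiplication alone, without the derivative of inversion.\<close>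

definition tangent_pair ::
  "('g::topological_space, 'e::{real_vector,topological_space}) chart \<Rightarrow> 'i filter \<Rightarrow> ('i \<Rightarrow> real) \<Rightarrow>
    ('i \<Rightarrow> 'g) \<Rightarrow> ('i \<Rightarrow> 'g) \<Rightarrow> 'g \<Rightarrow> 'e \<Rightarrow> bool" where
  "tangent_pair c F h y z g w \<longleftrightarrow> (y \<longlongrightarrow> g) F \<and> (z \<longlongrightarrow> g) F \<and>
     ((\<lambda>i. (1 / h i) *\<^sub>R (snd c (z i) - snd c (y i))) \<longlongrightarrow> w) F"

lemma tangent_pair_same:
  "(y \<longlongrightarrow> g) F \<Longrightarrow> tangent_pair c F h y y g (0::'e::{real_vector,topological_space})"
  unfolding tangent_pair_def by simp

lemma tangent_pair_trans:
  fixes w :: "'e::locally_convex_space"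
  assumes "tangent_pair c F h x y g w" "tangent_pair c F h y z g w'"
  shows "tangent_pair c F h x z g (w + w')"
proof -
  have "((\<lambda>i. (1 / h i) *\<^sub>R (snd c (y i) - snd c (x i)) + (1 / h i) *\<^sub>R (snd c (z i) - snd c (y i)))
      \<longlongrightarrow> w + w') F"
    using assms unfolding tangent_pair_def by (intro tendsto_add) auto
  then show ?thesis
    using assms unfolding tangent_pair_def by (simp add: scaleR_add_right[symmetric])
qed

lemma tangent_pair_swap:
  fixes w :: "'e::locally_convex_space"
  assumes "tangent_pair c F h x y g w"
  shows "tangent_pair c F h y x g (- w)"
proof -
  have "((\<lambda>i. - ((1 / h i) *\<^sub>R (snd c (y i) - snd c (x i)))) \<longlongrightarrow> - w) F"
    using assms unfolding tangent_pair_def by (intro tendsto_minus) auto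
  then show ?thesis
    using assms unfolding tangent_pair_def by (simp add: scaleR_minus_right[symmetric])
qed

lemma tangent_pair_scale:
  fixes w :: "'e::locally_convex_space"
  assumes "tangent_pair c F h x y g w" "r \<noteq> 0"
  shows "tangent_pair c F (\<lambda>i. h i / r) x y g (r *\<^sub>R w)"
proof -
  have "((\<lambda>i. r *\<^sub>R ((1 / h i) *\<^sub>R (snd c (y i) - snd c (x i)))) \<longlongrightarrow> r *\<^sub>R w) F"
    using assms unfolding tangent_pair_def by (intro tendsto_scaleR_lcs tendsto_const) auto
  then show ?thesis
    using assms unfolding tangent_pair_def by simp
qed

text \<open>Realises any prescribed vector by a pair. Letting \<open>v\<close> move realises a
  convergent family of vectors at once, as the joint continuity of differentials requires.\<close>

lemma tangent_pair_ray:
  fixes c :: "('g::topological_space, 'e::locally_convex_space) chart"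
  assumes c: "is_chart c" "g \<in> fst c" and h: "filterlim h (at 0) F" and v: "(v \<longlongrightarrow> w) F"
  shows "tangent_pair c F h (\<lambda>_. g) (\<lambda>i. chart_inv c (snd c g + h i *\<^sub>R v i)) g w"
proof -
  have h0: "(h \<longlongrightarrow> 0) F" and hn: "\<forall>\<^sub>F i in F. h i \<noteq> 0"
    using h unfolding filterlim_at by auto
  have "((\<lambda>i. snd c g + h i *\<^sub>R v i) \<longlongrightarrow> snd c g + 0 *\<^sub>R w) F"
    by (intro tendsto_add tendsto_scaleR_lcs tendsto_const h0 v)
  then have lim: "((\<lambda>i. snd c g + h i *\<^sub>R v i) \<longlongrightarrow> snd c g) F" by simp
  have "\<forall>\<^sub>F i in F. snd c g + h i *\<^sub>R v i \<in> snd c ` fst c"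
    by (rule topological_tendstoD[OF lim chart_open_image[OF c(1)]]) (use c in simp)
  then have "\<forall>\<^sub>F i in F. v i = (1 / h i) *\<^sub>R (snd c (chart_inv c (snd c g + h i *\<^sub>R v i)) - snd c g)"
    using hn by eventually_elim (simp add: chart_inv_right[OF c(1)])
  with v show ?thesis
    using chart_inv_tendsto[OF c lim] unfolding tangent_pair_def
    by (auto intro: Lim_transform_eventually)
qed

text \<open>The differential at \<open>g\<close> of a two-sided translation, read in two charts. The
  one notion covers changes of chart (\<open>l\<close> and \<open>r\<close> the unit),
  \<open>Ad\<close>, the right translation in \<open>log_deriv\<close>, and the mixed translation in
  the velocity of a quotient.\<close>

definition dtrans ::
  "('g::topological_space, 'e::{real_vector,t2_space}, 'm) lie_group_data_scheme \<Rightarrow>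
    ('g, 'e) chart \<Rightarrow> ('g, 'e) chart \<Rightarrow> 'g \<Rightarrow> 'g \<Rightarrow> 'g \<Rightarrow> 'e \<Rightarrow> 'e" where
  "dtrans G c c' l g r = ddir (snd c' \<circ> (\<lambda>z. l \<otimes>\<^bsub>G\<^esub> z \<otimes>\<^bsub>G\<^esub> r) \<circ> chart_inv c) (snd c g)"

context
  fixes G :: "('g::t2_space, 'e::locally_convex_space, 'm) lie_group_data_scheme"
  assumes G: "lie_group G"
begin

lemma lie_group_group: "group G" and lie_group_carrier: "carrier G = UNIV"
  using G unfolding lie_group_def by auto

lemma lie_group_mem [simp]: "g \<in> carrier G"
  by (simp add: lie_group_carrier)

lemma charts_atD:
  assumes "c \<in> charts_at (atlas G) g"
  shows charts_at_atlas: "c \<in> atlas G" and charts_at_is_chart: "is_chart c" and charts_at_mem: "g \<in> fst c"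
proof -
  show *: "c \<in> atlas G" and "g \<in> fst c"
    using assms unfolding charts_at_def by simp_all
  have "\<forall>c\<in>atlas G. is_chart c"
    using G unfolding lie_group_def maximal_atlas_def by (elim conjE)
  with * show "is_chart c" by (rule bspec[rotated])
qed

lemma charts_at_ne: "\<exists>c. c \<in> charts_at (atlas G) g"
proof -
  have "g \<in> (\<Union>c\<in>atlas G. fst c)"
    using G unfolding lie_group_def maximal_atlas_def by (elim conjE) (simp only: UNIV_I)
  then show ?thesis unfolding charts_at_def by auto
qed

lemma tendsto_mult_lie:
  assumes "(a \<longlongrightarrow> x) F" "(b \<longlongrightarrow> y) F"
  shows "((\<lambda>i. a i \<otimes>\<^bsub>G\<^esub> b i) \<longlongrightarrow> x \<otimes>\<^bsub>G\<^esub> y) F"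
proof -
  have "continuous_on UNIV (\<lambda>(g, h). g \<otimes>\<^bsub>G\<^esub> h)"
    using G unfolding lie_group_def Ck_map_def by (elim conjE)
  from continuous_on_tendsto_compose[OF this tendsto_Pair[OF assms]]
  show ?thesis by simp
qed

lemma tendsto_inv_lie:
  assumes "(a \<longlongrightarrow> x) F"
  shows "((\<lambda>i. inv\<^bsub>G\<^esub> (a i)) \<longlongrightarrow> inv\<^bsub>G\<^esub> x) F"
proof -
  have "continuous_on UNIV (\<lambda>g. inv\<^bsub>G\<^esub> g)"
    using G unfolding lie_group_def Ck_map_def by (elim conjE)
  from continuous_on_tendsto_compose[OF this assms]
  show ?thesis by simp
qed

text \<open>In charts the multiplication is a Bastiani smooth map on an open subset of
  \<open>'e \<times> 'e\<close>. The two difference quotients together form its moving direction, so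
  strict differentiability applies. The resulting vector depends only on the limits, not on the
  pairs or the filter.\<close>

lemma tangent_pair_mult:
  assumes h: "filterlim h (at 0) F"
    and a: "a \<in> charts_at (atlas G) l0" and b: "b \<in> charts_at (atlas G) g0"
    and c: "c \<in> charts_at (atlas G) (l0 \<otimes>\<^bsub>G\<^esub> g0)"
    and l: "tangent_pair a F h l l' l0 u" and y: "tangent_pair b F h y z g0 w"
  shows "tangent_pair c F h (\<lambda>i. l i \<otimes>\<^bsub>G\<^esub> y i) (\<lambda>i. l' i \<otimes>\<^bsub>G\<^esub> z i) (l0 \<otimes>\<^bsub>G\<^esub> g0)
    (ddir (snd c \<circ> (\<lambda>(g, h). g \<otimes>\<^bsub>G\<^esub> h) \<circ> chart_inv (fst a \<times> fst b, map_prod (snd a) (snd b)))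
      (snd a l0, snd b g0) (u, w))"
proof -
  note ch = charts_at_is_chart[OF a] charts_at_is_chart[OF b]
  let ?ab = "(fst a \<times> fst b, map_prod (snd a) (snd b))"
  let ?m = "\<lambda>(g, h). g \<otimes>\<^bsub>G\<^esub> h"
  let ?f = "snd c \<circ> ?m \<circ> chart_inv ?ab"
  let ?U = "snd ?ab ` (fst ?ab \<inter> UNIV \<inter> ?m -` fst c)"
  have "?ab \<in> prod_atlas (atlas G) (atlas G)"
    using charts_at_atlas[OF a] charts_at_atlas[OF b] unfolding prod_atlas_def by blast
  moreover have "Ck_map (prod_atlas (atlas G) (atlas G)) (atlas G) \<infinity> UNIV ?m"
    using G unfolding lie_group_def by (elim conjE)
  ultimately have f: "bastiani \<infinity> ?U ?f"
    using charts_at_atlas[OF c] unfolding Ck_map_def by blast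
  have mem: "(snd a l0, snd b g0) \<in> ?U"
  proof -
    have "(l0, g0) \<in> fst ?ab \<inter> UNIV \<inter> ?m -` fst c"
      using charts_at_mem[OF a] charts_at_mem[OF b] charts_at_mem[OF c] by simp
    then have "snd ?ab (l0, g0) \<in> ?U" by (rule imageI)
    then show ?thesis by simp
  qed
  \<comment> \<open>The inverse of the product chart is an \<open>inv_into\<close>, so injectivity
    is needed to evaluate it at a pair of coordinates.\<close>
  have "inj_on (snd a) (fst a)" "inj_on (snd b) (fst b)"
    using chart_inv_left[OF ch(1)] chart_inv_left[OF ch(2)] by (metis inj_onI)+
  then have "inj_on (map_prod (snd a) (snd b)) (fst a \<times> fst b)"
    by (rule map_prod_inj_on)
  then have f_eq: "?f (snd a p, snd b q) = snd c (p \<otimes>\<^bsub>G\<^esub> q)" if "p \<in> fst a" "q \<in> fst b" for p q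
    using inv_into_f_f[of "map_prod (snd a) (snd b)" "fst a \<times> fst b" "(p, q)"] that
    unfolding chart_inv_def by simp
  have h0: "(h \<longlongrightarrow> 0) F" and hn: "\<forall>\<^sub>F i in F. h i \<noteq> 0"
    using h unfolding filterlim_at by auto
  note ly = l[unfolded tangent_pair_def] y[unfolded tangent_pair_def]
  have ev: "\<forall>\<^sub>F i in F. l i \<in> fst a \<and> l' i \<in> fst a \<and> y i \<in> fst b \<and> z i \<in> fst b"
    using ly by (intro eventually_conj; elim conjE)
      (erule topological_tendstoD[OF _ chart_open[OF ch(1)] charts_at_mem[OF a]]
        topological_tendstoD[OF _ chart_open[OF ch(2)] charts_at_mem[OF b]])+
  let ?v = "\<lambda>i. ((1 / h i) *\<^sub>R (snd a (l' i) - snd a (l i)), (1 / h i) *\<^sub>R (snd b (z i) - snd b (y i)))"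
  let ?y = "\<lambda>i. (snd a (l i), snd b (y i))"
  have "(?v \<longlongrightarrow> (u, w)) F"
    using ly by (intro tendsto_Pair) auto
  moreover have "(?y \<longlongrightarrow> (snd a l0, snd b g0)) F"
    using ly by (intro tendsto_Pair chart_tendsto ch charts_at_mem[OF a] charts_at_mem[OF b]) auto
  ultimately have "((\<lambda>i. (1 / h i) *\<^sub>R (?f (?y i + h i *\<^sub>R ?v i) - ?f (?y i))) \<longlongrightarrow>
      ddir ?f (snd a l0, snd b g0) (u, w)) F"
    by (intro bastiani_strict_ddir[OF f _ mem _ _ h]) auto
  moreover have "\<forall>\<^sub>F i in F. (1 / h i) *\<^sub>R (?f (?y i + h i *\<^sub>R ?v i) - ?f (?y i)) =
      (1 / h i) *\<^sub>R (snd c (l' i \<otimes>\<^bsub>G\<^esub> z i) - snd c (l i \<otimes>\<^bsub>G\<^esub> y i))"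
    using ev hn
  proof eventually_elim
    case (elim i)
    have "?y i + h i *\<^sub>R ?v i = (snd a (l' i), snd b (z i))"
      using elim by simp
    then show ?case
      using elim f_eq by (simp only:)
  qed
  ultimately have "((\<lambda>i. (1 / h i) *\<^sub>R (snd c (l' i \<otimes>\<^bsub>G\<^esub> z i) - snd c (l i \<otimes>\<^bsub>G\<^esub> y i))) \<longlongrightarrow>
      ddir ?f (snd a l0, snd b g0) (u, w)) F"
    by (rule Lim_transform_eventually)
  moreover have "((\<lambda>i. l i \<otimes>\<^bsub>G\<^esub> y i) \<longlongrightarrow> l0 \<otimes>\<^bsub>G\<^esub> g0) F" "((\<lambda>i. l' i \<otimes>\<^bsub>G\<^esub> z i) \<longlongrightarrow> l0 \<otimes>\<^bsub>G\<^esub> g0) F"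
    using ly by (auto intro: tendsto_mult_lie)
  ultimately show ?thesis
    unfolding tangent_pair_def by blast
qed

text \<open>Multiplying by \<open>l\<close> and then by \<open>r\<close>, each as a pair at rest,
  gives some vector \<open>D\<close>. The same two multiplications along the chart ray with constant
  factors give the same \<open>D\<close>, and there it is by definition the value of
  \<open>dtrans\<close>.\<close>

lemma tangent_pair_translate:
  fixes F :: "'i filter"
  assumes h: "filterlim h (at 0) F" and l: "(l \<longlongrightarrow> l0) F" and r: "(r \<longlongrightarrow> r0) F"
    and c: "c \<in> charts_at (atlas G) g" and c': "c' \<in> charts_at (atlas G) (l0 \<otimes>\<^bsub>G\<^esub> g \<otimes>\<^bsub>G\<^esub> r0)"
    and yz: "tangent_pair c F h y z g w"
  shows "tangent_pair c' F h (\<lambda>i. l i \<otimes>\<^bsub>G\<^esub> y i \<otimes>\<^bsub>G\<^esub> r i) (\<lambda>i. l i \<otimes>\<^bsub>G\<^esub> z i \<otimes>\<^bsub>G\<^esub> r i)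
    (l0 \<otimes>\<^bsub>G\<^esub> g \<otimes>\<^bsub>G\<^esub> r0) (dtrans G c c' l0 g r0 w)"
proof -
  obtain a b d where abd: "a \<in> charts_at (atlas G) l0" "b \<in> charts_at (atlas G) (l0 \<otimes>\<^bsub>G\<^esub> g)"
      "d \<in> charts_at (atlas G) r0"
    using charts_at_ne by meson
  obtain D where F: "tangent_pair c' F h (\<lambda>i. l i \<otimes>\<^bsub>G\<^esub> y i \<otimes>\<^bsub>G\<^esub> r i) (\<lambda>i. l i \<otimes>\<^bsub>G\<^esub> z i \<otimes>\<^bsub>G\<^esub> r i)
      (l0 \<otimes>\<^bsub>G\<^esub> g \<otimes>\<^bsub>G\<^esub> r0) D"
    and at0: "tangent_pair c' (at 0) (\<lambda>h. h) (\<lambda>i. l0 \<otimes>\<^bsub>G\<^esub> g \<otimes>\<^bsub>G\<^esub> r0)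
      (\<lambda>h. l0 \<otimes>\<^bsub>G\<^esub> chart_inv c (snd c g + h *\<^sub>R w) \<otimes>\<^bsub>G\<^esub> r0) (l0 \<otimes>\<^bsub>G\<^esub> g \<otimes>\<^bsub>G\<^esub> r0) D"
  proof -
    let ?L = "ddir (snd b \<circ> (\<lambda>(g, h). g \<otimes>\<^bsub>G\<^esub> h) \<circ> chart_inv (fst a \<times> fst c, map_prod (snd a) (snd c)))
      (snd a l0, snd c g) (0, w)"
    have 1: "tangent_pair b F h (\<lambda>i. l i \<otimes>\<^bsub>G\<^esub> y i) (\<lambda>i. l i \<otimes>\<^bsub>G\<^esub> z i) (l0 \<otimes>\<^bsub>G\<^esub> g) ?L"
      by (rule tangent_pair_mult[OF h abd(1) c abd(2) tangent_pair_same[OF l] yz])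
    have i: "filterlim (\<lambda>h::real. h) (at 0) (at 0)" by (rule filterlim_ident)
    have 2: "tangent_pair b (at 0) (\<lambda>h. h) (\<lambda>i. l0 \<otimes>\<^bsub>G\<^esub> g)
        (\<lambda>h. l0 \<otimes>\<^bsub>G\<^esub> chart_inv c (snd c g + h *\<^sub>R w)) (l0 \<otimes>\<^bsub>G\<^esub> g) ?L"
      by (rule tangent_pair_mult[OF i abd(1) c abd(2) tangent_pair_same[OF tendsto_const]
            tangent_pair_ray[OF charts_at_is_chart[OF c] charts_at_mem[OF c] i tendsto_const]])
    show thesis
      by (rule that[OF tangent_pair_mult[OF h abd(2,3) c' 1 tangent_pair_same[OF r]]
            tangent_pair_mult[OF i abd(2,3) c' 2 tangent_pair_same[OF tendsto_const]]])
  qed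
  have "((\<lambda>h. (1 / h) *\<^sub>R (snd c' (l0 \<otimes>\<^bsub>G\<^esub> chart_inv c (snd c g + h *\<^sub>R w) \<otimes>\<^bsub>G\<^esub> r0) - snd c' (l0 \<otimes>\<^bsub>G\<^esub> g \<otimes>\<^bsub>G\<^esub> r0)))
      \<longlongrightarrow> D) (at 0)"
    using at0 unfolding tangent_pair_def by blast
  then have "dtrans G c c' l0 g r0 w = D"
    unfolding dtrans_def ddir_def using chart_inv_left[OF charts_at_is_chart[OF c] charts_at_mem[OF c]]
    by (intro tendsto_Lim) auto
  with F show ?thesis by simp
qed

lemma dtrans_eqI:
  assumes "F \<noteq> bot" "filterlim h (at 0) F"
    and "c \<in> charts_at (atlas G) g" "c' \<in> charts_at (atlas G) (l \<otimes>\<^bsub>G\<^esub> g \<otimes>\<^bsub>G\<^esub> r)"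
    and "tangent_pair c F h y z g w"
    and "tangent_pair c' F h (\<lambda>i. l \<otimes>\<^bsub>G\<^esub> y i \<otimes>\<^bsub>G\<^esub> r) (\<lambda>i. l \<otimes>\<^bsub>G\<^esub> z i \<otimes>\<^bsub>G\<^esub> r) g' w'"
  shows "dtrans G c c' l g r w = w'"
  using tangent_pair_translate[OF assms(2) tendsto_const tendsto_const assms(3-5)] assms(1,6)
  unfolding tangent_pair_def by (blast intro: tendsto_unique)

text \<open>Additivity comes from concatenating pairs: the rays for \<open>w\<close> and
  \<open>w + w'\<close> form a pair with vector \<open>w'\<close> whose first point moves, and so
  translate like any other pair. Homogeneity comes from rescaling the increments to
  \<open>h / a\<close>, which leaves \<open>a = 0\<close> as a separate case.\<close>

lemma linear_dtrans:
  assumes c: "c \<in> charts_at (atlas G) g" and c': "c' \<in> charts_at (atlas G) (l \<otimes>\<^bsub>G\<^esub> g \<otimes>\<^bsub>G\<^esub> r)"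
  shows "linear (dtrans G c c' l g r)"
proof (rule linearI)
  let ?ray = "\<lambda>w h::real. chart_inv c (snd c g + h *\<^sub>R w)"
  have i: "filterlim (\<lambda>h::real. h) (at 0) (at 0)" by (rule filterlim_ident)
  have ray: "tangent_pair c (at 0) (\<lambda>h. h) (\<lambda>_. g) (?ray w) g w" for w
    by (rule tangent_pair_ray[OF charts_at_is_chart[OF c] charts_at_mem[OF c] i tendsto_const])
  note tr = tangent_pair_translate[OF _ tendsto_const tendsto_const c c']
  fix w w'
  have "tangent_pair c (at 0) (\<lambda>h. h) (?ray w) (?ray (w + w')) g (- w + (w + w'))"
    by (rule tangent_pair_trans[OF tangent_pair_swap[OF ray] ray])
  then have *: "tangent_pair c (at 0) (\<lambda>h. h) (?ray w) (?ray (w + w')) g w'" by simp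
  show "dtrans G c c' l g r (w + w') = dtrans G c c' l g r w + dtrans G c c' l g r w'"
    by (rule dtrans_eqI[OF _ i c c' ray tangent_pair_trans[OF tr[OF i ray] tr[OF i *]]]) simp
  fix a :: real
  show "dtrans G c c' l g r (a *\<^sub>R w) = a *\<^sub>R dtrans G c c' l g r w"
  proof (cases "a = 0")
    case True
    have 0: "tangent_pair c (at 0) (\<lambda>h. h) (\<lambda>_. g) (\<lambda>_. g) g 0"
      by (rule tangent_pair_same[OF tendsto_const])
    have "dtrans G c c' l g r 0 = 0"
      by (rule dtrans_eqI[OF _ i c c' 0 tangent_pair_same[OF tendsto_const]]) simp
    with True show ?thesis by simp
  next
    case False
    have "((\<lambda>h. h / a) \<longlongrightarrow> 0 / a) (at 0)"
      using False by (intro tendsto_divide tendsto_ident_at tendsto_const)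
    then have h: "filterlim (\<lambda>h. h / a) (at 0) (at 0)"
      using False by (auto simp: filterlim_at eventually_at_filter)
    show ?thesis
      by (rule dtrans_eqI[OF _ h c c' tangent_pair_scale[OF ray False] tangent_pair_scale[OF tr[OF i ray] False]]) simp
  qed
qed

text \<open>The difference quotients converge along the product of \<open>F\<close> and
  \<open>at 0\<close>. For almost all \<open>i\<close> they are thus within \<open>e / 2\<close> of
  the limit for small \<open>h\<close>, and letting \<open>h\<close> tend to 0 with \<open>i\<close>
  fixed gives the estimate for the differentials themselves.\<close>

lemma dtrans_tendsto:
  assumes l: "(l \<longlongrightarrow> l0) F" and r: "(r \<longlongrightarrow> r0) F" and w: "(w \<longlongrightarrow> w0) F"
    and c: "c \<in> charts_at (atlas G) g" and c': "c' \<in> charts_at (atlas G) (l0 \<otimes>\<^bsub>G\<^esub> g \<otimes>\<^bsub>G\<^esub> r0)"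
  shows "((\<lambda>i. dtrans G c c' (l i) g (r i) (w i)) \<longlongrightarrow> dtrans G c c' l0 g r0 w0) F"
  unfolding tendsto_seminorm_iff
proof (intro ballI allI impI)
  fix p :: "'e \<Rightarrow> real" and e :: real
  assume p: "p \<in> cont_seminorms" and e: "e > 0"
  note ch = charts_at_is_chart[OF c] charts_at_mem[OF c]
  let ?D = "dtrans G c c' l0 g r0 w0"
  let ?z = "\<lambda>i h. chart_inv c (snd c g + h *\<^sub>R w i)"
  let ?q = "\<lambda>i h. (1 / h) *\<^sub>R (snd c' (l i \<otimes>\<^bsub>G\<^esub> ?z i h \<otimes>\<^bsub>G\<^esub> r i) - snd c' (l i \<otimes>\<^bsub>G\<^esub> g \<otimes>\<^bsub>G\<^esub> r i))"
  have f: "filterlim fst F (F \<times>\<^sub>F at (0::real))" and s: "filterlim snd (at (0::real)) (F \<times>\<^sub>F at 0)"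
    by (rule filterlim_fst, rule filterlim_snd)
  have "tangent_pair c (F \<times>\<^sub>F at 0) snd (\<lambda>_. g) (\<lambda>q. ?z (fst q) (snd q)) g w0"
    by (rule tangent_pair_ray[OF ch s filterlim_compose[OF w f]])
  from tangent_pair_translate[OF s filterlim_compose[OF l f] filterlim_compose[OF r f] c c' this]
  have "((\<lambda>q. ?q (fst q) (snd q)) \<longlongrightarrow> ?D) (F \<times>\<^sub>F at 0)"
    unfolding tangent_pair_def by (elim conjE)
  then have "\<forall>\<^sub>F q in F \<times>\<^sub>F at 0. p (?q (fst q) (snd q) - ?D) < e / 2"
    using e by (intro eventually_seminorm_less p) auto
  then have *: "\<forall>\<^sub>F i in F. \<forall>\<^sub>F h in at 0. p (?q i h - ?D) < e / 2"
    unfolding eventually_prod_filter by (auto elim!: eventually_mono)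
  have "((\<lambda>i. l i \<otimes>\<^bsub>G\<^esub> g \<otimes>\<^bsub>G\<^esub> r i) \<longlongrightarrow> l0 \<otimes>\<^bsub>G\<^esub> g \<otimes>\<^bsub>G\<^esub> r0) F"
    by (intro tendsto_mult_lie l r tendsto_const)
  then have "\<forall>\<^sub>F i in F. l i \<otimes>\<^bsub>G\<^esub> g \<otimes>\<^bsub>G\<^esub> r i \<in> fst c'"
    by (rule topological_tendstoD[OF _ chart_open[OF charts_at_is_chart[OF c']] charts_at_mem[OF c']])
  with * show "\<forall>\<^sub>F i in F. p (dtrans G c c' (l i) g (r i) (w i) - ?D) < e"
  proof eventually_elim
    case (elim i)
    have c'i: "c' \<in> charts_at (atlas G) (l i \<otimes>\<^bsub>G\<^esub> g \<otimes>\<^bsub>G\<^esub> r i)"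
      using elim(2) charts_at_atlas[OF c'] unfolding charts_at_def by simp
    have i: "filterlim (\<lambda>h::real. h) (at 0) (at 0)" by (rule filterlim_ident)
    have "tangent_pair c (at 0) (\<lambda>h. h) (\<lambda>_. g) (?z i) g (w i)"
      by (rule tangent_pair_ray[OF ch i tendsto_const])
    from tangent_pair_translate[OF i tendsto_const tendsto_const c c'i this]
    have "(?q i \<longlongrightarrow> dtrans G c c' (l i) g (r i) (w i)) (at 0)"
      unfolding tangent_pair_def by (elim conjE)
    then have "((\<lambda>h. p (?q i h - ?D)) \<longlongrightarrow> p (dtrans G c c' (l i) g (r i) (w i) - ?D)) (at 0)"
      by (intro tendsto_seminorm[OF p] tendsto_diff tendsto_const)
    then have "p (dtrans G c c' (l i) g (r i) (w i) - ?D) \<le> e / 2"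
      by (rule tendsto_upperbound) (use elim(1) in \<open>auto elim!: eventually_mono\<close>)
    then show ?case using e by simp
  qed
qed

end

section \<open>Tangent vectors of curves and the evolution map\<close>

text \<open>The chart-free form of a pair with fixed first point: all charts at \<open>g\<close> are
  tested, matching the coordinate families that make up a \<open>tvec\<close>.\<close>

definition tangent_to ::
  "('g::topological_space, 'e::{real_vector,topological_space}) chart set \<Rightarrow> 'i filter \<Rightarrow> ('i \<Rightarrow> real) \<Rightarrow>
    ('i \<Rightarrow> 'g) \<Rightarrow> 'g \<Rightarrow> ('g, 'e) tvec \<Rightarrow> bool" where
  "tangent_to A F h z g \<xi> \<longleftrightarrow>
     (\<forall>c\<in>charts_at A g. tangent_pair c F h (\<lambda>_. g) z g (coord \<xi> c))"

text \<open>The filter \<open>at t within {0..1}\<close> sees only points where the curve agrees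
  with its extension, so limits transfer from the open interval, end points included. The filter is
  nontrivial, so \<open>Lim\<close> in \<open>velocity\<close> returns these limits.\<close>

lemma C1_curve_velocity:
  fixes G :: "('g::t2_space, 'e::locally_convex_space, 'm) lie_group_data_scheme"
  assumes \<mu>: "C1_curve G \<mu>" and t: "t \<in> {0..1}"
  shows C1_curve_tendsto: "(\<mu> \<longlongrightarrow> \<mu> t) (at t within {0..1})"
    and tangent_to_velocity:
      "tangent_to (atlas G) (at t within {0..1}) (\<lambda>s. s - t) \<mu> (\<mu> t) (velocity (atlas G) \<mu> t)"
proof -
  obtain a b \<nu> where ab: "a < 0" "1 < b" and \<nu>: "Ck_map vs_atlas (atlas G) 1 {a<..<b} \<nu>"
    and eq: "\<And>t. t \<in> {0..1} \<Longrightarrow> \<mu> t = \<nu> t"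
    using \<mu> unfolding C1_curve_def extends_with_def by blast
  have tJ: "t \<in> {a<..<b}" using t ab by auto
  have cont: "continuous_on {a<..<b} \<nu>"
    using \<nu> unfolding Ck_map_def by (elim conjE)
  then have "(\<nu> \<longlongrightarrow> \<nu> t) (at t within {a<..<b})"
    using tJ unfolding continuous_on_def by blast
  then have "(\<nu> \<longlongrightarrow> \<nu> t) (at t within {0..1})"
    by (rule tendsto_within_subset) (use ab in auto)
  then show lim: "(\<mu> \<longlongrightarrow> \<mu> t) (at t within {0..1})"
    unfolding eq[OF t] by (rule Lim_transform_eventually) (simp add: eventually_at_filter eq)
  have ex: "\<exists>w. ((\<lambda>s. (1 / (s - t)) *\<^sub>R (snd c (\<mu> s) - snd c (\<mu> t))) \<longlongrightarrow> w) (at t within {0..1})"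
    if c: "c \<in> charts_at (atlas G) (\<mu> t)" for c
  proof -
    have c': "c \<in> atlas G" "\<nu> t \<in> fst c"
      using c eq[OF t] unfolding charts_at_def by simp_all
    have U: "(UNIV, id) \<in> (vs_atlas :: (real, real) chart set)" unfolding vs_atlas_def by simp
    have "\<forall>a'\<in>vs_atlas. \<forall>b'\<in>atlas G.
        bastiani 1 (snd a' ` (fst a' \<inter> {a<..<b} \<inter> \<nu> -` fst b')) (snd b' \<circ> \<nu> \<circ> chart_inv a')"
      using \<nu> unfolding Ck_map_def by (elim conjE)
    from bspec[OF bspec[OF this U] c'(1)]
    have "bastiani 1 ({a<..<b} \<inter> \<nu> -` fst c) (snd c \<circ> \<nu> \<circ> chart_inv (UNIV, id :: real \<Rightarrow> real))"
      by simp
    moreover have "chart_inv (UNIV, id) = (id :: real \<Rightarrow> real)"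
      unfolding chart_inv_def by (simp add: inv_id)
    ultimately have "bastiani 1 ({a<..<b} \<inter> \<nu> -` fst c) (snd c \<circ> \<nu>)" by simp
    from bastiani_tendsto_ddir[OF this _ , of t 1] tJ c'(2)
    have "((\<lambda>h. (1 / h) *\<^sub>R (snd c (\<nu> (t + h)) - snd c (\<nu> t))) \<longlongrightarrow> ddir (snd c \<circ> \<nu>) t 1) (at 0)"
      by simp
    moreover have "filterlim (\<lambda>s. s - t) (at 0) (at t within {0..1})"
      by (auto simp: filterlim_at eventually_at_filter intro!: tendsto_eq_intros)
    ultimately have "((\<lambda>s. (1 / (s - t)) *\<^sub>R (snd c (\<nu> (t + (s - t))) - snd c (\<nu> t)))
        \<longlongrightarrow> ddir (snd c \<circ> \<nu>) t 1) (at t within {0..1})"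
      by (rule filterlim_compose)
    then have "((\<lambda>s. (1 / (s - t)) *\<^sub>R (snd c (\<mu> s) - snd c (\<mu> t)))
        \<longlongrightarrow> ddir (snd c \<circ> \<nu>) t 1) (at t within {0..1})"
      by (rule Lim_transform_eventually) (simp add: eventually_at_filter eq eq[OF t])
    then show ?thesis by blast
  qed
  have ne: "at t within {0..1} \<noteq> bot"
    using t by (simp add: trivial_limit_within islimpt_Icc)
  have "((\<lambda>s. (1 / (s - t)) *\<^sub>R (snd c (\<mu> s) - snd c (\<mu> t)))
      \<longlongrightarrow> coord (velocity (atlas G) \<mu> t) c) (at t within {0..1})"
    if c: "c \<in> charts_at (atlas G) (\<mu> t)" for c
  proof -
    obtain w where w: "((\<lambda>s. (1 / (s - t)) *\<^sub>R (snd c (\<mu> s) - snd c (\<mu> t))) \<longlongrightarrow> w) (at t within {0..1})"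
      using ex[OF c] by blast
    have "coord (velocity (atlas G) \<mu> t) c = w"
      using c tendsto_Lim[OF ne w] by (simp add: velocity_def)
    with w show ?thesis by simp
  qed
  then show "tangent_to (atlas G) (at t within {0..1}) (\<lambda>s. s - t) \<mu> (\<mu> t) (velocity (atlas G) \<mu> t)"
    unfolding tangent_to_def tangent_pair_def using lim by blast
qed

context
  fixes G :: "('g::t2_space, 'e::locally_convex_space, 'm) lie_group_data_scheme"
  assumes G: "lie_group G"
begin

interpretation group G by (rule lie_group_group[OF G])

lemma mem_carrier: "g \<in> carrier G"
  by (rule lie_group_mem[OF G])

lemma inv_mult_cancel: "inv\<^bsub>G\<^esub> a \<otimes>\<^bsub>G\<^esub> (a \<otimes>\<^bsub>G\<^esub> b) = b" "a \<otimes>\<^bsub>G\<^esub> (inv\<^bsub>G\<^esub> a \<otimes>\<^bsub>G\<^esub> b) = b"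
  by (simp_all add: m_assoc[symmetric] mem_carrier)

text \<open>One family of points seen in two charts is related by translation with the unit, whose
  differential is that of the transition map; uniqueness of limits forces the compatibility of the
  coordinates.\<close>

lemma tangent_to_space:
  assumes z: "tangent_to (atlas G) F h z g \<xi>" and F: "F \<noteq> bot" and h: "filterlim h (at 0) F"
    and out: "\<And>c. c \<notin> charts_at (atlas G) g \<Longrightarrow> coord \<xi> c = 0"
  shows "\<xi> \<in> tangent_space (atlas G) g"
proof -
  have "coord \<xi> c' = ddir (snd c' \<circ> chart_inv c) (snd c g) (coord \<xi> c)"
    if c: "c \<in> charts_at (atlas G) g" and c': "c' \<in> charts_at (atlas G) g" for c c'
  proof -
    have 1: "c' \<in> charts_at (atlas G) (\<one>\<^bsub>G\<^esub> \<otimes>\<^bsub>G\<^esub> g \<otimes>\<^bsub>G\<^esub> \<one>\<^bsub>G\<^esub>)"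
      using c' by (simp add: mem_carrier)
    have 2: "tangent_pair c' F h (\<lambda>i. \<one>\<^bsub>G\<^esub> \<otimes>\<^bsub>G\<^esub> g \<otimes>\<^bsub>G\<^esub> \<one>\<^bsub>G\<^esub>) (\<lambda>i. \<one>\<^bsub>G\<^esub> \<otimes>\<^bsub>G\<^esub> z i \<otimes>\<^bsub>G\<^esub> \<one>\<^bsub>G\<^esub>) g (coord \<xi> c')"
      using z c' unfolding tangent_to_def by (simp add: mem_carrier)
    have 3: "tangent_pair c F h (\<lambda>_. g) z g (coord \<xi> c)"
      using z c unfolding tangent_to_def by simp
    have "dtrans G c c' \<one>\<^bsub>G\<^esub> g \<one>\<^bsub>G\<^esub> (coord \<xi> c) = coord \<xi> c'"
      by (rule dtrans_eqI[OF G F h c 1 3 2])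
    then show ?thesis
      by (simp add: dtrans_def mem_carrier comp_def)
  qed
  then show ?thesis
    using out unfolding tangent_space_def by blast
qed

lemma tangent_space_coord:
  assumes \<xi>: "\<xi> \<in> tangent_space (atlas G) g"
    and c: "c \<in> charts_at (atlas G) g" "c' \<in> charts_at (atlas G) g"
  shows "coord \<xi> c' = dtrans G c c' \<one>\<^bsub>G\<^esub> g \<one>\<^bsub>G\<^esub> (coord \<xi> c)"
proof -
  have "coord \<xi> c' = ddir (snd c' \<circ> chart_inv c) (snd c g) (coord \<xi> c)"
    using \<xi> c unfolding tangent_space_def by blast
  then show ?thesis
    by (simp only: dtrans_def l_one[OF mem_carrier] r_one[OF mem_carrier] comp_def)
qed

text \<open>Convergence in a single chart suffices, because the differential of the transition map,
  as a translation by the unit, carries it to every other chart.\<close>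

lemma tangent_toI:
  assumes \<xi>: "\<xi> \<in> tangent_space (atlas G) g" and c: "c \<in> charts_at (atlas G) g" and h: "filterlim h (at 0) F"
    and z: "tangent_pair c F h (\<lambda>_. g) z g (coord \<xi> c)"
  shows "tangent_to (atlas G) F h z g \<xi>"
  unfolding tangent_to_def
proof
  fix c' assume c': "c' \<in> charts_at (atlas G) g"
  have "coord \<xi> c' = dtrans G c c' \<one>\<^bsub>G\<^esub> g \<one>\<^bsub>G\<^esub> (coord \<xi> c)"
    by (rule tangent_space_coord[OF \<xi> c c'])
  moreover have "c' \<in> charts_at (atlas G) (\<one>\<^bsub>G\<^esub> \<otimes>\<^bsub>G\<^esub> g \<otimes>\<^bsub>G\<^esub> \<one>\<^bsub>G\<^esub>)"
    using c' by (simp add: mem_carrier)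
  from tangent_pair_translate[OF G h tendsto_const tendsto_const c this z]
  have "tangent_pair c' F h (\<lambda>_. g) z g (dtrans G c c' \<one>\<^bsub>G\<^esub> g \<one>\<^bsub>G\<^esub> (coord \<xi> c))"
    by (simp add: mem_carrier)
  ultimately show "tangent_pair c' F h (\<lambda>_. g) z g (coord \<xi> c')" by simp
qed

lemma tangent_to_ray:
  assumes \<xi>: "\<xi> \<in> tangent_space (atlas G) g" and c: "c \<in> charts_at (atlas G) g"
  shows "tangent_to (atlas G) (at 0) (\<lambda>h. h) (\<lambda>h. chart_inv c (snd c g + h *\<^sub>R coord \<xi> c)) g \<xi>"
  by (rule tangent_toI[OF \<xi> c _ tangent_pair_ray[OF charts_at_is_chart[OF G c] charts_at_mem[OF G c]]])
    (auto intro: filterlim_ident)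

lemma tangent_to_tmap:
  assumes z: "tangent_to (atlas G) F h z g \<xi>" and h: "filterlim h (at 0) F"
  shows "tangent_to (atlas G) F h (\<lambda>i. l \<otimes>\<^bsub>G\<^esub> z i \<otimes>\<^bsub>G\<^esub> r) (l \<otimes>\<^bsub>G\<^esub> g \<otimes>\<^bsub>G\<^esub> r)
    (tmap (atlas G) (\<lambda>z. l \<otimes>\<^bsub>G\<^esub> z \<otimes>\<^bsub>G\<^esub> r) g \<xi>)"
  unfolding tangent_to_def
proof
  fix c' assume c': "c' \<in> charts_at (atlas G) (l \<otimes>\<^bsub>G\<^esub> g \<otimes>\<^bsub>G\<^esub> r)"
  define c where "c = (SOME c. c \<in> charts_at (atlas G) g)"
  have c: "c \<in> charts_at (atlas G) g"
    unfolding c_def by (rule someI_ex[OF charts_at_ne[OF G]])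
  have "coord (tmap (atlas G) (\<lambda>z. l \<otimes>\<^bsub>G\<^esub> z \<otimes>\<^bsub>G\<^esub> r) g \<xi>) c' = dtrans G c c' l g r (coord \<xi> c)"
    using c' unfolding tmap_def dtrans_def c_def by (simp add: Let_def)
  then show "tangent_pair c' F h (\<lambda>_. l \<otimes>\<^bsub>G\<^esub> g \<otimes>\<^bsub>G\<^esub> r) (\<lambda>i. l \<otimes>\<^bsub>G\<^esub> z i \<otimes>\<^bsub>G\<^esub> r) (l \<otimes>\<^bsub>G\<^esub> g \<otimes>\<^bsub>G\<^esub> r)
      (coord (tmap (atlas G) (\<lambda>z. l \<otimes>\<^bsub>G\<^esub> z \<otimes>\<^bsub>G\<^esub> r) g \<xi>) c')"
    using tangent_pair_translate[OF G h tendsto_const tendsto_const c c'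
        z[unfolded tangent_to_def, rule_format, OF c]] by simp
qed

lemma tmap_translate_tangent_space:
  assumes \<xi>: "\<xi> \<in> tangent_space (atlas G) g"
  shows "tmap (atlas G) (\<lambda>z. l \<otimes>\<^bsub>G\<^esub> z \<otimes>\<^bsub>G\<^esub> r) g \<xi> \<in> tangent_space (atlas G) (l \<otimes>\<^bsub>G\<^esub> g \<otimes>\<^bsub>G\<^esub> r)"
proof -
  obtain c where c: "c \<in> charts_at (atlas G) g" using charts_at_ne[OF G] by meson
  show ?thesis
    by (rule tangent_to_space[OF tangent_to_tmap[OF tangent_to_ray[OF \<xi> c] filterlim_ident] _ filterlim_ident])
      (simp_all add: tmap_def)
qed

text \<open>Removes the arbitrary source chart chosen inside \<open>tmap\<close>: in whichever chart
  it is read, the same ray is translated, so the two limits agree.\<close>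

lemma coord_tmap_translate:
  assumes \<xi>: "\<xi> \<in> tangent_space (atlas G) g" and c: "c \<in> charts_at (atlas G) g"
    and c': "c' \<in> charts_at (atlas G) (l \<otimes>\<^bsub>G\<^esub> g \<otimes>\<^bsub>G\<^esub> r)"
  shows "coord (tmap (atlas G) (\<lambda>z. l \<otimes>\<^bsub>G\<^esub> z \<otimes>\<^bsub>G\<^esub> r) g \<xi>) c' = dtrans G c c' l g r (coord \<xi> c)"
  by (rule dtrans_eqI[OF G _ filterlim_ident c c'
        tangent_to_ray[OF \<xi> c, unfolded tangent_to_def, rule_format, OF c]
        tangent_to_tmap[OF tangent_to_ray[OF \<xi> c] filterlim_ident, unfolded tangent_to_def, rule_format, OF c'],
        symmetric]) simp

text \<open>Inverse of the coordinate isomorphism of chart \<open>c\<close> from the tangent space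
  at \<open>g\<close> onto the modelling space; \<open>dtrans\<close> with units on both sides is
  the change of chart.\<close>

definition tlift :: "('g, 'e) chart \<Rightarrow> 'g \<Rightarrow> 'e \<Rightarrow> ('g, 'e) tvec" where
  "tlift c g X = Tvec (\<lambda>c'. if c' \<in> charts_at (atlas G) g then dtrans G c c' \<one>\<^bsub>G\<^esub> g \<one>\<^bsub>G\<^esub> X else 0)"

lemma tlift:
  assumes c: "c \<in> charts_at (atlas G) g"
  shows tlift_tangent_space: "tlift c g X \<in> tangent_space (atlas G) g"
    and coord_tlift: "coord (tlift c g X) c = X"
    and tlift_coord: "\<xi> \<in> tangent_space (atlas G) g \<Longrightarrow> tlift c g (coord \<xi> c) = \<xi>"
proof -
  have c1: "c' \<in> charts_at (atlas G) g \<longleftrightarrow> c' \<in> charts_at (atlas G) (\<one>\<^bsub>G\<^esub> \<otimes>\<^bsub>G\<^esub> g \<otimes>\<^bsub>G\<^esub> \<one>\<^bsub>G\<^esub>)" for c'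
    by (simp add: mem_carrier)
  let ?z = "\<lambda>h::real. chart_inv c (snd c g + h *\<^sub>R X)"
  have ray: "tangent_pair c (at 0) (\<lambda>h. h) (\<lambda>_. g) ?z g X"
    by (rule tangent_pair_ray[OF charts_at_is_chart[OF G c] charts_at_mem[OF G c] filterlim_ident tendsto_const])
  have "tangent_to (atlas G) (at 0) (\<lambda>h. h) ?z g (tlift c g X)"
    unfolding tangent_to_def
  proof
    fix c' assume c': "c' \<in> charts_at (atlas G) g"
    from tangent_pair_translate[OF G filterlim_ident tendsto_const tendsto_const c c'[unfolded c1] ray]
    show "tangent_pair c' (at 0) (\<lambda>h. h) (\<lambda>_. g) ?z g (coord (tlift c g X) c')"
      using c' by (simp add: tlift_def mem_carrier)
  qed
  then show "tlift c g X \<in> tangent_space (atlas G) g"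
    by (rule tangent_to_space[OF _ _ filterlim_ident]) (simp_all add: tlift_def)
  have "tangent_pair c (at 0) (\<lambda>h. h) (\<lambda>i. \<one>\<^bsub>G\<^esub> \<otimes>\<^bsub>G\<^esub> g \<otimes>\<^bsub>G\<^esub> \<one>\<^bsub>G\<^esub>)
      (\<lambda>i. \<one>\<^bsub>G\<^esub> \<otimes>\<^bsub>G\<^esub> ?z i \<otimes>\<^bsub>G\<^esub> \<one>\<^bsub>G\<^esub>) g X"
    using ray by (simp add: mem_carrier)
  then have "dtrans G c c \<one>\<^bsub>G\<^esub> g \<one>\<^bsub>G\<^esub> X = X"
    by (rule dtrans_eqI[OF G _ filterlim_ident c c[unfolded c1] ray, rotated]) simp
  then show "coord (tlift c g X) c = X"
    using c by (simp add: tlift_def)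
  assume \<xi>: "\<xi> \<in> tangent_space (atlas G) g"
  show "tlift c g (coord \<xi> c) = \<xi>"
  proof (rule tvec.expand, rule ext)
    fix c'
    show "coord (tlift c g (coord \<xi> c)) c' = coord \<xi> c'"
    proof (cases "c' \<in> charts_at (atlas G) g")
      case True
      then show ?thesis
        using tangent_space_coord[OF \<xi> c True] by (simp only: tlift_def tvec.sel if_True)
    next
      case False
      then have "coord \<xi> c' = 0"
        using \<xi> unfolding tangent_space_def by blast
      with False show ?thesis by (simp only: tlift_def tvec.sel if_False)
    qed
  qed
qed

lemma Ad_lie_algebra:
  assumes "\<xi> \<in> lie_algebra G"
  shows "Ad G g \<xi> \<in> lie_algebra G"
  using tmap_translate_tangent_space[of \<xi> "\<one>\<^bsub>G\<^esub>" g "inv\<^bsub>G\<^esub> g"] assms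
  by (simp add: lie_algebra_def Ad_def mem_carrier)

lemma coord_Ad:
  assumes "\<xi> \<in> lie_algebra G" and c: "c \<in> charts_at (atlas G) \<one>\<^bsub>G\<^esub>"
  shows "coord (Ad G g \<xi>) c = dtrans G c c g \<one>\<^bsub>G\<^esub> (inv\<^bsub>G\<^esub> g) (coord \<xi> c)"
  unfolding Ad_def
  by (rule coord_tmap_translate) (use assms in \<open>simp_all add: lie_algebra_def mem_carrier\<close>)

lemma tangent_to_log_deriv:
  assumes \<mu>: "C1_curve G \<mu>" and t: "t \<in> {0..1}"
  shows "tangent_to (atlas G) (at t within {0..1}) (\<lambda>s. s - t) (\<lambda>s. \<mu> s \<otimes>\<^bsub>G\<^esub> inv\<^bsub>G\<^esub> (\<mu> t)) \<one>\<^bsub>G\<^esub>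
    (log_deriv G \<mu> t)"
proof -
  have h: "filterlim (\<lambda>s. s - t) (at 0) (at t within {0..1})"
    by (auto simp: filterlim_at eventually_at_filter intro!: tendsto_eq_intros)
  have "(\<lambda>h. \<one>\<^bsub>G\<^esub> \<otimes>\<^bsub>G\<^esub> h \<otimes>\<^bsub>G\<^esub> inv\<^bsub>G\<^esub> (\<mu> t)) = (\<lambda>h. h \<otimes>\<^bsub>G\<^esub> inv\<^bsub>G\<^esub> (\<mu> t))"
    by (simp add: mem_carrier)
  then show ?thesis
    using tangent_to_tmap[OF tangent_to_velocity[OF \<mu> t] h, of "\<one>\<^bsub>G\<^esub>" "inv\<^bsub>G\<^esub> (\<mu> t)"]
    by (simp add: log_deriv_def mem_carrier)
qed

lemma Evol_primitive:
  assumes "\<phi> \<in> evol_domain G"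
  obtains \<mu> where "is_primitive G \<phi> \<mu>" "\<And>t. Evol G \<phi> t = \<mu> t \<otimes>\<^bsub>G\<^esub> inv\<^bsub>G\<^esub> (\<mu> 0)"
proof
  show "is_primitive G \<phi> (SOME \<mu>. is_primitive G \<phi> \<mu>)"
    using assms someI_ex[of "is_primitive G \<phi>"] by (simp add: evol_domain_def)
qed (simp add: Evol_def Let_def)

lemma Evol_0:
  assumes "\<phi> \<in> evol_domain G"
  shows "Evol G \<phi> 0 = \<one>\<^bsub>G\<^esub>"
  using Evol_primitive[OF assms] by (metis mem_carrier r_inv)

lemma Evol_tendsto:
  assumes "\<phi> \<in> evol_domain G" "t \<in> {0..1}"
  shows "(Evol G \<phi> \<longlongrightarrow> Evol G \<phi> t) (at t within {0..1})"
proof -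
  obtain \<mu> where \<mu>: "is_primitive G \<phi> \<mu>" "\<And>t. Evol G \<phi> t = \<mu> t \<otimes>\<^bsub>G\<^esub> inv\<^bsub>G\<^esub> (\<mu> 0)"
    by (rule Evol_primitive[OF assms(1)]) blast
  have "Evol G \<phi> = (\<lambda>t. \<mu> t \<otimes>\<^bsub>G\<^esub> inv\<^bsub>G\<^esub> (\<mu> 0))" using \<mu>(2) by blast
  moreover have "C1_curve G \<mu>" using \<mu>(1) unfolding is_primitive_def by (rule conjunct1)
  from tendsto_mult_lie[OF G C1_curve_tendsto[OF this assms(2)] tendsto_const]
  have "((\<lambda>s. \<mu> s \<otimes>\<^bsub>G\<^esub> inv\<^bsub>G\<^esub> (\<mu> 0)) \<longlongrightarrow> \<mu> t \<otimes>\<^bsub>G\<^esub> inv\<^bsub>G\<^esub> (\<mu> 0)) (at t within {0..1})" .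
  ultimately show ?thesis by simp
qed

text \<open>With \<open>\<mu>\<close>, \<open>\<nu>\<close> primitives of \<open>\<phi>\<close>, \<open>\<psi>\<close>, the quotient at time \<open>s\<close> is
  \<open>\<mu>(0) \<mu>(s)\<^sup>-\<^sup>1 (\<nu>(s) \<nu>(t)\<^sup>-\<^sup>1) \<nu>(t) \<nu>(0)\<^sup>-\<^sup>1\<close> and at time \<open>t\<close> it is
  \<open>\<mu>(0) \<mu>(s)\<^sup>-\<^sup>1 (\<mu>(s) \<mu>(t)\<^sup>-\<^sup>1) \<nu>(t) \<nu>(0)\<^sup>-\<^sup>1\<close>: the same translates of a pair of points near the unit.\<close>

lemma Evol_quotient_tangent_pair:
  assumes \<phi>: "\<phi> \<in> evol_domain G" and \<psi>: "\<psi> \<in> evol_domain G" and t: "t \<in> {0..1}"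
    and c: "c \<in> charts_at (atlas G) \<one>\<^bsub>G\<^esub>"
  defines "\<alpha> \<equiv> \<lambda>s. inv\<^bsub>G\<^esub> (Evol G \<phi> s) \<otimes>\<^bsub>G\<^esub> Evol G \<psi> s"
  assumes ct: "c \<in> charts_at (atlas G) (\<alpha> t)"
  shows "tangent_pair c (at t within {0..1}) (\<lambda>s. s - t) (\<lambda>_. \<alpha> t) \<alpha> (\<alpha> t)
    (dtrans G c c (inv\<^bsub>G\<^esub> (Evol G \<phi> t)) \<one>\<^bsub>G\<^esub> (Evol G \<psi> t) (coord (\<psi> t) c - coord (\<phi> t) c))"
proof -
  let ?F = "at t within {0..1}"
  obtain \<mu> where \<mu>: "is_primitive G \<phi> \<mu>" "\<And>t. Evol G \<phi> t = \<mu> t \<otimes>\<^bsub>G\<^esub> inv\<^bsub>G\<^esub> (\<mu> 0)"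
    by (rule Evol_primitive[OF \<phi>]) blast
  obtain \<nu> where \<nu>: "is_primitive G \<psi> \<nu>" "\<And>t. Evol G \<psi> t = \<nu> t \<otimes>\<^bsub>G\<^esub> inv\<^bsub>G\<^esub> (\<nu> 0)"
    by (rule Evol_primitive[OF \<psi>]) blast
  let ?u = "\<lambda>s. \<mu> s \<otimes>\<^bsub>G\<^esub> inv\<^bsub>G\<^esub> (\<mu> t)" and ?w = "\<lambda>s. \<nu> s \<otimes>\<^bsub>G\<^esub> inv\<^bsub>G\<^esub> (\<nu> t)"
  have h: "filterlim (\<lambda>s. s - t) (at 0) ?F"
    by (auto simp: filterlim_at eventually_at_filter intro!: tendsto_eq_intros)
  have "tangent_to (atlas G) ?F (\<lambda>s. s - t) ?u \<one>\<^bsub>G\<^esub> (\<phi> t)" "tangent_to (atlas G) ?F (\<lambda>s. s - t) ?w \<one>\<^bsub>G\<^esub> (\<psi> t)"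
    using \<mu>(1) \<nu>(1) t tangent_to_log_deriv unfolding is_primitive_def by auto
  then have "tangent_pair c ?F (\<lambda>s. s - t) (\<lambda>_. \<one>\<^bsub>G\<^esub>) ?u \<one>\<^bsub>G\<^esub> (coord (\<phi> t) c)"
      "tangent_pair c ?F (\<lambda>s. s - t) (\<lambda>_. \<one>\<^bsub>G\<^esub>) ?w \<one>\<^bsub>G\<^esub> (coord (\<psi> t) c)"
    using c unfolding tangent_to_def by auto
  \<comment> \<open>Both moving points are paired with the unit; running the first pair backwards
    joins them directly and subtracts the logarithmic derivatives.\<close>
  from tangent_pair_trans[OF tangent_pair_swap[OF this(1)] this(2)]
  have uw: "tangent_pair c ?F (\<lambda>s. s - t) ?u ?w \<one>\<^bsub>G\<^esub> (coord (\<psi> t) c - coord (\<phi> t) c)"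
    by simp
  have l: "((\<lambda>s. inv\<^bsub>G\<^esub> (Evol G \<phi> s)) \<longlongrightarrow> inv\<^bsub>G\<^esub> (Evol G \<phi> t)) ?F"
    by (intro tendsto_inv_lie[OF G] Evol_tendsto \<phi> t)
  have eq: "inv\<^bsub>G\<^esub> (Evol G \<phi> s) \<otimes>\<^bsub>G\<^esub> ?u s \<otimes>\<^bsub>G\<^esub> Evol G \<psi> t = \<alpha> t"
       "inv\<^bsub>G\<^esub> (Evol G \<phi> s) \<otimes>\<^bsub>G\<^esub> ?w s \<otimes>\<^bsub>G\<^esub> Evol G \<psi> t = \<alpha> s"
       "inv\<^bsub>G\<^esub> (Evol G \<phi> t) \<otimes>\<^bsub>G\<^esub> \<one>\<^bsub>G\<^esub> \<otimes>\<^bsub>G\<^esub> Evol G \<psi> t = \<alpha> t" for s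
    unfolding \<alpha>_def \<mu>(2) \<nu>(2)
    by (simp_all add: m_assoc inv_mult_group mem_carrier inv_mult_cancel)
  have "c \<in> charts_at (atlas G) (inv\<^bsub>G\<^esub> (Evol G \<phi> t) \<otimes>\<^bsub>G\<^esub> \<one>\<^bsub>G\<^esub> \<otimes>\<^bsub>G\<^esub> Evol G \<psi> t)"
    using ct unfolding eq .
  from tangent_pair_translate[OF G h l tendsto_const c this uw]
  show ?thesis unfolding eq .
qed

end

section \<open>Curves in the Lie algebra and Mackey convergence\<close>

lemma coord_simps [simp]:
  "coord 0 c = 0" "coord (\<xi> + \<eta>) c = coord \<xi> c + coord \<eta> c" "coord (\<xi> - \<eta>) c = coord \<xi> c - coord \<eta> c"
  "coord (r *\<^sub>R \<xi>) c = r *\<^sub>R coord \<xi> c"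
  by (simp_all add: zero_tvec_def plus_tvec_def minus_tvec_def scaleR_tvec_def)

lemma tendsto_coord:
  fixes f :: "'i \<Rightarrow> ('g, 'e::topological_space) tvec"
  assumes "(f \<longlongrightarrow> \<xi>) F"
  shows "((\<lambda>i. coord (f i) c) \<longlongrightarrow> coord \<xi> c) F"
  by (rule continuous_on_tendsto_compose[OF continuous_on_coord assms]) auto

lemma tendsto_tvecI:
  fixes f :: "'i \<Rightarrow> ('g, 'e::topological_space) tvec"
  assumes "\<And>c. ((\<lambda>i. coord (f i) c) \<longlongrightarrow> coord \<xi> c) F"
  shows "(f \<longlongrightarrow> \<xi>) F"
proof (rule topological_tendstoI)
  fix U :: "('g, 'e) tvec set" assume U: "open U" "\<xi> \<in> U"
  have "((\<lambda>i. coord (f i)) \<longlongrightarrow> coord \<xi>) F"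
    by (rule tendsto_funI) (rule assms)
  moreover have "open (Tvec -` U)" "coord \<xi> \<in> Tvec -` U"
    using U by (simp_all add: open_tvec_def)
  ultimately have "\<forall>\<^sub>F i in F. coord (f i) \<in> Tvec -` U"
    by (rule topological_tendstoD)
  then show "\<forall>\<^sub>F i in F. f i \<in> U" by simp
qed

text \<open>\<open>cderiv\<close> is built from \<open>Lim\<close>, which says nothing when there is
  no limit; this records that the limits below order \<open>m\<close> exist.\<close>

definition cderiv_lim :: "nat \<Rightarrow> (real \<Rightarrow> 'a::{real_vector,t2_space}) \<Rightarrow> bool" where
  "cderiv_lim m \<gamma> \<longleftrightarrow> (\<forall>i<m. \<forall>t\<in>{0..1}.
     ((\<lambda>s. (1 / (s - t)) *\<^sub>R (cderiv i \<gamma> s - cderiv i \<gamma> t)) \<longlongrightarrow> cderiv (Suc i) \<gamma> t) (at t within {0..1}))"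

lemma at_within_unit_neq_bot: "t \<in> {0..1} \<Longrightarrow> at t within {0..1::real} \<noteq> bot"
  by (simp add: trivial_limit_within islimpt_Icc)

text \<open>With the constant direction 1, \<open>bdiff\<close> is the ordinary derivative of the
  extension; restricting its limit to \<open>{0..1}\<close> gives the one-sided derivatives at the
  end points.\<close>

lemma bastiani_cderiv:
  fixes \<nu> :: "real \<Rightarrow> 'a::{real_vector,t2_space}"
  assumes \<nu>: "bastiani k J \<nu>" and J: "{0..1} \<subseteq> J" and eq: "\<And>t. t \<in> {0..1} \<Longrightarrow> \<gamma> t = \<nu> t"
    and m: "enat m \<le> k"
  shows "cderiv_lim m \<gamma> \<and> (\<forall>t\<in>{0..1}. cderiv m \<gamma> t = bdiff m \<nu> t (\<lambda>_. 1))"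
  using m
proof (induction m)
  case 0
  then show ?case by (simp add: cderiv_lim_def eq)
next
  case (Suc m)
  have "enat m \<le> k" using Suc.prems by (meson Suc_ile_eq less_imp_le)
  from Suc.IH[OF this] have IH: "cderiv_lim m \<gamma>" "\<And>t. t \<in> {0..1} \<Longrightarrow> cderiv m \<gamma> t = bdiff m \<nu> t (\<lambda>_. 1)"
    by auto
  have lim: "((\<lambda>s. (1 / (s - t)) *\<^sub>R (cderiv m \<gamma> s - cderiv m \<gamma> t)) \<longlongrightarrow> bdiff (Suc m) \<nu> t (\<lambda>_. 1)) (at t within {0..1})"
    if t: "t \<in> {0..1}" for t
  proof -
    let ?b = "\<lambda>t. bdiff m \<nu> t (\<lambda>_. 1)"
    have "\<forall>p. enat (Suc p) \<le> k \<longrightarrow> (\<forall>x\<in>J. \<forall>v. \<exists>l.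
        ((\<lambda>h::real. (1 / h) *\<^sub>R (bdiff p \<nu> (x + h *\<^sub>R v p) v - bdiff p \<nu> x v)) \<longlongrightarrow> l) (at 0))"
      using \<nu> unfolding bastiani_def by simp
    from this[rule_format, OF Suc.prems subsetD[OF J t], of "\<lambda>_. 1"]
    obtain l where l: "((\<lambda>h. (1 / h) *\<^sub>R (?b (t + h *\<^sub>R 1) - ?b t)) \<longlongrightarrow> l) (at 0)" by blast
    then have "bdiff (Suc m) \<nu> t (\<lambda>_. 1) = l"
      unfolding bdiff.simps ddir_def by (intro tendsto_Lim) auto
    moreover have "filterlim (\<lambda>s. s - t) (at 0) (at t within {0..1})"
      by (auto simp: filterlim_at eventually_at_filter intro!: tendsto_eq_intros)
    from filterlim_compose[OF l this]
    have "((\<lambda>s. (1 / (s - t)) *\<^sub>R (?b s - ?b t)) \<longlongrightarrow> l) (at t within {0..1})"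
      by simp
    then have "((\<lambda>s. (1 / (s - t)) *\<^sub>R (cderiv m \<gamma> s - cderiv m \<gamma> t)) \<longlongrightarrow> l) (at t within {0..1})"
      by (rule Lim_transform_eventually) (simp add: eventually_at_filter IH(2) IH(2)[OF t])
    ultimately show ?thesis by simp
  qed
  have eqs: "cderiv (Suc m) \<gamma> t = bdiff (Suc m) \<nu> t (\<lambda>_. 1)" if "t \<in> {0..1}" for t
    unfolding cderiv.simps by (rule tendsto_Lim[OF at_within_unit_neq_bot[OF that] lim[OF that]])
  have "cderiv_lim (Suc m) \<gamma>"
    unfolding cderiv_lim_def
  proof (intro allI impI ballI)
    fix i t assume i: "i < Suc m" and t: "t \<in> {0..1::real}"
    show "((\<lambda>s. (1 / (s - t)) *\<^sub>R (cderiv i \<gamma> s - cderiv i \<gamma> t)) \<longlongrightarrow> cderiv (Suc i) \<gamma> t) (at t within {0..1})"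
    proof (cases "i = m")
      case True
      show ?thesis unfolding True eqs[OF t] by (rule lim[OF t])
    next
      case False
      then have "i < m" using i by simp
      then show ?thesis using IH(1) t unfolding cderiv_lim_def by blast
    qed
  qed
  with eqs show ?case by blast
qed

text \<open>Limits of differences are taken coordinate by coordinate, in the locally convex space
  \<open>'e\<close>, and then reassembled in \<open>tvec\<close>.\<close>

lemma cderiv_diff:
  fixes \<gamma> \<eta> :: "real \<Rightarrow> ('g, 'e::locally_convex_space) tvec"
  assumes "cderiv_lim m \<gamma>" "cderiv_lim m \<eta>" "t \<in> {0..1}"
  shows "cderiv m (\<lambda>t. \<gamma> t - \<eta> t) t = cderiv m \<gamma> t - cderiv m \<eta> t"
  using assms
proof (induction m arbitrary: t)
  case (Suc m)
  have m: "cderiv_lim m \<gamma>" "cderiv_lim m \<eta>"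
    using Suc.prems unfolding cderiv_lim_def by auto
  have "((\<lambda>s. (1 / (s - t)) *\<^sub>R (cderiv m \<gamma> s - cderiv m \<gamma> t)) \<longlongrightarrow> cderiv (Suc m) \<gamma> t) (at t within {0..1})"
      "((\<lambda>s. (1 / (s - t)) *\<^sub>R (cderiv m \<eta> s - cderiv m \<eta> t)) \<longlongrightarrow> cderiv (Suc m) \<eta> t) (at t within {0..1})"
    using Suc.prems unfolding cderiv_lim_def by blast+
  from this[THEN tendsto_coord]
  have "((\<lambda>s. (1 / (s - t)) *\<^sub>R (cderiv m \<gamma> s - cderiv m \<gamma> t) - (1 / (s - t)) *\<^sub>R (cderiv m \<eta> s - cderiv m \<eta> t))
      \<longlongrightarrow> cderiv (Suc m) \<gamma> t - cderiv (Suc m) \<eta> t) (at t within {0..1})"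
    by (intro tendsto_tvecI) (auto simp del: cderiv.simps intro!: tendsto_diff)
  then have "((\<lambda>s. (1 / (s - t)) *\<^sub>R (cderiv m (\<lambda>t. \<gamma> t - \<eta> t) s - cderiv m (\<lambda>t. \<gamma> t - \<eta> t) t))
      \<longlongrightarrow> cderiv (Suc m) \<gamma> t - cderiv (Suc m) \<eta> t) (at t within {0..1})"
    by (rule Lim_transform_eventually)
      (simp add: eventually_at_filter Suc.IH[OF m] Suc.IH[OF m Suc.prems(3)] scaleR_diff_right del: cderiv.simps)
  then have "Lim (at t within {0..1}) (\<lambda>s. (1 / (s - t)) *\<^sub>R (cderiv m (\<lambda>t. \<gamma> t - \<eta> t) s - cderiv m (\<lambda>t. \<gamma> t - \<eta> t) t))
      = cderiv (Suc m) \<gamma> t - cderiv (Suc m) \<eta> t"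
    by (rule tendsto_Lim[OF at_within_unit_neq_bot[OF Suc.prems(3)]])
  then show ?case by (simp only: cderiv.simps)
qed simp

lemma alg_curve_cderiv_lim:
  assumes \<gamma>: "\<gamma> \<in> alg_curves G \<Xi> (Diff k)" and s: "enat s \<le> k" "m \<le> s"
  shows "cderiv_lim m \<gamma>"
proof -
  obtain a b \<nu> where ab: "a < 0" "1 < b" and \<nu>: "bastiani k {a<..<b} \<nu>" and eq: "\<forall>t\<in>{0..1}. \<gamma> t = \<nu> t"
    using \<gamma> unfolding alg_curves.simps extends_with_def by blast
  have "enat m \<le> k" using s by (meson enat_ord_simps(1) order_trans)
  moreover have "{0..1} \<subseteq> {a<..<b}" using ab by auto
  ultimately show ?thesis
    using bastiani_cderiv[OF \<nu>, of \<gamma> m] eq by blast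
qed

text \<open>Hypothesis b) bounds the increment of \<open>\<Phi>\<close>, whereas Mackey convergence
  asks for the opposite difference. For derivatives the change of sign is legitimate because the
  limits in \<open>cderiv\<close> exist for curves of the class.\<close>

lemma sup_seminorm_diff_commute:
  fixes \<gamma> \<eta> :: "real \<Rightarrow> ('g, 'e::locally_convex_space) tvec"
  assumes \<gamma>: "\<gamma> \<in> alg_curves G \<Xi> k" and \<eta>: "\<eta> \<in> alg_curves G \<Xi> k" and s: "s \<preceq> k"
    and p: "p \<in> cont_seminorms"
  shows "sup_seminorm (p \<circ> d_chart \<Xi>) s (\<lambda>t. \<gamma> t - \<eta> t) = sup_seminorm (p \<circ> d_chart \<Xi>) s (\<lambda>t. \<eta> t - \<gamma> t)"
proof (cases s)
  case (Ord n)
  have lim: "cderiv_lim m \<gamma> \<and> cderiv_lim m \<eta>" if "m \<le> n" for m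
  proof (cases k)
    case (Diff k')
    then show ?thesis
      using that \<gamma> \<eta> s Ord alg_curve_cderiv_lim[of _ G \<Xi> k' n m] by simp
  next
    case Const
    with s Ord that have "m = 0" by simp
    then show ?thesis by (simp add: cderiv_lim_def)
  qed (use s Ord in simp)
  have "(p \<circ> d_chart \<Xi>) (cderiv m (\<lambda>t. \<gamma> t - \<eta> t) t) = (p \<circ> d_chart \<Xi>) (cderiv m (\<lambda>t. \<eta> t - \<gamma> t) t)"
    if "m \<le> n" "t \<in> {0..1}" for m t
    using lim[OF that(1)] that(2) by (simp add: cderiv_diff d_chart_def seminorm_diff_commute[OF p])
  then show ?thesis
    unfolding Ord sup_seminorm.simps by (intro SUP_cong) auto
next
  case LipOrd
  have 1: "(p \<circ> d_chart \<Xi>) (\<gamma> t - \<eta> t) = (p \<circ> d_chart \<Xi>) (\<eta> t - \<gamma> t)" for t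
    by (simp add: d_chart_def seminorm_diff_commute[OF p])
  have "coord ((\<gamma> t - \<eta> t) - (\<gamma> t' - \<eta> t')) \<Xi> = - coord ((\<eta> t - \<gamma> t) - (\<eta> t' - \<gamma> t')) \<Xi>" for t t'
    by simp
  then have 2: "(p \<circ> d_chart \<Xi>) ((\<gamma> t - \<eta> t) - (\<gamma> t' - \<eta> t')) = (p \<circ> d_chart \<Xi>) ((\<eta> t - \<gamma> t) - (\<eta> t' - \<gamma> t'))" for t t'
    by (simp only: comp_def d_chart_def seminorm_minus[OF p])
  show ?thesis
    unfolding LipOrd sup_seminorm.simps Lip_const_def 1 2 ..
qed

lemma alg_curve_lie_algebra:
  assumes \<gamma>: "\<gamma> \<in> alg_curves G \<Xi> k" and t: "t \<in> {0..1}"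
  shows "\<gamma> t \<in> lie_algebra G"
proof (cases k)
  case (Diff k')
  obtain a b \<nu> where "a < 0" "1 < b" "\<nu> ` {a<..<b} \<subseteq> lie_algebra G" "\<forall>t\<in>{0..1}. \<gamma> t = \<nu> t"
    using \<gamma> unfolding Diff alg_curves.simps extends_with_def by blast
  moreover have "t \<in> {a<..<b}" using calculation t by auto
  ultimately show ?thesis using t by (metis image_subset_iff)
qed (use \<gamma> t in auto)

lemma alg_curve_continuous:
  fixes \<Xi> :: "('g::topological_space, 'e::locally_convex_space) chart"
  assumes \<gamma>: "\<gamma> \<in> alg_curves G \<Xi> k"
  shows "continuous_on {0..1} (\<lambda>t. coord (\<gamma> t) \<Xi>)"
proof (cases k)
  case (Diff k')
  obtain a b \<nu> where ab: "a < 0" "1 < b" and \<nu>: "bastiani k' {a<..<b} \<nu>" and eq: "\<forall>t\<in>{0..1}. \<gamma> t = \<nu> t"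
    using \<gamma> unfolding Diff alg_curves.simps extends_with_def by blast
  \<comment> \<open>Order 0 of \<open>bastiani\<close> is continuity in the point and the direction
    sequence together; freezing the directions leaves continuity of the curve.\<close>
  have "continuous_on ({a<..<b} \<times> UNIV) (\<lambda>(x, v). bdiff 0 \<nu> x v)"
    using \<nu> unfolding bastiani_def by (metis zero_enat_def zero_le)
  then have c: "continuous_on ({a<..<b} \<times> (UNIV :: (nat \<Rightarrow> real) set)) (\<lambda>z. \<nu> (fst z))"
    by (simp add: case_prod_unfold)
  have "continuous_on {0..1} (\<lambda>t. (t, \<lambda>_::nat. 0 :: real))"
    by (intro continuous_intros)
  moreover have "(\<lambda>t. (t, \<lambda>_::nat. 0 :: real)) ` {0..1} \<subseteq> {a<..<b} \<times> UNIV"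
    using ab by auto
  ultimately have "continuous_on {0..1} \<nu>"
    using continuous_on_compose2[OF c] by fastforce
  then have "continuous_on {0..1} (\<lambda>t. coord (\<nu> t) \<Xi>)"
    by (rule continuous_on_compose2[OF continuous_on_coord]) auto
  then show ?thesis by (rule continuous_on_eq) (use eq in auto)
next
  case Lip
  have "((\<lambda>s. coord (\<gamma> s) \<Xi>) \<longlongrightarrow> coord (\<gamma> t) \<Xi>) (at t within {0..1})" if t: "t \<in> {0..1}" for t
    unfolding tendsto_seminorm_iff
  proof (intro ballI allI impI)
    fix p :: "'e \<Rightarrow> real" and e :: real
    assume p: "p \<in> cont_seminorms" and e: "e > 0"
    have "Lip_const (p \<circ> d_chart \<Xi>) \<gamma> < \<infinity>" using \<gamma> p Lip by auto
    then obtain K where K: "Lip_const (p \<circ> d_chart \<Xi>) \<gamma> \<le> ereal K"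
      by (cases "Lip_const (p \<circ> d_chart \<Xi>) \<gamma>") auto
    have "p (coord (\<gamma> s) \<Xi> - coord (\<gamma> t) \<Xi>) \<le> K * \<bar>s - t\<bar>" if s: "s \<in> {0..1}" "s \<noteq> t" for s
    proof -
      have "ereal ((p \<circ> d_chart \<Xi>) (\<gamma> s - \<gamma> t) / \<bar>s - t\<bar>) \<le> Lip_const (p \<circ> d_chart \<Xi>) \<gamma>"
        unfolding Lip_const_def by (rule SUP_upper2[of "(s, t)"]) (use s t in auto)
      with K have "ereal ((p \<circ> d_chart \<Xi>) (\<gamma> s - \<gamma> t) / \<bar>s - t\<bar>) \<le> ereal K" by (rule order_trans[rotated])
      then show ?thesis using s by (simp add: d_chart_def pos_divide_le_eq)
    qed
    then have "\<forall>\<^sub>F s in at t within {0..1}. p (coord (\<gamma> s) \<Xi> - coord (\<gamma> t) \<Xi>) \<le> K * \<bar>s - t\<bar>"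
      by (simp add: eventually_at_filter)
    moreover have "((\<lambda>s. K * \<bar>s - t\<bar>) \<longlongrightarrow> 0) (at t within {0..1})"
      by (auto intro!: tendsto_eq_intros)
    from order_tendstoD(2)[OF this e] have "\<forall>\<^sub>F s in at t within {0..1}. K * \<bar>s - t\<bar> < e" .
    ultimately show "\<forall>\<^sub>F s in at t within {0..1}. p (coord (\<gamma> s) \<Xi> - coord (\<gamma> t) \<Xi>) < e"
      by eventually_elim simp
  qed
  then show ?thesis unfolding continuous_on_def by blast
next
  case Const
  then obtain X where "\<forall>t\<in>{0..1}. \<gamma> t = X" using \<gamma> by auto
  then have "continuous_on {0..1} (\<lambda>t. coord (\<gamma> t) \<Xi>) \<longleftrightarrow> continuous_on {0..1::real} (\<lambda>t. coord X \<Xi>)"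
    by (intro continuous_on_cong) auto
  then show ?thesis by simp
qed

text \<open>Every class admits an index that controls the values of a curve: \<open>LipOrd\<close>
  for \<open>Lip\<close>, order 0 otherwise. It turns b) into a bound uniform in
  \<open>t\<close>.\<close>

lemma sup_seminorm_upper:
  obtains s where "s \<preceq> k"
    and "\<And>q \<gamma> t. t \<in> {0..1} \<Longrightarrow> ereal (q (\<gamma> t :: 'a::{real_vector,t2_space})) \<le> sup_seminorm q s \<gamma>"
proof (cases "k = Lip")
  case True
  have "ereal (q (\<gamma> t)) \<le> sup_seminorm q LipOrd \<gamma>" if "t \<in> {0..1}" for q and \<gamma> :: "real \<Rightarrow> 'a" and t
    unfolding sup_seminorm.simps by (rule max.coboundedI1, rule SUP_upper2[OF that]) simp
  then show thesis using that[of LipOrd] True by simp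
next
  case False
  have "ereal (q (\<gamma> t)) \<le> sup_seminorm q (Ord 0) \<gamma>" if "t \<in> {0..1}" for q and \<gamma> :: "real \<Rightarrow> 'a" and t
    by simp (rule SUP_upper2[OF that], simp)
  moreover have "Ord 0 \<preceq> k" using False by (cases k) (simp_all add: zero_enat_def[symmetric])
  ultimately show thesis using that[of "Ord 0"] by simp
qed

text \<open>Mackey continuity speaks of sequences, and a property holding eventually along every
  null sequence holds near 0. Hypothesis b) makes each such sequence of increments Mackey
  convergent.\<close>

lemma mackey_Evol_uniform:
  fixes G :: "('g::t2_space, 'e::locally_convex_space, 'm) lie_group_data_scheme"
  assumes mc: "mackey_continuous G \<Xi> k" and I: "open I" "x \<in> I"
    and \<Phi>: "\<And>z. z \<in> I \<Longrightarrow> \<Phi> z \<in> evol_domain_k G \<Xi> k"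
    and L: "\<And>p s. p \<in> cont_seminorms \<Longrightarrow> s \<preceq> k \<Longrightarrow>
           \<exists>L\<ge>0. \<exists>J. open J \<and> J \<subseteq> I \<and> x \<in> J \<and>
             (\<forall>h. h \<noteq> 0 \<and> x + h \<in> J \<longrightarrow>
                ereal (1 / \<bar>h\<bar>) * sup_seminorm (p \<circ> d_chart \<Xi>) s (\<lambda>t. \<Phi> (x + h) t - \<Phi> x t)
                  \<le> ereal L)"
    and U: "open U" "\<one>\<^bsub>G\<^esub> \<in> U"
  shows "\<forall>\<^sub>F h in at 0. \<forall>t\<in>{0..1}. inv\<^bsub>G\<^esub> (Evol G (\<Phi> x) t) \<otimes>\<^bsub>G\<^esub> Evol G (\<Phi> (x + h)) t \<in> U"
proof -
  let ?Q = "\<lambda>h. \<forall>t\<in>{0..1}. inv\<^bsub>G\<^esub> (Evol G (\<Phi> x) t) \<otimes>\<^bsub>G\<^esub> Evol G (\<Phi> (x + h)) t \<in> U"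
  \<comment> \<open>The increments that stay in \<open>I\<close>. This is an open neighbourhood of
    0, so \<open>at 0 within S\<close> and \<open>at 0\<close> coincide.\<close>
  define S where "S = (\<lambda>h. x + h) -` I"
  have S: "open S" "0 \<in> S"
    using I unfolding S_def by (auto intro!: open_vimage continuous_intros)
  define B where "B p s L J \<longleftrightarrow> L \<ge> 0 \<and> open J \<and> J \<subseteq> I \<and> x \<in> J \<and> (\<forall>h. h \<noteq> 0 \<and> x + h \<in> J \<longrightarrow>
      ereal (1 / \<bar>h\<bar>) * sup_seminorm (p \<circ> d_chart \<Xi>) s (\<lambda>t. \<Phi> (x + h) t - \<Phi> x t) \<le> ereal L)"
    for p s L J
  have "\<exists>L J. B p s L J" if "p \<in> cont_seminorms" "s \<preceq> k" for p s
    using L[OF that] unfolding B_def by blast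
  \<comment> \<open>Bounds and neighbourhoods are chosen for all \<open>p\<close> and
    \<open>s\<close> together, since Mackey convergence asks for families of constants.\<close>
  then obtain L J where LJ: "\<And>p s. p \<in> cont_seminorms \<Longrightarrow> s \<preceq> k \<Longrightarrow> B p s (L p s) (J p s)"
    by metis
  have "eventually ?Q (at 0 within S)"
  proof (rule sequentially_imp_eventually_within, intro allI impI)
    fix h :: "nat \<Rightarrow> real"
    assume h: "(\<forall>n. h n \<in> S \<and> h n \<noteq> 0) \<and> h \<longlonglongrightarrow> 0"
    then have hI: "x + h n \<in> I" and hn: "h n \<noteq> 0" and h0: "h \<longlonglongrightarrow> 0" for n
      unfolding S_def by auto
    have "\<exists>N. \<forall>n\<ge>N. x + h n \<in> J p s" if "p \<in> cont_seminorms" "s \<preceq> k" for p s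
    proof -
      have "(\<lambda>n. x + h n) \<longlonglongrightarrow> x + 0" by (intro tendsto_intros h0)
      then have "\<forall>\<^sub>F n in sequentially. x + h n \<in> J p s"
        by (rule topological_tendstoD) (use LJ[OF that] in \<open>simp_all add: B_def\<close>)
      then show ?thesis by (simp add: eventually_sequentially)
    qed
    then obtain l where l: "\<And>p s n. p \<in> cont_seminorms \<Longrightarrow> s \<preceq> k \<Longrightarrow> n \<ge> l p s \<Longrightarrow> x + h n \<in> J p s"
      by metis
    have "mackey_converges \<Xi> k (\<lambda>n. \<Phi> (x + h n)) (\<Phi> x)"
      unfolding mackey_converges_def
    \<comment> \<open>The constants are those of b), the common null sequence is
      \<open>\<bar>h n\<bar>\<close>, and \<open>l p s\<close> is an index after which
      \<open>x + h n\<close> stays in \<open>J p s\<close>.\<close>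
    proof (intro exI[of _ L] exI[of _ l] exI[of _ "\<lambda>n. \<bar>h n\<bar>"] conjI ballI allI impI)
      show "(\<lambda>n. \<bar>h n\<bar>) \<longlonglongrightarrow> 0" using h0 by (rule tendsto_rabs_zero)
      fix p :: "'e \<Rightarrow> real" and s assume ps: "p \<in> cont_seminorms" "s \<preceq> k"
      show "L p s \<ge> 0" using LJ[OF ps] by (simp add: B_def)
      fix n assume n: "l p s \<le> n"
      let ?\<gamma> = "\<lambda>t. \<Phi> (x + h n) t - \<Phi> x t"
      have "\<Phi> (x + h n) \<in> alg_curves G \<Xi> k" "\<Phi> x \<in> alg_curves G \<Xi> k"
        using \<Phi>[OF hI] \<Phi>[OF I(2)] unfolding evol_domain_k_def by auto
      from sup_seminorm_diff_commute[OF this(2,1) ps(2,1)]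
      have "sup_seminorm (p \<circ> d_chart \<Xi>) s (\<lambda>t. \<Phi> x t - \<Phi> (x + h n) t) = sup_seminorm (p \<circ> d_chart \<Xi>) s ?\<gamma>" .
      moreover have "ereal (1 / \<bar>h n\<bar>) * sup_seminorm (p \<circ> d_chart \<Xi>) s ?\<gamma> \<le> ereal (L p s)"
        using LJ[OF ps] l[OF ps n] hn unfolding B_def by blast
      \<comment> \<open>The supremum is an extended real; the value \<open>\<infinity>\<close> is
        excluded because \<open>1 / \<bar>h n\<bar>\<close> is positive and the product is
        bounded.\<close>
      then have "sup_seminorm (p \<circ> d_chart \<Xi>) s ?\<gamma> \<le> ereal (L p s * \<bar>h n\<bar>)"
        using hn[of n] by (cases "sup_seminorm (p \<circ> d_chart \<Xi>) s ?\<gamma>") (auto simp: field_simps)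
      ultimately show "sup_seminorm (p \<circ> d_chart \<Xi>) s (\<lambda>t. \<Phi> x t - \<Phi> (x + h n) t) \<le> ereal (L p s * \<bar>h n\<bar>)"
        by simp
    qed auto
    from mc[unfolded mackey_continuous_def, rule_format, OF \<Phi>[OF I(2)] \<Phi>[OF hI] this conjI[OF U]]
    have "\<exists>N. \<forall>n\<ge>N. ?Q (h n)" by blast
    then show "\<forall>\<^sub>F n in sequentially. ?Q (h n)"
      by (simp add: eventually_sequentially)
  qed
  then show ?thesis
    using at_within_open[OF S(2,1)] by simp
qed

section \<open>Riemann sums of the velocity\<close>

lemma sum_increments_tagged_division:
  fixes f :: "real \<Rightarrow> 'a::ab_group_add"
  assumes "a \<le> b" and P: "P tagged_division_of {a..b}"
  shows "(\<Sum>(x, K)\<in>P. f (Sup K) - f (Inf K)) = f b - f a"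
proof -
  \<comment> \<open>The empty interval gets the value 0 explicitly, since \<open>Sup\<close> and
    \<open>Inf\<close> of the empty set carry no information; increments are then additive under
    splitting.\<close>
  let ?g = "\<lambda>K::real set. if K = {} then 0 else f (Sup K) - f (Inf K)"
  interpret operative_real plus 0 ?g
    rewrites "comm_monoid_set.F (+) 0 = sum"
    by standard[1] (auto simp add: sum_def)
  from tagged_division[OF P]
  have "?g {a..b} = (\<Sum>(x, K)\<in>P. ?g K)" by (rule sym)
  also have "\<dots> = (\<Sum>(x, K)\<in>P. f (Sup K) - f (Inf K))"
    using P by (intro sum.cong) auto
  finally show ?thesis using \<open>a \<le> b\<close> by simp
qed

text \<open>On a piece with tag \<open>x\<close> the curve \<open>D r - r *\<^sub>R f x\<close> has
  derivative \<open>D' - f x\<close>, of seminorm at most \<open>g + e\<close> since the piece lies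
  in \<open>ball x \<delta>\<close>. The mean value inequality bounds its increment by that of the
  antiderivative \<open>G\<close>, and both sides telescope over the pieces.\<close>

lemma riemann_sum_increment_bound:
  fixes D D' f :: "real \<Rightarrow> 'a::locally_convex_space" and g :: "real \<Rightarrow> real"
  assumes p: "p \<in> cont_seminorms"
    and D: "\<And>s. s \<in> {0..1} \<Longrightarrow> ((\<lambda>r. (1 / (r - s)) *\<^sub>R (D r - D s)) \<longlongrightarrow> D' s) (at s within {0..1})"
    and g: "continuous_on {0..1} g" "\<And>s. s \<in> {0..1} \<Longrightarrow> p (D' s - f s) \<le> g s"
    and f: "\<And>s r. s \<in> {0..1} \<Longrightarrow> r \<in> {0..1} \<Longrightarrow> \<bar>s - r\<bar> < \<delta> \<Longrightarrow> p (f s - f r) \<le> e"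
    and t: "t \<in> {0..1}" and e: "e \<ge> 0"
    and P: "P tagged_division_of {0..t}" "(\<lambda>x. ball x \<delta>) fine P"
  shows "p (D t - D 0 - (\<Sum>(x, K)\<in>P. Henstock_Kurzweil_Integration.content K *\<^sub>R f x))
    \<le> integral {0..1} g + e"
proof -
  define G where "G s = integral {0..s} g + e * s" for s
  have G: "(G has_real_derivative g s + e) (at s within {0..1})" if s: "s \<in> {0..1}" for s
    unfolding G_def
    by (auto intro!: derivative_eq_intros integral_has_real_derivative[OF g(1) s])
  have piece: "p (D (Sup K) - D (Inf K) - Henstock_Kurzweil_Integration.content K *\<^sub>R f x) \<le> G (Sup K) - G (Inf K)"
    if xK: "(x, K) \<in> P" for x K
  proof -
    obtain u v where K: "K = {u..v}" using P(1) xK by (metis box_real(2) tagged_division_ofD(4))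
    have "x \<in> K" "K \<subseteq> {0..t}" using P(1) xK by (auto dest: tagged_division_ofD(2,3))
    then have x: "x \<in> {u..v}" and uv: "u \<le> v" "{u..v} \<subseteq> {0..1}" using t unfolding K by force+
    have ball: "{u..v} \<subseteq> ball x \<delta>" using fineD[OF P(2) xK] unfolding K .
    have "p ((D v - v *\<^sub>R f x) - (D u - u *\<^sub>R f x)) \<le> G v - G u"
    proof (rule seminorm_mean_value[OF p uv(1), where c' = "\<lambda>s. D' s - f x" and G' = "\<lambda>s. g s + e"])
      fix s assume s: "s \<in> {u..v}"
      then have s1: "s \<in> {0..1}" and x1: "x \<in> {0..1}" using uv x by auto
      have "((\<lambda>r. (1 / (r - s)) *\<^sub>R (D r - D s)) \<longlongrightarrow> D' s) (at s within {u..v})"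
        by (rule tendsto_within_subset[OF D[OF s1] uv(2)])
      then have "((\<lambda>r. (1 / (r - s)) *\<^sub>R (D r - D s) - f x) \<longlongrightarrow> D' s - f x) (at s within {u..v})"
        by (intro tendsto_diff tendsto_const)
      moreover have "\<forall>\<^sub>F r in at s within {u..v}. (1 / (r - s)) *\<^sub>R (D r - D s) - f x
          = (1 / (r - s)) *\<^sub>R ((D r - r *\<^sub>R f x) - (D s - s *\<^sub>R f x))"
        using eventually_neq_at_within[of s s "{u..v}"]
      proof eventually_elim
        case (elim r)
        have "(D r - r *\<^sub>R f x) - (D s - s *\<^sub>R f x) = (D r - D s) - (r - s) *\<^sub>R f x"
          by (simp add: algebra_simps)
        then have "(1 / (r - s)) *\<^sub>R ((D r - r *\<^sub>R f x) - (D s - s *\<^sub>R f x))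
            = (1 / (r - s)) *\<^sub>R (D r - D s) - (1 / (r - s) * (r - s)) *\<^sub>R f x"
          by (simp only: scaleR_diff_right scaleR_scaleR)
        then show ?case using elim by simp
      qed
      ultimately show "((\<lambda>r. (1 / (r - s)) *\<^sub>R ((D r - r *\<^sub>R f x) - (D s - s *\<^sub>R f x)))
          \<longlongrightarrow> D' s - f x) (at s within {u..v})"
        by (rule Lim_transform_eventually)
      show "(G has_real_derivative g s + e) (at s within {u..v})"
        by (rule DERIV_subset[OF G[OF s1] uv(2)])
      have "\<bar>s - x\<bar> < \<delta>" using ball s by (auto simp: dist_real_def abs_minus_commute)
      with f[OF s1 x1] g(2)[OF s1] seminorm_triangle[OF p, of "D' s" "f x" "f s"]
      show "p (D' s - f x) \<le> g s + e" by simp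
    qed
    moreover have "(D v - v *\<^sub>R f x) - (D u - u *\<^sub>R f x) = D v - D u - (v - u) *\<^sub>R f x"
      by (simp add: algebra_simps)
    ultimately show ?thesis unfolding K using uv by simp
  qed
  have t0: "0 \<le> t" using t by simp
  have "D t - D 0 - (\<Sum>(x, K)\<in>P. Henstock_Kurzweil_Integration.content K *\<^sub>R f x)
      = (\<Sum>(x, K)\<in>P. D (Sup K) - D (Inf K) - Henstock_Kurzweil_Integration.content K *\<^sub>R f x)"
    unfolding sum_increments_tagged_division[OF t0 P(1), symmetric]
    by (simp add: sum_subtractf[symmetric] case_prod_unfold)
  also have "p \<dots> \<le> (\<Sum>(x, K)\<in>P. p (D (Sup K) - D (Inf K) - Henstock_Kurzweil_Integration.content K *\<^sub>R f x))"
    using seminorm_sum[OF p, of _ P] by (simp add: case_prod_unfold)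
  also have "\<dots> \<le> (\<Sum>(x, K)\<in>P. G (Sup K) - G (Inf K))"
    by (rule sum_mono) (use piece in auto)
  also have "\<dots> = G t - G 0" by (rule sum_increments_tagged_division[OF t0 P(1)])
  also have "\<dots> = integral {0..t} g + e * t" unfolding G_def by simp
  \<comment> \<open>As \<open>g\<close> dominates a seminorm it is nonnegative; enlarging the
    interval makes the bound independent of \<open>t\<close>.\<close>
  also have "\<dots> \<le> integral {0..1} g + e"
  proof (rule add_mono)
    have "g integrable_on {0..t}" "g integrable_on {0..1}"
      using t by (auto intro!: integrable_continuous_real continuous_on_subset[OF g(1)])
    moreover have "0 \<le> g s" if "s \<in> {0..1}" for s
      using seminorm_nonneg[OF p] g(2)[OF that] by (rule order_trans)
    ultimately show "integral {0..t} g \<le> integral {0..1} g"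
      using t by (intro integral_subset_le) auto
    show "e * t \<le> e" using e t by (simp add: mult_left_le)
  qed
  finally show ?thesis .
qed

text \<open>The real function \<open>p (f s - f r)\<close> is uniformly continuous on the compact
  square and vanishes on the diagonal; comparing \<open>(s, r)\<close> with \<open>(r, r)\<close>
  gives the modulus.\<close>

lemma uniform_modulus_seminorm:
  fixes f :: "real \<Rightarrow> 'a::locally_convex_space"
  assumes p: "p \<in> cont_seminorms" and f: "continuous_on {0..1} f" and e: "e > 0"
  obtains \<delta> where "\<delta> > 0"
    "\<And>s r. s \<in> {0..1} \<Longrightarrow> r \<in> {0..1} \<Longrightarrow> \<bar>s - r\<bar> < \<delta> \<Longrightarrow> p (f s - f r) \<le> e"
proof -
  let ?S = "{0..1::real} \<times> {0..1::real}"
  have "continuous_on ?S (\<lambda>z. f (fst z))" "continuous_on ?S (\<lambda>z. f (snd z))"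
    by (auto intro!: continuous_on_compose2[OF f] continuous_on_fst continuous_on_snd continuous_on_id)
  then have "continuous_on ?S (\<lambda>z. f (fst z) - f (snd z))"
    by (rule continuous_on_diff)
  then have "continuous_on ?S (\<lambda>z. p (f (fst z) - f (snd z)))"
    by (rule continuous_on_seminorm[OF p])
  then have "uniformly_continuous_on ?S (\<lambda>z. p (f (fst z) - f (snd z)))"
    by (rule compact_uniformly_continuous) (simp add: compact_Times)
  then obtain \<delta> where \<delta>: "\<delta> > 0" "\<And>z z'. z \<in> ?S \<Longrightarrow> z' \<in> ?S \<Longrightarrow> dist z' z < \<delta> \<Longrightarrow>
      dist (p (f (fst z') - f (snd z'))) (p (f (fst z) - f (snd z))) < e"
    unfolding uniformly_continuous_on_def using e by metis
  have "p (f s - f r) \<le> e" if "s \<in> {0..1}" "r \<in> {0..1}" "\<bar>s - r\<bar> < \<delta>" for s r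
    using \<delta>(2)[of "(r, r)" "(s, r)"] that p by (simp add: dist_Pair_Pair dist_real_def)
  with \<delta>(1) show thesis using that by blast
qed

lemma dominated_convergence_at_0:
  fixes u :: "real \<Rightarrow> real \<Rightarrow> real"
  assumes cont: "\<forall>\<^sub>F h in at 0. continuous_on {0..1} (u h)"
    and lim: "\<And>t. t \<in> {0..1} \<Longrightarrow> ((\<lambda>h. u h t) \<longlongrightarrow> 0) (at 0)"
    and bdd: "\<forall>\<^sub>F h in at 0. \<forall>t\<in>{0..1}. \<bar>u h t\<bar> \<le> L"
  shows "((\<lambda>h. integral {0..1} (u h)) \<longlongrightarrow> 0) (at 0)"
proof -
  define good where "good h \<longleftrightarrow> continuous_on {0..1} (u h) \<and> (\<forall>t\<in>{0..1}. \<bar>u h t\<bar> \<le> L)" for h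
  have good: "\<forall>\<^sub>F h in at 0. good h"
    using cont bdd unfolding good_def by (rule eventually_conj)
  \<comment> \<open>Continuity and the bound hold only for small \<open>h\<close>. Replacing the
    other functions by 0 makes them hold along every term of a null sequence, as dominated
    convergence requires.\<close>
  define v where "v h = (if good h then u h else (\<lambda>_. 0))" for h
  have "((\<lambda>h. integral {0..1} (v h)) \<longlongrightarrow> 0) (at 0)"
    unfolding tendsto_at_iff_sequentially
  proof (intro allI impI)
    fix X :: "nat \<Rightarrow> real" assume X: "\<forall>i. X i \<in> UNIV - {0}" "X \<longlonglongrightarrow> 0"
    have "filterlim X (at 0) sequentially"
      using X by (auto simp: filterlim_at)
    have lim': "(\<lambda>k. v (X k) t) \<longlonglongrightarrow> 0" if "t \<in> {0..1}" for t
    proof -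
      have "((\<lambda>h. v h t) \<longlongrightarrow> 0) (at 0)"
        by (rule Lim_transform_eventually[OF lim[OF that]])
          (use good in \<open>auto elim!: eventually_mono simp: v_def\<close>)
      then show ?thesis by (rule filterlim_compose) fact
    qed
    have "(\<lambda>k. integral {0..1} (v (X k))) \<longlonglongrightarrow> integral {0..1::real} (\<lambda>_. 0)"
    proof (rule dominated_convergence(2))
      fix k
      have "continuous_on {0..1} (v (X k))"
        unfolding v_def by (simp add: good_def)
      then show "v (X k) integrable_on {0..1}" by (rule integrable_continuous_real)
      fix t :: real assume t: "t \<in> {0..1}"
      show "norm (v (X k) t) \<le> \<bar>L\<bar>"
      proof (cases "good (X k)")
        case True
        then have "\<bar>u (X k) t\<bar> \<le> L" using t unfolding good_def by blast
        with True show ?thesis by (simp add: v_def)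
      qed (simp add: v_def)
    qed (use lim' in \<open>auto intro: integrable_const_ivl\<close>)
    then show "((\<lambda>h. integral {0..1} (v h)) \<circ> X) \<longlonglongrightarrow> 0"
      by (simp add: comp_def)
  qed
  then show ?thesis
    by (rule Lim_transform_eventually) (use good in \<open>auto elim!: eventually_mono simp: v_def\<close>)
qed

text \<open>This filter also contains the point \<open>t\<close> itself, unlike
  \<open>at t within S\<close>; it is the form in which compactness is applied.\<close>

lemma filterlim_inf_principal_at_within:
  assumes "(f \<longlongrightarrow> f t) (at t within S)"
  shows "(f \<longlongrightarrow> f t) (inf (nhds t) (principal S))"
proof (rule topological_tendstoI)
  fix U assume U: "open U" "f t \<in> U"
  from topological_tendstoD[OF assms U] have "\<forall>\<^sub>F s in nhds t. s \<noteq> t \<longrightarrow> s \<in> S \<longrightarrow> f s \<in> U"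
    by (simp add: eventually_at_filter)
  then show "\<forall>\<^sub>F s in inf (nhds t) (principal S). f s \<in> U"
    unfolding eventually_inf_principal by (rule eventually_mono) (use U in blast)
qed

section \<open>The velocity of a quotient of two evolutions\<close>

context
  fixes G :: "('g::t2_space, 'e::locally_convex_space, 'm) lie_group_data_scheme"
    and \<Xi> :: "('g, 'e) chart" and \<phi> :: "real \<Rightarrow> ('g, 'e) tvec"
  assumes G: "lie_group G" and \<Xi>: "\<Xi> \<in> charts_at (atlas G) \<one>\<^bsub>G\<^esub>" and \<phi>: "\<phi> \<in> evol_domain G"
begin

interpretation group G by (rule lie_group_group[OF G])

abbreviation (input) "E \<equiv> Evol G \<phi>"

text \<open>The velocity of \<open>\<alpha>\<close> at time \<open>t\<close> when \<open>\<alpha>(t) = a\<close>, for the quotient \<open>\<alpha>\<close> of the evolution of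
  \<open>\<phi>\<close> and another evolution whose logarithmic derivative differs from \<open>\<phi>\<close> by \<open>Z\<close> at \<open>t\<close>.\<close>

definition qvel :: "real \<Rightarrow> 'g \<Rightarrow> 'e \<Rightarrow> 'e" where
  "qvel t a Z = dtrans G \<Xi> \<Xi> (inv\<^bsub>G\<^esub> (E t)) \<one>\<^bsub>G\<^esub> (E t \<otimes>\<^bsub>G\<^esub> a) Z"

text \<open>The translation in \<open>qvel\<close> sends the unit to \<open>a\<close>, so for the
  target chart only \<open>a\<close> has to lie in its domain.\<close>

lemma qvel_base: "inv\<^bsub>G\<^esub> (E t) \<otimes>\<^bsub>G\<^esub> \<one>\<^bsub>G\<^esub> \<otimes>\<^bsub>G\<^esub> (E t \<otimes>\<^bsub>G\<^esub> a) = a"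
  by (simp add: inv_mult_cancel[OF G] mem_carrier[OF G])

lemma linear_qvel:
  assumes "\<Xi> \<in> charts_at (atlas G) a"
  shows "linear (qvel t a)"
  unfolding qvel_def[abs_def]
  by (rule linear_dtrans[OF G \<Xi>]) (simp only: qvel_base assms)

lemma qvel_tendsto:
  assumes t: "t \<in> {0..1}" and s: "filterlim s (inf (nhds t) (principal {0..1})) F"
    and a: "(a \<longlongrightarrow> \<one>\<^bsub>G\<^esub>) F" and Z: "(Z \<longlongrightarrow> Z0) F"
  shows "((\<lambda>i. qvel (s i) (a i) (Z i)) \<longlongrightarrow> qvel t \<one>\<^bsub>G\<^esub> Z0) F"
proof -
  have E: "((\<lambda>i. E (s i)) \<longlongrightarrow> E t) F"
    by (rule filterlim_compose[OF filterlim_inf_principal_at_within[OF Evol_tendsto[OF G \<phi> t]] s])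
  have "\<Xi> \<in> charts_at (atlas G) (inv\<^bsub>G\<^esub> (E t) \<otimes>\<^bsub>G\<^esub> \<one>\<^bsub>G\<^esub> \<otimes>\<^bsub>G\<^esub> (E t \<otimes>\<^bsub>G\<^esub> \<one>\<^bsub>G\<^esub>))"
    by (simp only: qvel_base \<Xi>)
  then show ?thesis
    unfolding qvel_def
    by (rule dtrans_tendsto[OF G tendsto_inv_lie[OF G E] tendsto_mult_lie[OF G E a] Z \<Xi>])
qed

lemma continuous_on_qvel:
  assumes "continuous_on {0..1} W"
  shows "continuous_on {0..1} (\<lambda>t. qvel t \<one>\<^bsub>G\<^esub> (W t))"
  unfolding continuous_on_def
proof
  fix t :: real assume t: "t \<in> {0..1}"
  have "filterlim (\<lambda>s. s) (inf (nhds t) (principal {0..1})) (at t within {0..1})"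
    unfolding filterlim_def at_within_def by (simp add: inf.coboundedI2 filtermap_ident)
  moreover have "(W \<longlongrightarrow> W t) (at t within {0..1})"
    using assms t unfolding continuous_on_def by blast
  ultimately show "((\<lambda>t. qvel t \<one>\<^bsub>G\<^esub> (W t)) \<longlongrightarrow> qvel t \<one>\<^bsub>G\<^esub> (W t)) (at t within {0..1})"
    by (intro qvel_tendsto[OF t] tendsto_const)
qed

text \<open>Equicontinuity of the linear maps \<open>qvel t a\<close>: joint continuity and
  compactness in \<open>t\<close> give one neighbourhood of the unit and one of 0 on which
  \<open>p\<close> stays below 1. A seminorm whose unit ball lies in the latter works for all
  \<open>Z\<close> by homogeneity.\<close>

lemma qvel_seminorm_bound:
  assumes p: "p \<in> cont_seminorms"
  obtains q where "q \<in> cont_seminorms"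
    "\<forall>\<^sub>F a in nhds \<one>\<^bsub>G\<^esub>. \<forall>t\<in>{0..1}. \<forall>Z. p (qvel t a Z) \<le> q Z"
proof -
  have "\<forall>\<^sub>F y in nhds \<one>\<^bsub>G\<^esub> \<times>\<^sub>F nhds (0::'e). \<forall>t\<in>{0..1}. p (qvel t (fst y) (snd y)) < 1"
  proof (rule compact_eventually_ball)
    fix t :: real assume t: "t \<in> {0..1}"
    let ?F = "inf (nhds t) (principal {0..1}) \<times>\<^sub>F (nhds \<one>\<^bsub>G\<^esub> \<times>\<^sub>F nhds (0::'e))"
    have s: "filterlim snd (nhds \<one>\<^bsub>G\<^esub> \<times>\<^sub>F nhds (0::'e)) ?F" by (rule filterlim_snd)
    have "((\<lambda>x. qvel (fst x) (fst (snd x)) (snd (snd x))) \<longlongrightarrow> qvel t \<one>\<^bsub>G\<^esub> 0) ?F"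
      by (rule qvel_tendsto[OF t filterlim_fst filterlim_compose[OF filterlim_fst s] filterlim_compose[OF filterlim_snd s]])
    then have "((\<lambda>x. p (qvel (fst x) (fst (snd x)) (snd (snd x)))) \<longlongrightarrow> p (qvel t \<one>\<^bsub>G\<^esub> 0)) ?F"
      by (rule tendsto_seminorm[OF p])
    then have "((\<lambda>x. p (qvel (fst x) (fst (snd x)) (snd (snd x)))) \<longlongrightarrow> 0) ?F"
      unfolding linear_0[OF linear_qvel[OF \<Xi>]] seminorm_zero[OF p] .
    from order_tendstoD(2)[OF this zero_less_one]
    show "\<forall>\<^sub>F (t, y) in ?F. p (qvel t (fst y) (snd y)) < 1"
      by (simp add: case_prod_unfold)
  qed simp
  then obtain A V where A: "eventually A (nhds \<one>\<^bsub>G\<^esub>)" and V: "eventually V (nhds (0::'e))"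
    and AV: "\<And>a Z t. A a \<Longrightarrow> V Z \<Longrightarrow> t \<in> {0..1} \<Longrightarrow> p (qvel t a Z) < 1"
    unfolding eventually_prod_filter by auto
  from V obtain N where N: "open N" "0 \<in> N" and NV: "\<And>Z. Z \<in> N \<Longrightarrow> V Z"
    unfolding eventually_nhds by blast
  obtain q where q: "q \<in> cont_seminorms" "\<And>Z. q Z < 1 \<Longrightarrow> Z \<in> N"
    by (rule exists_seminorm_zero[OF N]) blast
  have "\<forall>\<^sub>F a in nhds \<one>\<^bsub>G\<^esub>. a \<in> fst \<Xi>"
    using chart_open[OF charts_at_is_chart[OF G \<Xi>]] charts_at_mem[OF G \<Xi>] by (rule eventually_nhds_in_open)
  with A have "\<forall>\<^sub>F a in nhds \<one>\<^bsub>G\<^esub>. \<forall>t\<in>{0..1}. \<forall>Z. p (qvel t a Z) \<le> q Z"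
  proof eventually_elim
    case (elim a)
    then have lin: "linear (qvel t a)" for t
      using charts_at_atlas[OF G \<Xi>] by (intro linear_qvel) (simp add: charts_at_def)
    show ?case
    proof (intro ballI allI, rule field_le_epsilon)
      fix t :: real and Z and e :: real assume t: "t \<in> {0..1}" and "e > 0"
      \<comment> \<open>Adding \<open>e\<close> keeps the scaling factor positive even when
        \<open>q Z = 0\<close>, and puts \<open>(1 / r) *\<^sub>R Z\<close> strictly inside the unit
        ball of \<open>q\<close>.\<close>
      define r where "r = q Z + e"
      have r: "r > 0" "q Z < r" using \<open>e > 0\<close> seminorm_nonneg[OF q(1), of Z] unfolding r_def by linarith+
      then have "q ((1 / r) *\<^sub>R Z) < 1"
        using seminorm_scaleR[OF q(1), of "1 / r" Z] by simp
      from AV[OF elim(1) NV[OF q(2)[OF this]] t]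
      have "p ((1 / r) *\<^sub>R qvel t a Z) < 1"
        by (simp only: linear_scale[OF lin])
      then show "p (qvel t a Z) \<le> q Z + e"
        using r seminorm_scaleR[OF p, of "1 / r"] unfolding r_def[symmetric] by simp
    qed
  qed
  with q(1) show thesis by (rule that)
qed

lemma qvel_uniformly_near:
  assumes p: "p \<in> cont_seminorms" and W: "continuous_on {0..1} W" and e: "e > 0"
  shows "\<forall>\<^sub>F a in nhds \<one>\<^bsub>G\<^esub>. \<forall>t\<in>{0..1}. p (qvel t a (W t) - qvel t \<one>\<^bsub>G\<^esub> (W t)) < e"
proof (rule compact_eventually_ball)
  fix t :: real assume t: "t \<in> {0..1}"
  let ?F = "inf (nhds t) (principal {0..1}) \<times>\<^sub>F nhds \<one>\<^bsub>G\<^esub>"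
  have "(W \<longlongrightarrow> W t) (at t within {0..1})"
    using W t unfolding continuous_on_def by blast
  note Wl = filterlim_compose[OF filterlim_inf_principal_at_within[OF this] filterlim_fst]
  have "((\<lambda>x. qvel (fst x) (snd x) (W (fst x))) \<longlongrightarrow> qvel t \<one>\<^bsub>G\<^esub> (W t)) ?F"
    by (rule qvel_tendsto[OF t filterlim_fst filterlim_snd Wl])
  moreover have "((\<lambda>x. qvel (fst x) \<one>\<^bsub>G\<^esub> (W (fst x))) \<longlongrightarrow> qvel t \<one>\<^bsub>G\<^esub> (W t)) ?F"
    by (rule qvel_tendsto[OF t filterlim_fst tendsto_const Wl])
  ultimately have "((\<lambda>x. qvel (fst x) (snd x) (W (fst x)) - qvel (fst x) \<one>\<^bsub>G\<^esub> (W (fst x))) \<longlongrightarrow>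
      qvel t \<one>\<^bsub>G\<^esub> (W t) - qvel t \<one>\<^bsub>G\<^esub> (W t)) ?F"
    by (rule tendsto_diff)
  then have "((\<lambda>x. qvel (fst x) (snd x) (W (fst x)) - qvel (fst x) \<one>\<^bsub>G\<^esub> (W (fst x))) \<longlongrightarrow> 0) ?F"
    by simp
  from eventually_seminorm_less[OF this p e]
  show "\<forall>\<^sub>F (t, a) in ?F. p (qvel t a (W t) - qvel t \<one>\<^bsub>G\<^esub> (W t)) < e"
    by (simp add: case_prod_unfold)
qed simp

section \<open>Estimates for a family of quotient curves\<close>

context
  fixes \<psi> :: "real \<Rightarrow> real \<Rightarrow> ('g, 'e) tvec" and W :: "real \<Rightarrow> 'e" and \<alpha> :: "real \<Rightarrow> real \<Rightarrow> 'g"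
    and Z D :: "real \<Rightarrow> real \<Rightarrow> 'e"
  assumes \<Xi>0: "snd \<Xi> \<one>\<^bsub>G\<^esub> = 0"
    and \<psi>: "\<forall>\<^sub>F h in at 0. \<psi> h \<in> evol_domain G"
    and \<alpha>_def: "\<And>h t. \<alpha> h t = inv\<^bsub>G\<^esub> (E t) \<otimes>\<^bsub>G\<^esub> Evol G (\<psi> h) t"
    and unif: "\<And>U. open U \<Longrightarrow> \<one>\<^bsub>G\<^esub> \<in> U \<Longrightarrow> \<forall>\<^sub>F h in at 0. \<forall>t\<in>{0..1}. \<alpha> h t \<in> U"
    and Z_def: "\<And>h t. Z h t = (1 / h) *\<^sub>R (coord (\<psi> h t) \<Xi> - coord (\<phi> t) \<Xi>)"
    and contZ: "\<forall>\<^sub>F h in at 0. continuous_on {0..1} (Z h)"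
    and contW: "continuous_on {0..1} W"
    and limZ: "\<And>t. t \<in> {0..1} \<Longrightarrow> ((\<lambda>h. Z h t) \<longlongrightarrow> W t) (at 0)"
    and bddZ: "\<And>p. p \<in> cont_seminorms \<Longrightarrow> \<exists>L. \<forall>\<^sub>F h in at 0. \<forall>t\<in>{0..1}. p (Z h t) \<le> L"
    and D_def: "\<And>h t. D h t = (1 / h) *\<^sub>R snd \<Xi> (\<alpha> h t)"
begin

lemma quotient_derivative:
  assumes "\<psi> h \<in> evol_domain G" "h \<noteq> 0" and t: "t \<in> {0..1}" and mem: "\<alpha> h t \<in> fst \<Xi>"
  shows "((\<lambda>s. (1 / (s - t)) *\<^sub>R (D h s - D h t)) \<longlongrightarrow> qvel t (\<alpha> h t) (Z h t)) (at t within {0..1})"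
proof -
  have c: "\<Xi> \<in> charts_at (atlas G) (\<alpha> h t)"
    using mem charts_at_atlas[OF G \<Xi>] by (simp add: charts_at_def)
  have "Evol G (\<psi> h) t = E t \<otimes>\<^bsub>G\<^esub> \<alpha> h t"
    unfolding \<alpha>_def by (simp add: inv_mult_cancel[OF G])
  with Evol_quotient_tangent_pair[OF G \<phi> assms(1) t \<Xi> c[unfolded \<alpha>_def]]
  have "((\<lambda>s. (1 / (s - t)) *\<^sub>R (snd \<Xi> (\<alpha> h s) - snd \<Xi> (\<alpha> h t))) \<longlongrightarrow>
      qvel t (\<alpha> h t) (coord (\<psi> h t) \<Xi> - coord (\<phi> t) \<Xi>)) (at t within {0..1})"
    unfolding tangent_pair_def qvel_def \<alpha>_def[symmetric] by simp
  then have "((\<lambda>s. (1 / h) *\<^sub>R ((1 / (s - t)) *\<^sub>R (snd \<Xi> (\<alpha> h s) - snd \<Xi> (\<alpha> h t)))) \<longlongrightarrow>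
      (1 / h) *\<^sub>R qvel t (\<alpha> h t) (coord (\<psi> h t) \<Xi> - coord (\<phi> t) \<Xi>)) (at t within {0..1})"
    by (intro tendsto_scaleR_lcs tendsto_const)
  moreover have "(1 / h) *\<^sub>R qvel t (\<alpha> h t) (coord (\<psi> h t) \<Xi> - coord (\<phi> t) \<Xi>) = qvel t (\<alpha> h t) (Z h t)"
    unfolding Z_def by (simp only: linear_scale[OF linear_qvel[OF c]])
  moreover have "(1 / h) *\<^sub>R ((1 / (s - t)) *\<^sub>R (snd \<Xi> (\<alpha> h s) - snd \<Xi> (\<alpha> h t))) = (1 / (s - t)) *\<^sub>R (D h s - D h t)" for s
    unfolding D_def by (simp add: scaleR_diff_right mult.commute)
  ultimately show ?thesis by simp
qed

lemma integral_seminorm_small: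
  assumes q: "q \<in> cont_seminorms" and e: "e > 0"
  shows "\<forall>\<^sub>F h in at 0. integral {0..1} (\<lambda>t. q (Z h t - W t)) < e"
proof -
  obtain L where L: "\<forall>\<^sub>F h in at 0. \<forall>t\<in>{0..1}. q (Z h t) \<le> L" using bddZ[OF q] by blast
  have "continuous_on {0..1} (\<lambda>t. q (W t))" by (rule continuous_on_seminorm[OF q contW])
  then have "bdd_above ((\<lambda>t. q (W t)) ` {0..1})"
    by (intro bounded_imp_bdd_above compact_imp_bounded compact_continuous_image) auto
  then obtain M where M: "\<And>t. t \<in> {0..1} \<Longrightarrow> q (W t) \<le> M" unfolding bdd_above_def by blast
  have "((\<lambda>h. integral {0..1} (\<lambda>t. q (Z h t - W t))) \<longlongrightarrow> 0) (at 0)"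
  proof (rule dominated_convergence_at_0[where L = "L + M"])
    show "\<forall>\<^sub>F h in at 0. continuous_on {0..1} (\<lambda>t. q (Z h t - W t))"
      using contZ by eventually_elim (intro continuous_on_seminorm[OF q] continuous_on_diff contW)
    fix t :: real assume t: "t \<in> {0..1}"
    have "((\<lambda>h. q (Z h t - W t)) \<longlongrightarrow> q (W t - W t)) (at 0)"
      by (intro tendsto_seminorm[OF q] tendsto_diff limZ[OF t] tendsto_const)
    then show "((\<lambda>h. q (Z h t - W t)) \<longlongrightarrow> 0) (at 0)" by (simp add: seminorm_zero[OF q])
  next
    show "\<forall>\<^sub>F h in at 0. \<forall>t\<in>{0..1}. \<bar>q (Z h t - W t)\<bar> \<le> L + M"
      using L
    proof (eventually_elim, intro ballI)
      fix h t assume L: "\<forall>t\<in>{0..1}. q (Z h t) \<le> L" and t: "t \<in> {0..1::real}"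
      have "q (Z h t - W t) \<le> q (Z h t) + q (W t)" by (rule seminorm_diff[OF q])
      also have "\<dots> \<le> L + M" using L M t by (intro add_mono) auto
      finally show "\<bar>q (Z h t - W t)\<bar> \<le> L + M" using seminorm_nonneg[OF q, of "Z h t - W t"] by simp
    qed
  qed
  then show ?thesis using e by (rule order_tendstoD)
qed

text \<open>Three errors of \<open>e / 3\<close>: the oscillation of the integrand on a fine piece,
  the replacement of \<open>\<alpha> h\<close> by the unit in the velocity, and the integral of
  \<open>q (Z h t - W t)\<close>. The mesh \<open>\<delta>\<close> depends on the integrand alone
  and is fixed before \<open>h\<close>.\<close>

lemma quotient_near_riemann_sums:
  assumes p: "p \<in> cont_seminorms" and e: "e > 0"
  obtains \<delta> where "\<delta> > 0"
    "\<forall>\<^sub>F h in at 0. \<forall>t\<in>{0..1}. \<forall>P. P tagged_division_of {0..t} \<longrightarrow> (\<lambda>x. ball x \<delta>) fine P \<longrightarrow>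
       p (D h t - (\<Sum>(x, K)\<in>P. Henstock_Kurzweil_Integration.content K *\<^sub>R qvel x \<one>\<^bsub>G\<^esub> (W x))) \<le> e"
proof -
  let ?f = "\<lambda>t. qvel t \<one>\<^bsub>G\<^esub> (W t)"
  obtain \<delta> where \<delta>: "\<delta> > 0"
    "\<And>s r. s \<in> {0..1} \<Longrightarrow> r \<in> {0..1} \<Longrightarrow> \<bar>s - r\<bar> < \<delta> \<Longrightarrow> p (?f s - ?f r) \<le> e / 3"
    using uniform_modulus_seminorm[OF p continuous_on_qvel[OF contW], of "e / 3"] e by auto
  obtain q where q: "q \<in> cont_seminorms"
    and qb: "\<forall>\<^sub>F a in nhds \<one>\<^bsub>G\<^esub>. \<forall>t\<in>{0..1}. \<forall>Z. p (qvel t a Z) \<le> q Z"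
    by (rule qvel_seminorm_bound[OF p]) blast
  have near: "\<forall>\<^sub>F a in nhds \<one>\<^bsub>G\<^esub>. \<forall>t\<in>{0..1}. p (qvel t a (W t) - ?f t) < e / 3"
    using e by (intro qvel_uniformly_near[OF p contW]) simp
  have "\<forall>\<^sub>F a in nhds \<one>\<^bsub>G\<^esub>. a \<in> fst \<Xi>"
    using chart_open[OF charts_at_is_chart[OF G \<Xi>]] charts_at_mem[OF G \<Xi>] by (rule eventually_nhds_in_open)
  from eventually_conj[OF this eventually_conj[OF qb near]]
  obtain U where U: "open U" "\<one>\<^bsub>G\<^esub> \<in> U" and mem: "\<And>a. a \<in> U \<Longrightarrow> a \<in> fst \<Xi>"
    and qb: "\<And>a t Z. a \<in> U \<Longrightarrow> t \<in> {0..1} \<Longrightarrow> p (qvel t a Z) \<le> q Z"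
    and near: "\<And>a t. a \<in> U \<Longrightarrow> t \<in> {0..1} \<Longrightarrow> p (qvel t a (W t) - ?f t) < e / 3"
    unfolding eventually_nhds by blast
  have small: "\<forall>\<^sub>F h in at 0. integral {0..1} (\<lambda>t. q (Z h t - W t)) < e / 3"
    using e by (intro integral_seminorm_small[OF q]) simp
  have "\<forall>\<^sub>F h in at 0. \<forall>t\<in>{0..1}. \<forall>P. P tagged_division_of {0..t} \<longrightarrow> (\<lambda>x. ball x \<delta>) fine P \<longrightarrow>
       p (D h t - (\<Sum>(x, K)\<in>P. Henstock_Kurzweil_Integration.content K *\<^sub>R ?f x)) \<le> e"
    using \<psi> contZ small unif[OF U] eventually_neq_at_within[of 0 0 UNIV]
  proof eventually_elim
    case (elim h)
    let ?g = "\<lambda>t. q (Z h t - W t) + e / 3"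
    have gc: "continuous_on {0..1} (\<lambda>t. q (Z h t - W t))"
      by (intro continuous_on_seminorm[OF q] continuous_on_diff contW elim(2))
    have g: "continuous_on {0..1} ?g" by (intro continuous_on_add gc continuous_on_const)
    have "integral {0..1} ?g = integral {0..1} (\<lambda>t. q (Z h t - W t)) + e / 3"
      by (subst integral_add) (auto intro!: integrable_continuous_real gc)
    then have gi: "integral {0..1} ?g \<le> e / 3 + e / 3" using elim(3) by simp
    have D': "((\<lambda>r. (1 / (r - s)) *\<^sub>R (D h r - D h s)) \<longlongrightarrow> qvel s (\<alpha> h s) (Z h s)) (at s within {0..1})"
      if "s \<in> {0..1}" for s
      using elim that mem by (intro quotient_derivative) auto
    \<comment> \<open>The error splits as \<open>qvel s (\<alpha> h s) (Z h s - W s)\<close>,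
      controlled by \<open>q\<close>, plus the effect of moving \<open>\<alpha> h s\<close> to the
      unit with \<open>W s\<close> fixed.\<close>
    have le: "p (qvel s (\<alpha> h s) (Z h s) - ?f s) \<le> ?g s" if s: "s \<in> {0..1}" for s
    proof -
      have aU: "\<alpha> h s \<in> U" using elim(4) s by blast
      have "\<Xi> \<in> charts_at (atlas G) (\<alpha> h s)"
        using mem[OF aU] charts_at_atlas[OF G \<Xi>] by (simp add: charts_at_def)
      then have "qvel s (\<alpha> h s) (Z h s) - qvel s (\<alpha> h s) (W s) = qvel s (\<alpha> h s) (Z h s - W s)"
        by (simp only: linear_diff[OF linear_qvel])
      with qb[OF aU s] near[OF aU s] seminorm_triangle[OF p, of "qvel s (\<alpha> h s) (Z h s)" "?f s" "qvel s (\<alpha> h s) (W s)"]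
      show ?thesis by (smt (verit))
    qed
    have D0: "D h 0 = 0"
      unfolding D_def \<alpha>_def using Evol_0[OF G \<phi>] Evol_0[OF G elim(1)] \<Xi>0
      by (simp add: mem_carrier[OF G])
    show ?case
    proof (intro ballI allI impI)
      fix t :: real and P
      assume t: "t \<in> {0..1}" and P: "P tagged_division_of {0..t}" "(\<lambda>x. ball x \<delta>) fine P"
      have "p (D h t - D h 0 - (\<Sum>(x, K)\<in>P. Henstock_Kurzweil_Integration.content K *\<^sub>R ?f x))
          \<le> integral {0..1} ?g + e / 3"
        by (rule riemann_sum_increment_bound[OF p D' g le \<delta>(2) t _ P]) (use e in auto)
      with gi show "p (D h t - (\<Sum>(x, K)\<in>P. Henstock_Kurzweil_Integration.content K *\<^sub>R ?f x)) \<le> e"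
        unfolding D0 by simp
    qed
  qed
  with \<delta>(1) show thesis by (rule that)
qed

end

end

section \<open>Riemann integrals and completions\<close>

lemma has_riemann_integral_cong:
  assumes "\<And>s. s \<in> {a..b} \<Longrightarrow> f s = g s"
  shows "has_riemann_integral f v a b \<longleftrightarrow> has_riemann_integral g v a b"
proof -
  have eq: "(\<Sum>(x, K)\<in>P. Henstock_Kurzweil_Integration.content K *\<^sub>R f x) =
      (\<Sum>(x, K)\<in>P. Henstock_Kurzweil_Integration.content K *\<^sub>R g x)"
    if P: "P tagged_division_of {a..b}" for P
  proof (rule sum.cong[OF refl], clarify)
    fix x K assume "(x, K) \<in> P"
    then have "x \<in> {a..b}" using tagged_division_ofD(2,3)[OF P] by blast
    then show "Henstock_Kurzweil_Integration.content K *\<^sub>R f x = Henstock_Kurzweil_Integration.content K *\<^sub>R g x"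
      using assms by simp
  qed
  show ?thesis
    unfolding has_riemann_integral_def by (simp cong: imp_cong add: eq)
qed

lemma has_riemann_integral_linear:
  fixes T :: "'a::{real_vector,topological_space} \<Rightarrow> 'b::{real_vector,topological_space}"
  assumes T: "linear T" "continuous_on UNIV T" and f: "has_riemann_integral f v a b"
  shows "has_riemann_integral (\<lambda>s. T (f s)) (T v) a b"
  unfolding has_riemann_integral_def
proof (intro allI impI)
  fix U assume U: "open U \<and> T v \<in> U"
  then have "open (T -` U) \<and> v \<in> T -` U"
    using T(2) by (auto intro: open_vimage)
  with f obtain \<delta> where \<delta>: "\<delta> > 0" "\<And>P. P tagged_division_of {a..b} \<and> (\<lambda>x. ball x \<delta>) fine P \<Longrightarrow>
      (\<Sum>(x, K)\<in>P. Henstock_Kurzweil_Integration.content K *\<^sub>R f x) \<in> T -` U"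
    unfolding has_riemann_integral_def by meson
  show "\<exists>\<delta>>0. \<forall>P. P tagged_division_of {a..b} \<and> (\<lambda>x. ball x \<delta>) fine P \<longrightarrow>
      (\<Sum>(x, K)\<in>P. Henstock_Kurzweil_Integration.content K *\<^sub>R T (f x)) \<in> U"
  proof (intro exI[of _ \<delta>] conjI allI impI \<delta>(1))
    fix P assume "P tagged_division_of {a..b} \<and> (\<lambda>x. ball x \<delta>) fine P"
    from \<delta>(2)[OF this]
    have "T (\<Sum>(x, K)\<in>P. Henstock_Kurzweil_Integration.content K *\<^sub>R f x) \<in> U" by simp
    then show "(\<Sum>(x, K)\<in>P. Henstock_Kurzweil_Integration.content K *\<^sub>R T (f x)) \<in> U"
      by (simp add: linear_sum[OF T(1)] case_prod_unfold linear_scale[OF T(1)])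
  qed
qed

lemma has_riemann_integral_seminorm_iff:
  fixes f :: "real \<Rightarrow> 'a::locally_convex_space"
  shows "has_riemann_integral f v a b \<longleftrightarrow> (\<forall>p\<in>cont_seminorms. \<forall>e>0. \<exists>\<delta>>0. \<forall>P.
    P tagged_division_of {a..b} \<longrightarrow> (\<lambda>x. ball x \<delta>) fine P \<longrightarrow>
      p ((\<Sum>(x, K)\<in>P. Henstock_Kurzweil_Integration.content K *\<^sub>R f x) - v) \<le> e)"
    (is "?L \<longleftrightarrow> ?R")
proof
  assume L: ?L
  show ?R
  proof (intro ballI allI impI)
    fix p :: "'a \<Rightarrow> real" and e :: real
    assume p: "p \<in> cont_seminorms" and e: "e > 0"
    let ?U = "(\<lambda>y. p (y - v)) -` {..<e}"
    have "open ?U"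
      by (intro open_vimage open_lessThan continuous_on_seminorm[OF p] continuous_intros)
    moreover have "v \<in> ?U" using e seminorm_zero[OF p] by simp
    ultimately obtain \<delta> where \<delta>: "\<delta> > 0" "\<And>P. P tagged_division_of {a..b} \<and> (\<lambda>x. ball x \<delta>) fine P \<Longrightarrow>
        (\<Sum>(x, K)\<in>P. Henstock_Kurzweil_Integration.content K *\<^sub>R f x) \<in> ?U"
      using L unfolding has_riemann_integral_def by meson
    show "\<exists>\<delta>>0. \<forall>P. P tagged_division_of {a..b} \<longrightarrow> (\<lambda>x. ball x \<delta>) fine P \<longrightarrow>
        p ((\<Sum>(x, K)\<in>P. Henstock_Kurzweil_Integration.content K *\<^sub>R f x) - v) \<le> e"
    proof (intro exI[of _ \<delta>] conjI allI impI \<delta>(1))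
      fix P assume "P tagged_division_of {a..b}" "(\<lambda>x. ball x \<delta>) fine P"
      with \<delta>(2)[of P] show "p ((\<Sum>(x, K)\<in>P. Henstock_Kurzweil_Integration.content K *\<^sub>R f x) - v) \<le> e"
        by simp
    qed
  qed
next
  assume R: ?R
  show ?L
    unfolding has_riemann_integral_def
  proof (intro allI impI)
    fix U assume "open U \<and> v \<in> U"
    then obtain p where p: "p \<in> cont_seminorms" "\<And>x. p (x - v) < 1 \<Longrightarrow> x \<in> U"
      using exists_seminorm by metis
    have "(1/2::real) > 0" by simp
    from R[rule_format, OF p(1) this] obtain \<delta> where \<delta>: "\<delta> > 0"
      "\<forall>P. P tagged_division_of {a..b} \<longrightarrow> (\<lambda>x. ball x \<delta>) fine P \<longrightarrow>
        p ((\<Sum>(x, K)\<in>P. Henstock_Kurzweil_Integration.content K *\<^sub>R f x) - v) \<le> 1/2"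
      by blast
    show "\<exists>\<delta>>0. \<forall>P. P tagged_division_of {a..b} \<and> (\<lambda>x. ball x \<delta>) fine P \<longrightarrow>
        (\<Sum>(x, K)\<in>P. Henstock_Kurzweil_Integration.content K *\<^sub>R f x) \<in> U"
    proof (intro exI[of _ \<delta>] conjI allI impI \<delta>(1))
      fix P assume "P tagged_division_of {a..b} \<and> (\<lambda>x. ball x \<delta>) fine P"
      with \<delta>(2) have "p ((\<Sum>(x, K)\<in>P. Henstock_Kurzweil_Integration.content K *\<^sub>R f x) - v) \<le> 1/2"
        by blast
      then show "(\<Sum>(x, K)\<in>P. Henstock_Kurzweil_Integration.content K *\<^sub>R f x) \<in> U"
        by (intro p(2)) simp
    qed
  qed
qed

lemma fine_tagged_division:
  assumes "\<delta> > 0"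
  obtains P where "P tagged_division_of {a..b::real}" "(\<lambda>x. ball x \<delta>) fine P"
  using fine_division_exists_real[of "\<lambda>x. ball x \<delta>"] assms by (auto simp: gauge_def)

text \<open>The mesh is quantified before \<open>h\<close> and \<open>t\<close>, so one fixed
  partition can be compared with all small \<open>h\<close>, and the set of admissible
  \<open>h\<close> is common to all \<open>t\<close>.\<close>

definition near_riemann_sums ::
  "(real \<Rightarrow> real \<Rightarrow> 'a::{real_vector,topological_space}) \<Rightarrow> (real \<Rightarrow> 'a) \<Rightarrow> bool" where
  "near_riemann_sums D f \<longleftrightarrow> (\<forall>p\<in>cont_seminorms. \<forall>e>0. \<exists>\<delta>>0. \<forall>\<^sub>F h in at 0. \<forall>t\<in>{0..1}. \<forall>P.
     P tagged_division_of {0..t} \<longrightarrow> (\<lambda>x. ball x \<delta>) fine P \<longrightarrow>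
       p (D h t - (\<Sum>(x, K)\<in>P. Henstock_Kurzweil_Integration.content K *\<^sub>R f x)) \<le> e)"

context
  fixes D :: "real \<Rightarrow> real \<Rightarrow> 'a::locally_convex_space" and f :: "real \<Rightarrow> 'a"
  assumes R: "near_riemann_sums D f"
begin

abbreviation (input) "RS P \<equiv> (\<Sum>(x, K)\<in>P. Henstock_Kurzweil_Integration.content K *\<^sub>R f x)"

lemma near_riemann_sumsD:
  assumes "p \<in> cont_seminorms" "e > 0"
  obtains \<delta> where "\<delta> > 0" "\<forall>\<^sub>F h in at 0. \<forall>t\<in>{0..1}. \<forall>P.
     P tagged_division_of {0..t} \<longrightarrow> (\<lambda>x. ball x \<delta>) fine P \<longrightarrow> p (D h t - RS P) \<le> e"
  using R[unfolded near_riemann_sums_def, rule_format, OF assms] by blast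

text \<open>The partition stays fixed while \<open>h\<close> tends to 0, so the closed bound passes
  to the limit.\<close>

lemma near_riemann_sums_limit:
  assumes p: "p \<in> cont_seminorms" and t: "t \<in> {0..1}" and X: "((\<lambda>h. D h t) \<longlongrightarrow> X) (at 0)"
    and ev: "\<forall>\<^sub>F h in at 0. \<forall>t\<in>{0..1}. \<forall>P.
     P tagged_division_of {0..t} \<longrightarrow> (\<lambda>x. ball x \<delta>) fine P \<longrightarrow> p (D h t - RS P) \<le> e"
    and P: "P tagged_division_of {0..t}" "(\<lambda>x. ball x \<delta>) fine P"
  shows "p (RS P - X) \<le> e"
proof -
  have "((\<lambda>h. p (D h t - RS P)) \<longlongrightarrow> p (X - RS P)) (at 0)"
    by (intro tendsto_seminorm[OF p] tendsto_diff X tendsto_const)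
  moreover have "\<forall>\<^sub>F h in at 0. p (D h t - RS P) \<le> e"
    using ev by (rule eventually_mono) (use t P in blast)
  ultimately have "p (X - RS P) \<le> e"
    by (rule tendsto_upperbound) simp
  then show ?thesis by (simp only: seminorm_diff_commute[OF p, of X])
qed

text \<open>Fine Riemann sums and the values \<open>D h t\<close> for small \<open>h\<close> are
  mutually close, so each family inherits the limit of the other. In \<open>'e\<close> this is what
  ties differentiability to existence of the integral.\<close>

lemma near_riemann_sums_tendsto_iff:
  assumes t: "t \<in> {0..1}"
  shows "((\<lambda>h. D h t) \<longlongrightarrow> X) (at 0) \<longleftrightarrow> has_riemann_integral f X 0 t"
proof
  assume X: "((\<lambda>h. D h t) \<longlongrightarrow> X) (at 0)"
  show "has_riemann_integral f X 0 t"
    unfolding has_riemann_integral_seminorm_iff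
  proof (intro ballI allI impI)
    fix p :: "'a \<Rightarrow> real" and e :: real assume p: "p \<in> cont_seminorms" and e: "e > 0"
    obtain \<delta> where "\<delta> > 0" and ev: "\<forall>\<^sub>F h in at 0. \<forall>t\<in>{0..1}. \<forall>P.
        P tagged_division_of {0..t} \<longrightarrow> (\<lambda>x. ball x \<delta>) fine P \<longrightarrow> p (D h t - RS P) \<le> e"
      by (rule near_riemann_sumsD[OF p e]) blast
    then show "\<exists>\<delta>>0. \<forall>P. P tagged_division_of {0..t} \<longrightarrow> (\<lambda>x. ball x \<delta>) fine P \<longrightarrow> p (RS P - X) \<le> e"
      by (intro exI[of _ \<delta>] conjI allI impI near_riemann_sums_limit[OF p t X ev])
  qed
next
  assume I: "has_riemann_integral f X 0 t"
  show "((\<lambda>h. D h t) \<longlongrightarrow> X) (at 0)"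
    unfolding tendsto_seminorm_iff
  proof (intro ballI allI impI)
    fix p :: "'a \<Rightarrow> real" and e :: real assume p: "p \<in> cont_seminorms" and e: "e > 0"
    then have e3: "e / 3 > 0" by simp
    obtain \<delta> where \<delta>: "\<delta> > 0" and ev: "\<forall>\<^sub>F h in at 0. \<forall>t\<in>{0..1}. \<forall>P.
        P tagged_division_of {0..t} \<longrightarrow> (\<lambda>x. ball x \<delta>) fine P \<longrightarrow> p (D h t - RS P) \<le> e / 3"
      by (rule near_riemann_sumsD[OF p e3]) blast
    obtain \<delta>' where \<delta>': "\<delta>' > 0" and I': "\<forall>P. P tagged_division_of {0..t} \<longrightarrow> (\<lambda>x. ball x \<delta>') fine P \<longrightarrow>
        p (RS P - X) \<le> e / 3"
      using I[unfolded has_riemann_integral_seminorm_iff, rule_format, OF p e3] by blast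
    obtain P where P: "P tagged_division_of {0..t}" "(\<lambda>x. ball x (min \<delta> \<delta>')) fine P"
      using fine_tagged_division[of "min \<delta> \<delta>'"] \<delta> \<delta>' by auto
    then have f1: "(\<lambda>x. ball x \<delta>) fine P" and f2: "(\<lambda>x. ball x \<delta>') fine P"
      unfolding fine_def by fastforce+
    show "\<forall>\<^sub>F h in at 0. p (D h t - X) < e"
      using ev
    proof eventually_elim
      case (elim h)
      then have "p (D h t - RS P) \<le> e / 3" using t P(1) f1 by blast
      moreover have "p (RS P - X) \<le> e / 3" using I' P(1) f2 by blast
      ultimately show ?case
        using seminorm_triangle[OF p, of "D h t" X "RS P"] e by linarith
    qed
  qed
qed

text \<open>The partition may vary with \<open>t\<close>, while the mesh and the range of
  \<open>h\<close> do not; hence pointwise limits are automatically uniform.\<close>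

lemma near_riemann_sums_uniform:
  assumes p: "p \<in> cont_seminorms" and e: "e > 0"
    and \<beta>: "\<And>t. t \<in> {0..1} \<Longrightarrow> ((\<lambda>h. D h t) \<longlongrightarrow> \<beta> t) (at 0)"
  shows "\<forall>\<^sub>F h in at 0. \<forall>t\<in>{0..1}. p (D h t - \<beta> t) \<le> e"
proof -
  have e2: "e / 2 > 0" using e by simp
  obtain \<delta> where \<delta>: "\<delta> > 0" and ev: "\<forall>\<^sub>F h in at 0. \<forall>t\<in>{0..1}. \<forall>P.
      P tagged_division_of {0..t} \<longrightarrow> (\<lambda>x. ball x \<delta>) fine P \<longrightarrow> p (D h t - RS P) \<le> e / 2"
    by (rule near_riemann_sumsD[OF p e2]) blast
  show ?thesis
    using ev
  proof eventually_elim
    case (elim h)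
    show ?case
    proof
      fix t :: real assume t: "t \<in> {0..1}"
      obtain P where P: "P tagged_division_of {0..t}" "(\<lambda>x. ball x \<delta>) fine P"
        by (rule fine_tagged_division[OF \<delta>]) blast
      have "p (D h t - RS P) \<le> e / 2" using elim t P by blast
      moreover have "p (RS P - \<beta> t) \<le> e / 2"
        by (rule near_riemann_sums_limit[OF p t \<beta>[OF t] ev P])
      ultimately show "p (D h t - \<beta> t) \<le> e"
        using seminorm_triangle[OF p, of "D h t" "\<beta> t" "RS P"] by linarith
    qed
  qed
qed

end

text \<open>Links the uniformity, in which completeness is stated, to neighbourhoods of 0: uniform
  continuity of addition gives a smaller entourage whose translates stay in \<open>R\<close>, and
  the pair \<open>(0, x - y)\<close> is translated by \<open>y\<close>.\<close>

lemma entourage_difference: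
  fixes R :: "'a::{uniform_topological_group_add,ab_group_add} \<times> 'a \<Rightarrow> bool"
  assumes "eventually R uniformity"
  obtains N where "open N" "0 \<in> N" "\<And>x y. x - y \<in> N \<Longrightarrow> R (y, x)"
proof -
  obtain A where A: "eventually A uniformity" and AR: "\<And>a b c. A (a, b) \<Longrightarrow> R (a + c, b + c)"
    by (rule uniformity_of_uniform_continuous_invariant[OF uniformly_continuous_add' assms]) blast
  from A have "\<forall>\<^sub>F z in nhds 0. A (0, z)"
    unfolding eventually_nhds_uniformity by (rule eventually_mono) auto
  then obtain N where N: "open N" "0 \<in> N" "\<And>z. z \<in> N \<Longrightarrow> A (0, z)"
    unfolding eventually_nhds by blast
  have "R (y, x)" if "x - y \<in> N" for x y
    using AR[OF N(3)[OF that], of y] by simp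
  with N(1,2) show thesis by (rule that)
qed

lemma near_riemann_sums_convergent:
  fixes D :: "real \<Rightarrow> real \<Rightarrow> 'a::{locally_convex_space,uniform_topological_group_add,complete_uniform_space}"
  assumes R: "near_riemann_sums D f" and t: "t \<in> {0..1}"
  shows "\<exists>X. ((\<lambda>h. D h t) \<longlongrightarrow> X) (at 0)"
proof -
  let ?F = "filtermap (\<lambda>h. D h t) (at 0)"
  have "cauchy_filter ?F"
    unfolding cauchy_filter_def
  proof (rule filter_leI)
    fix Q :: "'a \<times> 'a \<Rightarrow> bool" assume "eventually Q uniformity"
    then obtain N where N: "open N" "0 \<in> N" and NQ: "\<And>x y. x - y \<in> N \<Longrightarrow> Q (y, x)"
      by (rule entourage_difference) blast
    obtain p where p: "p \<in> cont_seminorms" and pN: "\<And>x. p x < 1 \<Longrightarrow> x \<in> N"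
      by (rule exists_seminorm_zero[OF N]) blast
    \<comment> \<open>Two values within 1/3 of the same Riemann sum differ by at most 2/3, inside
      the unit ball of \<open>p\<close>.\<close>
    have "(1/3::real) > 0" by simp
    then obtain \<delta> where \<delta>: "\<delta> > 0" and ev: "\<forall>\<^sub>F h in at 0. \<forall>t\<in>{0..1}. \<forall>P.
        P tagged_division_of {0..t} \<longrightarrow> (\<lambda>x. ball x \<delta>) fine P \<longrightarrow>
          p (D h t - (\<Sum>(x, K)\<in>P. Henstock_Kurzweil_Integration.content K *\<^sub>R f x)) \<le> 1/3"
      by (rule near_riemann_sumsD[OF R p]) blast
    obtain P where P: "P tagged_division_of {0..t}" "(\<lambda>x. ball x \<delta>) fine P"
      by (rule fine_tagged_division[OF \<delta>]) blast
    define S where "S = (\<Sum>(x, K)\<in>P. Henstock_Kurzweil_Integration.content K *\<^sub>R f x)"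
    have ev': "\<forall>\<^sub>F y in ?F. p (y - S) \<le> 1/3"
      unfolding eventually_filtermap using ev by (rule eventually_mono) (use t P in \<open>unfold S_def, blast\<close>)
    show "eventually Q (?F \<times>\<^sub>F ?F)"
      unfolding eventually_prod_filter
    proof (intro exI conjI allI impI)
      fix y x assume "p (y - S) \<le> 1/3" "p (x - S) \<le> 1/3"
      then have "p (x - y) < 1"
        using seminorm_triangle[OF p, of x y S] seminorm_diff_commute[OF p, of S y] by linarith
      then show "Q (y, x)" by (intro NQ pN)
    qed (rule ev')+
  qed
  then have "convergent_filter ?F" by (rule cauchy_filter_convergent)
  then show ?thesis
    unfolding convergent_filter_iff filterlim_def .
qed

section \<open>Extension of seminorms and passage to the completion\<close>

context
  fixes j :: "'e::locally_convex_space \<Rightarrow>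
    'f::{locally_convex_space,uniform_topological_group_add,complete_uniform_space}"
  assumes j: "is_completion j"
begin

lemma completion_linear: "linear j"
  and completion_continuous: "continuous_on UNIV j"
  and completion_dense: "closure (range j) = UNIV"
  using j unfolding is_completion_def homeomorphism_def by auto

lemma seminorm_completion_comp:
  assumes p: "p \<in> cont_seminorms"
  shows "(\<lambda>x. p (j x)) \<in> cont_seminorms"
  unfolding cont_seminorms_def
  using seminorm_add[OF p] seminorm_scaleR[OF p] continuous_on_seminorm[OF p completion_continuous]
  by (simp add: linear_add[OF completion_linear] linear_scale[OF completion_linear])

text \<open>As \<open>j\<close> is open onto its range, the unit ball of \<open>p\<close> is the
  trace of an open set of the completion; a seminorm whose unit ball lies in that set dominates
  \<open>p\<close> by homogeneity.\<close>

lemma seminorm_le_completion: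
  assumes p: "p \<in> cont_seminorms"
  obtains s where "s \<in> cont_seminorms" "\<And>x. p x \<le> s (j x)"
proof -
  have hom: "homeomorphism UNIV (range j) j (inv_into UNIV j)" and inj: "inj j"
    using j unfolding is_completion_def by auto
  have "open (p -` {..<1})"
    by (intro open_vimage seminorm_cont[OF p] open_lessThan)
  then have "openin (top_of_set UNIV) (p -` {..<1})" by simp
  from homeomorphism_imp_open_map[OF hom this]
  have "openin (top_of_set (range j)) (j ` (p -` {..<1}))" .
  then obtain N where N: "open N" "j ` (p -` {..<1}) = range j \<inter> N"
    unfolding openin_open by blast
  have "j 0 \<in> j ` (p -` {..<1})"
    by (rule imageI) (simp add: seminorm_zero[OF p])
  then have "0 \<in> N" using N(2) linear_0[OF completion_linear] by auto
  then obtain s where s: "s \<in> cont_seminorms" and sN: "\<And>y. s y < 1 \<Longrightarrow> y \<in> N"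
    by (rule exists_seminorm_zero[OF N(1)]) blast
  have lt: "p x < 1" if "s (j x) < 1" for x
  proof -
    have "j x \<in> j ` (p -` {..<1})" using sN[OF that] N(2) by auto
    then show ?thesis using inj by (auto dest: injD)
  qed
  have "p x \<le> s (j x)" for x
  proof (rule field_le_epsilon)
    fix e :: real assume "e > 0"
    define r where "r = s (j x) + e"
    have r: "r > 0" "s (j x) < r" using \<open>e > 0\<close> seminorm_nonneg[OF s, of "j x"] unfolding r_def by linarith+
    then have "s (j ((1 / r) *\<^sub>R x)) < 1"
      by (simp add: linear_scale[OF completion_linear] seminorm_scaleR[OF s])
    from lt[OF this] show "p x \<le> s (j x) + e"
      using r by (simp add: seminorm_scaleR[OF p] r_def[symmetric])
  qed
  with s show thesis by (rule that)
qed

text \<open>The extension is the infimal convolution of \<open>p\<close> with a continuous seminorm on the completion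
  that dominates it.\<close>

lemma ext_seminorm_cont:
  assumes p: "p \<in> cont_seminorms"
  shows "ext_seminorm j p \<in> cont_seminorms"
proof -
  obtain s where s: "s \<in> cont_seminorms" and ps: "\<And>x. p x \<le> s (j x)"
    by (rule seminorm_le_completion[OF p]) blast
  note lin = linear_add[OF completion_linear] linear_scale[OF completion_linear]
    linear_diff[OF completion_linear] linear_0[OF completion_linear]
  define q where "q y = (INF x. p x + s (y - j x))" for y
  have bdd: "bdd_below (range (\<lambda>x. p x + s (y - j x)))" for y
    by (rule bdd_belowI[of _ 0]) (auto simp: seminorm_nonneg[OF p] seminorm_nonneg[OF s])
  have q_le: "q y \<le> p x + s (y - j x)" for x y
    unfolding q_def by (rule cINF_lower[OF bdd]) simp
  have q_ge: "c \<le> q y" if "\<And>x. c \<le> p x + s (y - j x)" for c y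
    unfolding q_def using that by (intro cINF_greatest) auto
  have q_approx: "\<exists>x. p x + s (y - j x) < q y + e" if "e > 0" for y e
  proof (rule ccontr)
    assume "\<not> ?thesis"
    then have "q y + e \<le> q y" by (intro q_ge) (simp add: not_less)
    with that show False by simp
  qed
  \<comment> \<open>The infimum at \<open>j x\<close> is attained by \<open>x\<close> itself:
    \<open>p x - p x'\<close> is at most \<open>p (x - x')\<close>, hence at most
    \<open>s (j x - j x')\<close>.\<close>
  have eq: "q (j x) = p x" for x
  proof (rule antisym)
    show "q (j x) \<le> p x" using q_le[of "j x" x] by (simp add: seminorm_zero[OF s])
    show "p x \<le> q (j x)"
    proof (rule q_ge)
      fix x' show "p x \<le> p x' + s (j x - j x')"
        using seminorm_diff_ge[OF p, of x x'] ps[of "x - x'"] by (simp add: lin)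
    qed
  qed
  have "q \<in> cont_seminorms"
  proof (rule seminormI)
    show add: "q (y + z) \<le> q y + q z" for y z
    proof (rule field_le_epsilon)
      fix e :: real assume "e > 0"
      then have e2: "e / 2 > 0" by simp
      obtain u v where uv: "p u + s (y - j u) < q y + e / 2" "p v + s (z - j v) < q z + e / 2"
        using q_approx[OF e2] by meson
      have "q (y + z) \<le> p (u + v) + s ((y - j u) + (z - j v))"
        using q_le[of "y + z" "u + v"] by (simp add: lin algebra_simps)
      also have "\<dots> \<le> (p u + p v) + (s (y - j u) + s (z - j v))"
        by (intro add_mono seminorm_add[OF p] seminorm_add[OF s])
      finally show "q (y + z) \<le> q y + q z + e" using uv by simp
    qed
    have sc_le: "q (c *\<^sub>R y) \<le> \<bar>c\<bar> * q y" if "c \<noteq> 0" for c y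
    proof (rule field_le_epsilon)
      fix e :: real assume "e > 0"
      then have "e / \<bar>c\<bar> > 0" using that by simp
      then obtain u where u: "p u + s (y - j u) < q y + e / \<bar>c\<bar>" using q_approx by meson
      have "q (c *\<^sub>R y) \<le> p (c *\<^sub>R u) + s (c *\<^sub>R (y - j u))"
        using q_le[of "c *\<^sub>R y" "c *\<^sub>R u"] by (simp add: lin scaleR_diff_right)
      also have "\<dots> = \<bar>c\<bar> * (p u + s (y - j u))"
        by (simp only: seminorm_scaleR[OF p] seminorm_scaleR[OF s] distrib_left)
      also have "\<dots> \<le> \<bar>c\<bar> * (q y + e / \<bar>c\<bar>)"
        using u by (intro mult_left_mono) auto
      also have "\<dots> = \<bar>c\<bar> * q y + e" using that by (simp add: distrib_left)
      finally show "q (c *\<^sub>R y) \<le> \<bar>c\<bar> * q y + e" .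
    qed
    show "q (c *\<^sub>R y) = \<bar>c\<bar> * q y" for c y
    proof (cases "c = 0")
      case True
      then show ?thesis using eq[of 0] by (simp add: lin seminorm_zero[OF p])
    next
      case False
      have "\<bar>c\<bar> * q y = \<bar>c\<bar> * q ((1 / c) *\<^sub>R (c *\<^sub>R y))" using False by simp
      also have "\<dots> \<le> \<bar>c\<bar> * (\<bar>1 / c\<bar> * q (c *\<^sub>R y))"
        using False by (intro mult_left_mono sc_le) auto
      also have "\<dots> = q (c *\<^sub>R y)" using False by simp
      finally show ?thesis using sc_le[OF False, of y] by simp
    qed
    fix e :: real assume e: "e > 0"
    have "(s \<longlongrightarrow> s 0) (nhds 0)" by (rule tendsto_seminorm[OF s]) (rule filterlim_ident)
    then have "\<forall>\<^sub>F y in nhds 0. s y < e"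
      using e by (intro order_tendstoD(2)) (simp_all add: seminorm_zero[OF s])
    then show "\<forall>\<^sub>F y in nhds 0. q y < e"
      by (rule eventually_mono) (use q_le[of _ 0] in \<open>auto simp: lin seminorm_zero[OF p] intro: le_less_trans\<close>)
  qed
  \<comment> \<open>The \<open>THE\<close> is resolved by density: continuous real functions that
    agree on the range of \<open>j\<close> agree everywhere.\<close>
  moreover have "ext_seminorm j p = q"
    unfolding ext_seminorm_def
  proof (rule the_equality)
    show "continuous_on UNIV q \<and> (\<forall>x. q (j x) = p x)"
      using calculation eq by (simp add: seminorm_cont)
    fix r assume r: "continuous_on UNIV r \<and> (\<forall>x. r (j x) = p x)"
    have "closed {y. r y = q y}"
      by (rule closed_Collect_eq) (use r calculation in \<open>auto simp: seminorm_cont\<close>)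
    moreover have "range j \<subseteq> {y. r y = q y}" using r eq by auto
    ultimately have "closure (range j) \<subseteq> {y. r y = q y}" by (rule closure_minimal[rotated])
    then show "r = q" using completion_dense by auto
  qed
  ultimately show "ext_seminorm j p \<in> cont_seminorms" by simp
qed

text \<open>Composing with \<open>j\<close> turns seminorms of the completion into seminorms of
  \<open>'e\<close>, so the property transfers. Completeness then supplies \<open>\<beta>\<close>
  pointwise, and uniformity is tested with the extended seminorms.\<close>

lemma near_riemann_sums_completion:
  assumes R: "near_riemann_sums D f"
  shows "\<exists>\<beta>. (\<forall>t\<in>{0..1}. has_riemann_integral (\<lambda>s. j (f s)) (\<beta> t) 0 t) \<and>
    uniform_limit_completion j D \<beta>"
proof -
  have R': "near_riemann_sums (\<lambda>h t. j (D h t)) (\<lambda>s. j (f s))"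
    unfolding near_riemann_sums_def
  proof (intro ballI allI impI)
    fix p :: "'f \<Rightarrow> real" and e :: real assume p: "p \<in> cont_seminorms" and e: "e > 0"
    have "p (j y - (\<Sum>(x, K)\<in>P. Henstock_Kurzweil_Integration.content K *\<^sub>R j (f x))) =
        p (j (y - (\<Sum>(x, K)\<in>P. Henstock_Kurzweil_Integration.content K *\<^sub>R f x)))"
      for y and P :: "(real \<times> real set) set"
      by (simp add: linear_diff[OF completion_linear] linear_sum[OF completion_linear] case_prod_unfold
          linear_scale[OF completion_linear])
    then show "\<exists>\<delta>>0. \<forall>\<^sub>F h in at 0. \<forall>t\<in>{0..1}. \<forall>P. P tagged_division_of {0..t} \<longrightarrow> (\<lambda>x. ball x \<delta>) fine P \<longrightarrow>
        p (j (D h t) - (\<Sum>(x, K)\<in>P. Henstock_Kurzweil_Integration.content K *\<^sub>R j (f x))) \<le> e"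
      using R[unfolded near_riemann_sums_def, rule_format, OF seminorm_completion_comp[OF p] e] by simp
  qed
  obtain \<beta> where \<beta>: "\<And>t. t \<in> {0..1} \<Longrightarrow> ((\<lambda>h. j (D h t)) \<longlongrightarrow> \<beta> t) (at 0)"
    using near_riemann_sums_convergent[OF R'] by metis
  have "has_riemann_integral (\<lambda>s. j (f s)) (\<beta> t) 0 t" if "t \<in> {0..1}" for t
    using near_riemann_sums_tendsto_iff[OF R' that] \<beta>[OF that] by blast
  moreover have "uniform_limit_completion j D \<beta>"
    unfolding uniform_limit_completion_def
  proof (intro ballI)
    fix p :: "'e \<Rightarrow> real" assume p: "p \<in> cont_seminorms"
    note q = ext_seminorm_cont[OF p]
    let ?S = "\<lambda>h. SUP t\<in>{0..1}. ereal (ext_seminorm j p (j (D h t) - \<beta> t))"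
    show "(?S \<longlongrightarrow> 0) (at 0)"
    proof (rule order_tendstoI)
      fix a :: ereal assume "a < 0"
      have "0 \<le> ?S h" for h
        by (rule SUP_upper2[of 0]) (simp_all add: seminorm_nonneg[OF q])
      then show "\<forall>\<^sub>F h in at 0. a < ?S h"
        using \<open>a < 0\<close> by (intro always_eventually allI) (rule less_le_trans)
    next
      fix a :: ereal assume "0 < a"
      then obtain e where e: "0 < ereal e" "ereal e < a" using ereal_dense2 by blast
      then have "e > 0" by simp
      have "\<forall>\<^sub>F h in at 0. \<forall>t\<in>{0..1}. ext_seminorm j p (j (D h t) - \<beta> t) \<le> e"
        by (rule near_riemann_sums_uniform[OF R' q \<open>e > 0\<close> \<beta>])
      then show "\<forall>\<^sub>F h in at 0. ?S h < a"
      proof eventually_elim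
        case (elim h)
        have "?S h \<le> ereal e" using elim by (intro SUP_least) simp
        then show ?case using e(2) by (rule le_less_trans)
      qed
    qed
  qed
  ultimately show ?thesis by blast
qed

end

section \<open>Differentiability of the evolution map\<close>

context
  fixes G :: "('g::t2_space, 'e::locally_convex_space, 'm) lie_group_data_scheme"
  assumes G: "lie_group G"
begin

interpretation group G by (rule lie_group_group[OF G])

lemma linear_tlift:
  assumes c: "c \<in> charts_at (atlas G) g"
  shows "linear (tlift G c g)"
proof -
  have "linear (dtrans G c c' \<one>\<^bsub>G\<^esub> g \<one>\<^bsub>G\<^esub>)" if "c' \<in> charts_at (atlas G) g" for c'
    using that by (intro linear_dtrans[OF G c]) (simp add: mem_carrier[OF G])
  note lin = linear_add[OF this] linear_scale[OF this]
  show ?thesis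
    by (rule linearI; rule tvec.expand, rule ext) (simp_all add: tlift_def[OF G] lin)
qed

lemma continuous_tlift:
  assumes c: "c \<in> charts_at (atlas G) g"
  shows "continuous_on UNIV (tlift G c g)"
  unfolding continuous_on_def
proof
  fix X :: 'e
  show "(tlift G c g \<longlongrightarrow> tlift G c g X) (at X within UNIV)"
  proof (rule tendsto_tvecI)
    fix c'
    show "((\<lambda>X. coord (tlift G c g X) c') \<longlongrightarrow> coord (tlift G c g X) c') (at X within UNIV)"
    proof (cases "c' \<in> charts_at (atlas G) g")
      case True
      then have "c' \<in> charts_at (atlas G) (\<one>\<^bsub>G\<^esub> \<otimes>\<^bsub>G\<^esub> g \<otimes>\<^bsub>G\<^esub> \<one>\<^bsub>G\<^esub>)"
        by (simp add: mem_carrier[OF G])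
      from dtrans_tendsto[OF G tendsto_const tendsto_const tendsto_ident_at c this]
      show ?thesis using True by (simp add: tlift_def[OF G])
    qed (simp add: tlift_def[OF G])
  qed
qed

text \<open>Evaluation in the chart and \<open>tlift\<close> are continuous linear maps, so both
  preserve Riemann integrals; they are mutually inverse on the Lie algebra, where \<open>T\<close>
  and \<open>v\<close> live.\<close>

lemma has_riemann_integral_lie_algebra_iff:
  assumes c: "c \<in> charts_at (atlas G) \<one>\<^bsub>G\<^esub>" and v: "v \<in> lie_algebra G"
    and T: "\<And>s. s \<in> {a..b} \<Longrightarrow> T s \<in> lie_algebra G"
  shows "has_riemann_integral T v a b \<longleftrightarrow> has_riemann_integral (\<lambda>s. coord (T s) c) (coord v c) a b"
proof
  assume "has_riemann_integral T v a b"
  from has_riemann_integral_linear[OF _ continuous_on_coord this, of c]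
  show "has_riemann_integral (\<lambda>s. coord (T s) c) (coord v c) a b"
    by (simp add: linear_iff)
next
  assume "has_riemann_integral (\<lambda>s. coord (T s) c) (coord v c) a b"
  from has_riemann_integral_linear[OF linear_tlift[OF c] continuous_tlift[OF c] this]
  have I: "has_riemann_integral (\<lambda>s. tlift G c \<one>\<^bsub>G\<^esub> (coord (T s) c)) (tlift G c \<one>\<^bsub>G\<^esub> (coord v c)) a b" .
  have eq: "tlift G c \<one>\<^bsub>G\<^esub> (coord \<xi> c) = \<xi>" if "\<xi> \<in> lie_algebra G" for \<xi>
    using tlift_coord[OF G c] that unfolding lie_algebra_def by blast
  have "has_riemann_integral (\<lambda>s. tlift G c \<one>\<^bsub>G\<^esub> (coord (T s) c)) v a b \<longleftrightarrow> has_riemann_integral T v a b"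
    by (rule has_riemann_integral_cong) (rule eq[OF T])
  with I show "has_riemann_integral T v a b" unfolding eq[OF v] by blast
qed

lemma has_curve_derivative_translate:
  assumes c: "c \<in> charts_at (atlas G) \<one>\<^bsub>G\<^esub>" and v: "v \<in> lie_algebra G"
    and a: "tangent_pair c (at 0) (\<lambda>h. h) (\<lambda>_. \<one>\<^bsub>G\<^esub>) a \<one>\<^bsub>G\<^esub> (coord v c)"
    and f: "\<And>h. f h = g \<otimes>\<^bsub>G\<^esub> a h" "f 0 = g"
  shows "has_curve_derivative (atlas G) f (tmap (atlas G) (\<lambda>z. g \<otimes>\<^bsub>G\<^esub> z) \<one>\<^bsub>G\<^esub> v)"
proof -
  let ?w = "tmap (atlas G) (\<lambda>z. g \<otimes>\<^bsub>G\<^esub> z) \<one>\<^bsub>G\<^esub> v"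
  note v' = v[unfolded lie_algebra_def]
  have "tangent_to (atlas G) (at 0) (\<lambda>h. h) (\<lambda>h. g \<otimes>\<^bsub>G\<^esub> a h \<otimes>\<^bsub>G\<^esub> \<one>\<^bsub>G\<^esub>) (g \<otimes>\<^bsub>G\<^esub> \<one>\<^bsub>G\<^esub> \<otimes>\<^bsub>G\<^esub> \<one>\<^bsub>G\<^esub>)
      (tmap (atlas G) (\<lambda>z. g \<otimes>\<^bsub>G\<^esub> z \<otimes>\<^bsub>G\<^esub> \<one>\<^bsub>G\<^esub>) \<one>\<^bsub>G\<^esub> v)"
    by (rule tangent_to_tmap[OF G tangent_toI[OF G v' c filterlim_ident a] filterlim_ident])
  then have t: "tangent_to (atlas G) (at 0) (\<lambda>h. h) f g ?w"
    by (simp add: mem_carrier[OF G] f(1)[symmetric])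
  have w: "?w \<in> tangent_space (atlas G) g"
    using tmap_translate_tangent_space[OF G v', of g "\<one>\<^bsub>G\<^esub>"] by (simp add: mem_carrier[OF G])
  obtain d where d: "d \<in> charts_at (atlas G) g" using charts_at_ne[OF G] by meson
  have "(f \<longlongrightarrow> g) (at 0)" and q: "((\<lambda>h. (1 / h) *\<^sub>R (snd d (f h) - snd d g)) \<longlongrightarrow> coord ?w d) (at 0)"
    using t d unfolding tangent_to_def tangent_pair_def by auto
  from topological_tendstoD[OF this(1) chart_open[OF charts_at_is_chart[OF G d]] charts_at_mem[OF G d]]
  have "\<forall>\<^sub>F h in at 0. f h \<in> fst d" .
  with w d q show ?thesis
    unfolding has_curve_derivative_def d_chart_def f(2) by blast
qed

text \<open>Left translation by the inverse of \<open>g\<close> brings the derivative back to the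
  unit. Convergence of \<open>a\<close> to the unit provides the convergence of \<open>f\<close>
  that a pair includes.\<close>

lemma has_curve_derivative_untranslate:
  assumes c: "c \<in> charts_at (atlas G) \<one>\<^bsub>G\<^esub>"
    and w: "has_curve_derivative (atlas G) f w"
    and f: "\<And>h. f h = g \<otimes>\<^bsub>G\<^esub> a h" "f 0 = g" and a: "(a \<longlongrightarrow> \<one>\<^bsub>G\<^esub>) (at 0)"
  shows "\<exists>X. tangent_pair c (at 0) (\<lambda>h. h) (\<lambda>_. \<one>\<^bsub>G\<^esub>) a \<one>\<^bsub>G\<^esub> X"
proof -
  obtain d where d: "d \<in> charts_at (atlas G) g"
    and q: "((\<lambda>h. (1 / h) *\<^sub>R (snd d (f h) - snd d g)) \<longlongrightarrow> d_chart d w) (at 0)"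
    using w unfolding has_curve_derivative_def f(2) by blast
  have "((\<lambda>h. g \<otimes>\<^bsub>G\<^esub> a h) \<longlongrightarrow> g \<otimes>\<^bsub>G\<^esub> \<one>\<^bsub>G\<^esub>) (at 0)"
    by (intro tendsto_mult_lie[OF G] tendsto_const a)
  then have "(f \<longlongrightarrow> g) (at 0)"
    by (simp add: mem_carrier[OF G] f(1)[symmetric])
  with q have p: "tangent_pair d (at 0) (\<lambda>h. h) (\<lambda>_. g) f g (d_chart d w)"
    unfolding tangent_pair_def by simp
  have "c \<in> charts_at (atlas G) (inv\<^bsub>G\<^esub> g \<otimes>\<^bsub>G\<^esub> g \<otimes>\<^bsub>G\<^esub> \<one>\<^bsub>G\<^esub>)"
    using c by (simp add: mem_carrier[OF G])
  from tangent_pair_translate[OF G filterlim_ident tendsto_const tendsto_const d this p]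
  show ?thesis
    by (auto simp add: mem_carrier[OF G] f(1) inv_mult_cancel[OF G])
qed

end

theorem theoremE:
  fixes G :: "('g::t2_space, 'e::locally_convex_space, 'm) lie_group_data_scheme"
    and \<Xi> :: "('g, 'e) chart"
    and j :: "'e \<Rightarrow> 'f::{locally_convex_space,uniform_topological_group_add,complete_uniform_space}"
    and k :: curve_class
    and I :: "real set" and x :: real
    and \<Phi> :: "real \<Rightarrow> real \<Rightarrow> ('g, 'e) tvec"
    and d\<Phi> :: "real \<Rightarrow> ('g, 'e) tvec"
  assumes "lie_group G"
    and "\<Xi> \<in> atlas G" and "\<one>\<^bsub>G\<^esub> \<in> fst \<Xi>" and "snd \<Xi> \<one>\<^bsub>G\<^esub> = 0" and "convex (snd \<Xi> ` fst \<Xi>)"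
    and "is_completion j"
    and "mackey_continuous G \<Xi> k"
    and "k = Const \<Longrightarrow> comm_group G"
    and "open I"
    and "\<And>z. z \<in> I \<Longrightarrow> \<Phi> z \<in> evol_domain_k G \<Xi> k"
    and "x \<in> I"
    and "\<And>t. t \<in> {0..1} \<Longrightarrow> ((\<lambda>h. (1 / h) *\<^sub>R (\<Phi> (x + h) t - \<Phi> x t)) \<longlongrightarrow> d\<Phi> t) (at 0)"
    and "d\<Phi> \<in> alg_curves G \<Xi> k"
    and "\<And>p s. p \<in> cont_seminorms \<Longrightarrow> s \<preceq> k \<Longrightarrow>
           \<exists>L\<ge>0. \<exists>J. open J \<and> J \<subseteq> I \<and> x \<in> J \<and>
             (\<forall>h. h \<noteq> 0 \<and> x + h \<in> J \<longrightarrow>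
                ereal (1 / \<bar>h\<bar>) * sup_seminorm (p \<circ> d_chart \<Xi>) s (\<lambda>t. \<Phi> (x + h) t - \<Phi> x t)
                  \<le> ereal L)"
  shows "(\<forall>\<^sub>F h in at 0. \<forall>t\<in>{0..1}.
            inv\<^bsub>G\<^esub> (Evol G (\<Phi> x) t) \<otimes>\<^bsub>G\<^esub> Evol G (\<Phi> (x + h)) t \<in> fst \<Xi>) \<and>
         (\<exists>\<beta>. (\<forall>t\<in>{0..1}. has_riemann_integral
                 (\<lambda>s. j (d_chart \<Xi> (Ad G (inv\<^bsub>G\<^esub> (Evol G (\<Phi> x) s)) (d\<Phi> s)))) (\<beta> t) 0 t) \<and>
             uniform_limit_completion j
               (\<lambda>h t. (1 / h) *\<^sub>R
                  snd \<Xi> (inv\<^bsub>G\<^esub> (Evol G (\<Phi> x) t) \<otimes>\<^bsub>G\<^esub> Evol G (\<Phi> (x + h)) t)) \<beta>) \<and>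
         ((\<exists>w. has_curve_derivative (atlas G) (\<lambda>h. evol G (\<Phi> (x + h))) w) \<longleftrightarrow>
          (\<exists>v\<in>lie_algebra G.
             has_riemann_integral (\<lambda>s. Ad G (inv\<^bsub>G\<^esub> (Evol G (\<Phi> x) s)) (d\<Phi> s)) v 0 1)) \<and>
         (\<forall>v\<in>lie_algebra G.
            has_riemann_integral (\<lambda>s. Ad G (inv\<^bsub>G\<^esub> (Evol G (\<Phi> x) s)) (d\<Phi> s)) v 0 1 \<longrightarrow>
            has_curve_derivative (atlas G) (\<lambda>h. evol G (\<Phi> (x + h)))
              (tmap (atlas G) (\<lambda>g. evol G (\<Phi> x) \<otimes>\<^bsub>G\<^esub> g) \<one>\<^bsub>G\<^esub> v))"
proof -
  note G = assms(1) and \<Phi> = assms(10) and xI = assms(11) and bdd = assms(14)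
  interpret group G by (rule lie_group_group[OF G])
  have \<Xi>: "\<Xi> \<in> charts_at (atlas G) \<one>\<^bsub>G\<^esub>"
    using assms(2,3) by (simp add: charts_at_def)
  let ?E = "Evol G (\<Phi> x)"
  define \<alpha> where "\<alpha> h t = inv\<^bsub>G\<^esub> (?E t) \<otimes>\<^bsub>G\<^esub> Evol G (\<Phi> (x + h)) t" for h t
  define D where "D h t = (1 / h) *\<^sub>R snd \<Xi> (\<alpha> h t)" for h t
  define W where "W t = coord (d\<Phi> t) \<Xi>" for t
  define Z where "Z h t = (1 / h) *\<^sub>R (coord (\<Phi> (x + h) t) \<Xi> - coord (\<Phi> x t) \<Xi>)" for h t
  define T where "T s = Ad G (inv\<^bsub>G\<^esub> (?E s)) (d\<Phi> s)" for s
  have dom: "\<Phi> z \<in> evol_domain G" and alg: "\<Phi> z \<in> alg_curves G \<Xi> k" if "z \<in> I" for z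
    using \<Phi>[OF that] by (simp_all add: evol_domain_k_def)
  have unif: "\<forall>\<^sub>F h in at 0. \<forall>t\<in>{0..1}. \<alpha> h t \<in> U" if "open U" "\<one>\<^bsub>G\<^esub> \<in> U" for U
    unfolding \<alpha>_def by (rule mackey_Evol_uniform[OF assms(7,9) xI \<Phi> bdd that])
  have "((\<lambda>h. x + h) \<longlongrightarrow> x + 0) (at 0)" by (intro tendsto_intros)
  then have "((\<lambda>h. x + h) \<longlongrightarrow> x) (at 0)" by simp
  note near_x = topological_tendstoD[OF this]
  have inI: "\<forall>\<^sub>F h in at 0. x + h \<in> I" by (rule near_x[OF assms(9) xI])
  have contW: "continuous_on {0..1} W"
    unfolding W_def by (rule alg_curve_continuous[OF assms(13)])
  have contZ: "\<forall>\<^sub>F h in at 0. continuous_on {0..1} (Z h)"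
    using inI
  proof eventually_elim
    case (elim h)
    show ?case
      unfolding Z_def by (intro continuous_on_scaleR_lcs continuous_on_const continuous_on_diff
          alg_curve_continuous[OF alg[OF elim]] alg_curve_continuous[OF alg[OF xI]])
  qed
  have limZ: "((\<lambda>h. Z h t) \<longlongrightarrow> W t) (at 0)" if "t \<in> {0..1}" for t
    using tendsto_coord[OF assms(12)[OF that], of \<Xi>] by (simp add: Z_def W_def)
  \<comment> \<open>Only values of the curves matter here, so b) is used at the single index
    supplied by \<open>sup_seminorm_upper\<close>.\<close>
  have bddZ: "\<exists>L. \<forall>\<^sub>F h in at 0. \<forall>t\<in>{0..1}. p (Z h t) \<le> L" if p: "p \<in> cont_seminorms" for p
  proof -
    obtain s where s: "s \<preceq> k" and upper: "\<And>q \<gamma> t. t \<in> {0..1} \<Longrightarrow>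
        ereal (q (\<gamma> t :: ('g, 'e) tvec)) \<le> sup_seminorm q s \<gamma>"
      by (rule sup_seminorm_upper[where k = k]) blast
    obtain L J where L: "L \<ge> 0" and J: "open J" "x \<in> J" and LJ: "\<And>h. h \<noteq> 0 \<Longrightarrow> x + h \<in> J \<Longrightarrow>
        ereal (1 / \<bar>h\<bar>) * sup_seminorm (p \<circ> d_chart \<Xi>) s (\<lambda>t. \<Phi> (x + h) t - \<Phi> x t) \<le> ereal L"
      using bdd[OF p s] by blast
    have "\<forall>\<^sub>F h in at 0. \<forall>t\<in>{0..1}. p (Z h t) \<le> L"
      using near_x[OF J] eventually_neq_at_within[of 0 0 UNIV]
    proof (eventually_elim, intro ballI)
      fix h t assume h: "x + h \<in> J" "h \<noteq> 0" and t: "t \<in> {0..1::real}"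
      let ?q = "p \<circ> d_chart \<Xi>" and ?\<gamma> = "\<lambda>t. \<Phi> (x + h) t - \<Phi> x t"
      have "ereal (p (Z h t)) = ereal (1 / \<bar>h\<bar>) * ereal (?q (?\<gamma> t))"
        by (simp add: Z_def d_chart_def seminorm_scaleR[OF p])
      also have "\<dots> \<le> ereal (1 / \<bar>h\<bar>) * sup_seminorm ?q s ?\<gamma>"
        by (intro ereal_mult_left_mono upper[OF t, of ?q ?\<gamma>]) simp
      also have "\<dots> \<le> ereal L" by (rule LJ[OF h(2,1)])
      finally show "p (Z h t) \<le> L" by simp
    qed
    then show ?thesis by blast
  qed
  \<comment> \<open>At the unit the two translations in \<open>qvel\<close> are inverse to each
    other, so it is conjugation by the inverse of \<open>?E s\<close>, that is, the adjoint
    action.\<close>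
  have T: "T s \<in> lie_algebra G" and T_qvel: "coord (T s) \<Xi> = qvel G \<Xi> (\<Phi> x) s \<one>\<^bsub>G\<^esub> (W s)"
    if "s \<in> {0..1}" for s
  proof -
    note d = alg_curve_lie_algebra[OF assms(13) that]
    show "T s \<in> lie_algebra G" unfolding T_def by (rule Ad_lie_algebra[OF G d])
    show "coord (T s) \<Xi> = qvel G \<Xi> (\<Phi> x) s \<one>\<^bsub>G\<^esub> (W s)"
      unfolding T_def coord_Ad[OF G d \<Xi>] qvel_def[OF G \<Xi> dom[OF xI]] W_def
      by (simp add: mem_carrier[OF G])
  qed
  have R: "near_riemann_sums D (\<lambda>s. qvel G \<Xi> (\<Phi> x) s \<one>\<^bsub>G\<^esub> (W s))"
    unfolding near_riemann_sums_def
  proof (intro ballI allI impI)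
    fix p :: "'e \<Rightarrow> real" and e :: real assume p: "p \<in> cont_seminorms" and e: "e > 0"
    have \<psi>: "\<forall>\<^sub>F h in at 0. \<Phi> (x + h) \<in> evol_domain G"
      using inI by (rule eventually_mono) (rule dom)
    show "\<exists>\<delta>>0. \<forall>\<^sub>F h in at 0. \<forall>t\<in>{0..1}. \<forall>P. P tagged_division_of {0..t} \<longrightarrow> (\<lambda>x. ball x \<delta>) fine P \<longrightarrow>
        p (D h t - (\<Sum>(s, K)\<in>P. Henstock_Kurzweil_Integration.content K *\<^sub>R qvel G \<Xi> (\<Phi> x) s \<one>\<^bsub>G\<^esub> (W s))) \<le> e"
      (is "\<exists>\<delta>>0. ?Q \<delta>")
    proof -
      obtain \<delta> where "\<delta> > 0" "?Q \<delta>"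
        by (rule quotient_near_riemann_sums[OF G \<Xi> dom[OF xI] assms(4) \<psi> \<alpha>_def unif Z_def contZ contW
              limZ bddZ D_def p e])
      then show ?thesis by (intro exI conjI)
    qed
  qed
  have part1: "\<forall>\<^sub>F h in at 0. \<forall>t\<in>{0..1}. \<alpha> h t \<in> fst \<Xi>"
    by (rule unif[OF chart_open[OF charts_at_is_chart[OF G \<Xi>]] assms(3)])
  have part2: "\<exists>\<beta>. (\<forall>t\<in>{0..1}. has_riemann_integral (\<lambda>s. j (coord (T s) \<Xi>)) (\<beta> t) 0 t) \<and>
      uniform_limit_completion j D \<beta>"
  proof -
    obtain \<beta> where \<beta>: "\<forall>t\<in>{0..1}. has_riemann_integral
        (\<lambda>s. j (qvel G \<Xi> (\<Phi> x) s \<one>\<^bsub>G\<^esub> (W s))) (\<beta> t) 0 t" "uniform_limit_completion j D \<beta>"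
      using near_riemann_sums_completion[OF assms(6) R] by blast
    have "has_riemann_integral (\<lambda>s. j (coord (T s) \<Xi>)) (\<beta> t) 0 t" if t: "t \<in> {0..1}" for t
    proof (rule has_riemann_integral_cong[THEN iffD1, OF _ bspec[OF \<beta>(1) t]])
      fix s assume "s \<in> {0..t}"
      then have "s \<in> {0..1}" using t by auto
      then show "j (qvel G \<Xi> (\<Phi> x) s \<one>\<^bsub>G\<^esub> (W s)) = j (coord (T s) \<Xi>)" by (simp only: T_qvel)
    qed
    with \<beta>(2) show ?thesis by blast
  qed
  have one: "(1::real) \<in> {0..1}" by simp
  have \<alpha>_lim: "((\<lambda>h. \<alpha> h 1) \<longlongrightarrow> \<one>\<^bsub>G\<^esub>) (at 0)"
  proof (rule topological_tendstoI)
    fix U assume "open U" "\<one>\<^bsub>G\<^esub> \<in> U"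
    from unif[OF this] show "\<forall>\<^sub>F h in at 0. \<alpha> h 1 \<in> U" by (rule eventually_mono) simp
  qed
  \<comment> \<open>The chart sends the unit to 0, so \<open>D h 1\<close> is exactly the difference
    quotient of \<open>\<alpha> h 1\<close> against the constant unit.\<close>
  have pair_iff: "tangent_pair \<Xi> (at 0) (\<lambda>h. h) (\<lambda>_. \<one>\<^bsub>G\<^esub>) (\<lambda>h. \<alpha> h 1) \<one>\<^bsub>G\<^esub> X \<longleftrightarrow>
      has_riemann_integral (\<lambda>s. coord (T s) \<Xi>) X 0 1" for X
  proof -
    have "has_riemann_integral (\<lambda>s. coord (T s) \<Xi>) X 0 1 \<longleftrightarrow>
        has_riemann_integral (\<lambda>s. qvel G \<Xi> (\<Phi> x) s \<one>\<^bsub>G\<^esub> (W s)) X 0 1"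
      by (rule has_riemann_integral_cong) (rule T_qvel)
    also have "\<dots> \<longleftrightarrow> ((\<lambda>h. D h 1) \<longlongrightarrow> X) (at 0)"
      by (rule near_riemann_sums_tendsto_iff[OF R one, symmetric])
    finally show ?thesis
      using \<alpha>_lim by (simp add: tangent_pair_def D_def assms(4))
  qed
  have evol: "evol G (\<Phi> (x + h)) = evol G (\<Phi> x) \<otimes>\<^bsub>G\<^esub> \<alpha> h 1" for h
    unfolding evol_def \<alpha>_def by (simp add: inv_mult_cancel[OF G])
  have T_int: "has_riemann_integral T v 0 1 \<longleftrightarrow>
      tangent_pair \<Xi> (at 0) (\<lambda>h. h) (\<lambda>_. \<one>\<^bsub>G\<^esub>) (\<lambda>h. \<alpha> h 1) \<one>\<^bsub>G\<^esub> (coord v \<Xi>)"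
    if "v \<in> lie_algebra G" for v
    unfolding pair_iff by (rule has_riemann_integral_lie_algebra_iff[OF G \<Xi> that T])
  have part4: "has_curve_derivative (atlas G) (\<lambda>h. evol G (\<Phi> (x + h)))
      (tmap (atlas G) (\<lambda>g. evol G (\<Phi> x) \<otimes>\<^bsub>G\<^esub> g) \<one>\<^bsub>G\<^esub> v)"
    if v: "v \<in> lie_algebra G" and I: "has_riemann_integral T v 0 1" for v
    by (rule has_curve_derivative_translate[OF G \<Xi> v I[unfolded T_int[OF v]] evol]) simp
  have part3: "(\<exists>w. has_curve_derivative (atlas G) (\<lambda>h. evol G (\<Phi> (x + h))) w) \<longleftrightarrow>
      (\<exists>v\<in>lie_algebra G. has_riemann_integral T v 0 1)"
  proof
    assume "\<exists>w. has_curve_derivative (atlas G) (\<lambda>h. evol G (\<Phi> (x + h))) w"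
    then obtain w where "has_curve_derivative (atlas G) (\<lambda>h. evol G (\<Phi> (x + h))) w" by blast
    \<comment> \<open>A derivative, in whatever chart it is witnessed, yields a coordinate vector
      \<open>X\<close> at the unit; its lift to the Lie algebra is the integral.\<close>
    from has_curve_derivative_untranslate[OF G \<Xi> this evol _ \<alpha>_lim]
    obtain X where X: "tangent_pair \<Xi> (at 0) (\<lambda>h. h) (\<lambda>_. \<one>\<^bsub>G\<^esub>) (\<lambda>h. \<alpha> h 1) \<one>\<^bsub>G\<^esub> X" by auto
    have v: "tlift G \<Xi> \<one>\<^bsub>G\<^esub> X \<in> lie_algebra G"
      unfolding lie_algebra_def by (rule tlift_tangent_space[OF G \<Xi>])
    from X have "has_riemann_integral T (tlift G \<Xi> \<one>\<^bsub>G\<^esub> X) 0 1"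
      unfolding T_int[OF v] coord_tlift[OF G \<Xi>] .
    with v show "\<exists>v\<in>lie_algebra G. has_riemann_integral T v 0 1" by blast
  qed (use part4 in blast)
  show ?thesis
    using part1 part2 part3 part4 unfolding \<alpha>_def D_def T_def d_chart_def by blast
qed

end
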